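(* Let $\boldsymbol u$ be a smooth divergence-free velocity field on $V\times[0,\infty)$ satisfying the no-penetration condition $\boldsymbol u\cdot\boldsymbol e_z=0$ on $z=0,1$. Let $T$ be a smooth solution on $[0,\infty)$ of the temperature equation $$\partial_tT+\nabla\cdot(\boldsymbol uT)=\frac1{Pe}\nabla^2T+\frac{Q}{Pe}$$ with homogeneous isothermal boundary conditions $T=0$ on $z=0,1$. Suppose that $Q\in H^1$ is time independent and that $$ U_\infty\,Pe<\frac{\pi}{\sqrt{1+\pi^2}} . $$ Then $$ \limsup_{t\to\infty}\|\nabla_{x,y}\overline T(t)\|_{L^3}\ \le\ R_3:=\frac{b_3\,C_{\mathrm S}^{1/2}\,\|Q\|_{L^2}^{1/4}}{\sqrt\pi}\left(\frac{U_\infty\,Pe\,\|Q\|_{H^1}}{\pi-\sqrt{1+\pi^2}\,U_\infty\,Pe}+\|Q\|_{L^2}\right)^{3/4}. $$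
   Context: Domain: $V=[0,L_x]\times[0,L_y]\times[0,1]$ with $L_x,L_y>0$; all fields are periodic in $x$ and $y$. $Pe>0$. Norms are over $V$, and $\|f\|_{H^1}^2=\|f\|_{L^2}^2+\|\nabla f\|_{L^2}^2$. $\overline T(x,y,z)=\int_0^zT(x,y,z')\,\mathrm dz'$, $\nabla_{x,y}=(\partial_x,\partial_y)$. $$U_\infty=C_{\mathrm S,0}\limsup_{t\to\infty}\|\boldsymbol u\|_{L^3}+C_\infty\limsup_{t\to\infty}\|\nabla\boldsymbol u\|_{L^2},$$ where $C_\infty$ and $C_{\mathrm S,0}$ are positive Sobolev–elliptic constants (depending only on $L_x,L_y$) such that $$\|\nabla T\|_{L^\infty}\le C_\infty\|\nabla^2T\|_{H^1},\qquad\|\nabla\nabla T\|_{L^6}\le C_{\mathrm S,0}\|\nabla^2T\|_{H^1}$$ for all $T\in H^3(V)$ periodic in $x,y$ with $T=0$ on $z=0,1$ ($\nabla^2$ is the Laplacian, $\nabla\nabla T$ the Hessian). $b_3=\frac{3\sin(\pi/3)}{\pi\,2^{1/3}}$. $\lambda_1=\min\{\pi,2\pi/L_x,2\pi/L_y\}$, $C_3=\frac{2^{2/3}}{\pi^{2/3}\sqrt3}$, $C_{\mathrm S}=2\sqrt2\,C_3\Big(1+\frac{\sqrt{1+L_x^{-2}+L_y^{-2}}}{\lambda_1}\Big)$. *)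

theory Defs
  imports "HOL-Analysis.Analysis" "HOL-Probability.Essential_Supremum"
begin

section \<open>Domain and periodic fields\<close>

text \<open>
  A field that is periodic in \<open>x, y\<close> is a function on \<open>real^3\<close> of which only the values on
  the closed strip \<open>\<real>\<^sup>2 \<times> [0,1]\<close> matter. The coordinates \<open>x, y, z\<close> are the components
  1, 2, 3. Norms are taken over one period cell.
\<close>

definition strip :: "(real^3) set" where
  "strip = {x. 0 \<le> x $ 3 \<and> x $ 3 \<le> 1}"

definition walls :: "(real^3) set" where
  "walls = {x. x $ 3 = 0 \<or> x $ 3 = 1}"

definition cell :: "real \<Rightarrow> real \<Rightarrow> (real^3) set" where
  "cell Lx Ly = cbox 0 (vector [Lx, Ly, 1])"

definition periodic_xy :: "real \<Rightarrow> real \<Rightarrow> (real^3 \<Rightarrow> 'b) \<Rightarrow> bool" where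
  "periodic_xy Lx Ly f \<longleftrightarrow>
     (\<forall>x\<in>strip. f (x + axis 1 Lx) = f x \<and> f (x + axis 2 Ly) = f x)"

section \<open>Smooth functions and classical differential operators\<close>

text \<open>
  Derivatives are taken within the set, so at a boundary point they are one-sided. On a closed
  convex set with nonempty interior they are unique, and \<open>smooth_on\<close> says that the
  derivatives of all orders exist and are continuous up to the boundary.
\<close>

primrec Ck_on :: "nat \<Rightarrow> 'a::euclidean_space set \<Rightarrow> ('a \<Rightarrow> 'b::real_normed_vector) \<Rightarrow> bool" where
  "Ck_on 0 S f \<longleftrightarrow> continuous_on S f"
| "Ck_on (Suc k) S f \<longleftrightarrow>
     (\<exists>f'. (\<forall>x\<in>S. (f has_derivative f' x) (at x within S)) \<and> (\<forall>v. Ck_on k S (\<lambda>x. f' x v)))"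

definition smooth_on :: "'a::euclidean_space set \<Rightarrow> ('a \<Rightarrow> 'b::real_normed_vector) \<Rightarrow> bool" where
  "smooth_on S f \<longleftrightarrow> (\<forall>k. Ck_on k S f)"

definition pd :: "3 \<Rightarrow> (real^3 \<Rightarrow> 'b::real_normed_vector) \<Rightarrow> real^3 \<Rightarrow> 'b" where
  "pd i f x = frechet_derivative f (at x within strip) (axis i 1)"

text \<open>
  For a vector field the gradient is a matrix, whose norm in \<open>(real^3)^3\<close> is the Frobenius norm.
\<close>

definition grad :: "(real^3 \<Rightarrow> 'b::real_normed_vector) \<Rightarrow> real^3 \<Rightarrow> 'b^3" where
  "grad f x = (\<chi> i. pd i f x)"

definition grad_xy :: "(real^3 \<Rightarrow> real) \<Rightarrow> real^3 \<Rightarrow> real^2" where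
  "grad_xy f x = vector [pd 1 f x, pd 2 f x]"

definition divergence :: "(real^3 \<Rightarrow> real^3) \<Rightarrow> real^3 \<Rightarrow> real" where
  "divergence f x = (\<Sum>i\<in>UNIV. pd i (\<lambda>y. f y $ i) x)"

definition laplacian :: "(real^3 \<Rightarrow> real) \<Rightarrow> real^3 \<Rightarrow> real" where
  "laplacian f x = (\<Sum>i\<in>UNIV. pd i (pd i f) x)"

definition zint :: "(real^3 \<Rightarrow> real) \<Rightarrow> real^3 \<Rightarrow> real" where
  "zint f x = integral {0..x $ 3} (\<lambda>s. f (vector [x $ 1, x $ 2, s]))"

section \<open>Lebesgue norms\<close>

text \<open>Norms take values in \<open>ennreal\<close>, so that an infinite norm is \<open>\<infinity>\<close>.\<close>

definition enn_powr :: "ennreal \<Rightarrow> real \<Rightarrow> ennreal" where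
  "enn_powr a q = (if a = \<infinity> then \<infinity> else ennreal (enn2real a powr q))"

definition Lp_norm :: "real \<Rightarrow> (real^3) set \<Rightarrow> (real^3 \<Rightarrow> 'b::real_normed_vector) \<Rightarrow> ennreal" where
  "Lp_norm p V f =
     enn_powr (\<integral>\<^sup>+x. ennreal (norm (f x) powr p) \<partial>lebesgue_on V) (1 / p)"

definition Linf_norm :: "(real^3) set \<Rightarrow> (real^3 \<Rightarrow> 'b::real_normed_vector) \<Rightarrow> ennreal" where
  "Linf_norm V f = esssup (lebesgue_on V) (\<lambda>x. ennreal (norm (f x)))"

section \<open>Weak derivatives and Sobolev spaces\<close>

definition test_fun :: "(real^3 \<Rightarrow> real) \<Rightarrow> bool" where
  "test_fun \<phi> \<longleftrightarrow> smooth_on UNIV \<phi> \<and> compact (closure {x. \<phi> x \<noteq> 0}) \<and>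
     closure {x. \<phi> x \<noteq> 0} \<subseteq> interior strip"

definition locally_integrable :: "(real^3 \<Rightarrow> real) \<Rightarrow> bool" where
  "locally_integrable f \<longleftrightarrow>
     (\<forall>K. compact K \<and> K \<subseteq> interior strip \<longrightarrow> set_integrable lebesgue K f)"

definition is_weak_pd :: "3 \<Rightarrow> (real^3 \<Rightarrow> real) \<Rightarrow> (real^3 \<Rightarrow> real) \<Rightarrow> bool" where
  "is_weak_pd i f g \<longleftrightarrow> locally_integrable f \<and> locally_integrable g \<and>
     (\<forall>\<phi>. test_fun \<phi> \<longrightarrow>
        (LINT x:strip|lebesgue. f x * pd i \<phi> x) = - (LINT x:strip|lebesgue. g x * \<phi> x))"

text \<open>
  A weak derivative is unique almost everywhere; the choice of a representative affects no norm.
\<close>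

definition wpd :: "3 \<Rightarrow> (real^3 \<Rightarrow> real) \<Rightarrow> real^3 \<Rightarrow> real" where
  "wpd i f = (SOME g. is_weak_pd i f g)"

definition wgrad :: "(real^3 \<Rightarrow> real) \<Rightarrow> real^3 \<Rightarrow> real^3" where
  "wgrad f x = (\<chi> i. wpd i f x)"

definition whessian :: "(real^3 \<Rightarrow> real) \<Rightarrow> real^3 \<Rightarrow> real^3^3" where
  "whessian f x = (\<chi> i j. wpd i (wpd j f) x)"

definition wlaplacian :: "(real^3 \<Rightarrow> real) \<Rightarrow> real^3 \<Rightarrow> real" where
  "wlaplacian f x = (\<Sum>i\<in>UNIV. wpd i (wpd i f) x)"

definition L2_per :: "real \<Rightarrow> real \<Rightarrow> (real^3 \<Rightarrow> real) \<Rightarrow> bool" where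
  "L2_per Lx Ly f \<longleftrightarrow> periodic_xy Lx Ly f \<and> f \<in> borel_measurable (lebesgue_on strip) \<and>
     Lp_norm 2 (cell Lx Ly) f < \<infinity>"

text \<open>
  \<open>H_per k\<close> is the space \<open>H\<^sup>k\<close> of fields periodic in \<open>x, y\<close>. The weak derivatives are
  those of the periodic field on the strip, not only on the open cell, so the derivatives
  of order less than \<open>k\<close> match across the lateral faces of the cell.
\<close>

primrec H_per :: "nat \<Rightarrow> real \<Rightarrow> real \<Rightarrow> (real^3 \<Rightarrow> real) \<Rightarrow> bool" where
  "H_per 0 Lx Ly f \<longleftrightarrow> L2_per Lx Ly f"
| "H_per (Suc k) Lx Ly f \<longleftrightarrow> L2_per Lx Ly f \<and> (\<forall>i. \<exists>g. is_weak_pd i f g \<and> H_per k Lx Ly g)"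

definition H1_norm :: "(real^3) set \<Rightarrow> (real^3 \<Rightarrow> real) \<Rightarrow> ennreal" where
  "H1_norm V f = enn_powr ((Lp_norm 2 V f)\<^sup>2 + (Lp_norm 2 V (wgrad f))\<^sup>2) (1 / 2)"

section \<open>Constants\<close>

text \<open>
  An element of \<open>H\<^sup>3\<close> has a representative that is continuous on the closed strip. The
  condition \<open>\<theta> = 0\<close> on the walls is imposed on this representative.
\<close>

definition H3_wall :: "real \<Rightarrow> real \<Rightarrow> (real^3 \<Rightarrow> real) \<Rightarrow> bool" where
  "H3_wall Lx Ly \<theta> \<longleftrightarrow>
     H_per 3 Lx Ly \<theta> \<and> continuous_on strip \<theta> \<and> (\<forall>x\<in>walls. \<theta> x = 0)"

definition sobolev_elliptic_consts :: "real \<Rightarrow> real \<Rightarrow> real \<Rightarrow> real \<Rightarrow> bool" where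
  "sobolev_elliptic_consts Lx Ly Cinf CS0 \<longleftrightarrow> 0 < Cinf \<and> 0 < CS0 \<and>
     (\<forall>\<theta>. H3_wall Lx Ly \<theta> \<longrightarrow>
        Linf_norm (cell Lx Ly) (wgrad \<theta>) \<le> ennreal Cinf * H1_norm (cell Lx Ly) (wlaplacian \<theta>) \<and>
        Lp_norm 6 (cell Lx Ly) (whessian \<theta>) \<le> ennreal CS0 * H1_norm (cell Lx Ly) (wlaplacian \<theta>))"

definition U_infty ::
    "real \<Rightarrow> real \<Rightarrow> real \<Rightarrow> real \<Rightarrow> (real \<Rightarrow> real^3 \<Rightarrow> real^3) \<Rightarrow> ennreal" where
  "U_infty Lx Ly Cinf CS0 u =
     ennreal CS0 * Limsup at_top (\<lambda>t. Lp_norm 3 (cell Lx Ly) (u t)) +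
     ennreal Cinf * Limsup at_top (\<lambda>t. Lp_norm 2 (cell Lx Ly) (grad (u t)))"

definition b3 :: real where
  "b3 = 3 * sin (pi / 3) / (pi * 2 powr (1 / 3))"

definition lambda1 :: "real \<Rightarrow> real \<Rightarrow> real" where
  "lambda1 Lx Ly = Min {pi, 2 * pi / Lx, 2 * pi / Ly}"

definition C3 :: real where
  "C3 = 2 powr (2 / 3) / (pi powr (2 / 3) * sqrt 3)"

definition CS :: "real \<Rightarrow> real \<Rightarrow> real" where
  "CS Lx Ly = 2 * sqrt 2 * C3 * (1 + sqrt (1 + 1 / Lx\<^sup>2 + 1 / Ly\<^sup>2) / lambda1 Lx Ly)"

definition R3 :: "real \<Rightarrow> real \<Rightarrow> real \<Rightarrow> real \<Rightarrow> (real^3 \<Rightarrow> real) \<Rightarrow> real" where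
  "R3 Lx Ly Pe U Q =
     (let Q2 = enn2real (Lp_norm 2 (cell Lx Ly) Q);
          QH = enn2real (H1_norm (cell Lx Ly) Q)
      in b3 * CS Lx Ly powr (1 / 2) * Q2 powr (1 / 4) / sqrt pi *
         (U * Pe * QH / (pi - sqrt (1 + pi\<^sup>2) * U * Pe) + Q2) powr (3 / 4))"

section \<open>Flow and temperature\<close>

definition admissible_velocity :: "real \<Rightarrow> real \<Rightarrow> (real \<Rightarrow> real^3 \<Rightarrow> real^3) \<Rightarrow> bool" where
  "admissible_velocity Lx Ly u \<longleftrightarrow>
     smooth_on ({0..} \<times> strip) (\<lambda>(t, x). u t x) \<and>
     (\<forall>t\<ge>0. periodic_xy Lx Ly (u t)) \<and>
     (\<forall>t\<ge>0. \<forall>x\<in>strip. divergence (u t) x = 0) \<and>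
     (\<forall>t\<ge>0. \<forall>x\<in>walls. u t x $ 3 = 0)"

text \<open>
  The equation is required for almost every \<open>x\<close>, since \<open>Q\<close> is defined only up to null sets.
\<close>

definition temperature_solution ::
    "real \<Rightarrow> real \<Rightarrow> real \<Rightarrow> (real^3 \<Rightarrow> real) \<Rightarrow> (real \<Rightarrow> real^3 \<Rightarrow> real^3)
      \<Rightarrow> (real \<Rightarrow> real^3 \<Rightarrow> real) \<Rightarrow> bool" where
  "temperature_solution Lx Ly Pe Q u T \<longleftrightarrow>
     smooth_on ({0..} \<times> strip) (\<lambda>(t, x). T t x) \<and>
     (\<forall>t\<ge>0. periodic_xy Lx Ly (T t)) \<and>
     (\<forall>t\<ge>0. \<forall>x\<in>walls. T t x = 0) \<and>
     (\<forall>t\<ge>0. AE x in lebesgue_on (cell Lx Ly).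
        vector_derivative (\<lambda>s. T s x) (at t within {0..}) + divergence (\<lambda>y. T t y *\<^sub>R u t y) x
          = 1 / Pe * laplacian (T t) x + Q x / Pe)"

end

theory Submission
  imports Defs "HOL-Real_Asymp.Real_Asymp"
begin

text \<open>
  On the walls \<open>T\<close>, \<open>\<partial>\<^sub>tT\<close> and \<open>u \<cdot> \<nabla>T\<close> vanish, hence so does \<open>S = \<nabla>\<^sup>2T + Q = Pe (\<partial>\<^sub>tT + u \<cdot> \<nabla>T)\<close>.
  Testing \<open>\<partial>\<^sub>tS = \<nabla>\<^sup>2S / Pe - \<nabla>\<^sup>2(u \<cdot> \<nabla>T)\<close> with \<open>S\<close>, bounding \<open>\<nabla>(u \<cdot> \<nabla>T)\<close> in \<open>L\<^sup>2\<close> by the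
  Sobolev-elliptic constants and using \<open>\<pi> \<parallel>S\<parallel> \<le> \<parallel>\<nabla>S\<parallel>\<close> gives the limiting bound on \<open>\<parallel>S\<parallel>\<close>, hence on
  \<open>\<parallel>\<nabla>\<^sup>2T\<parallel>\<close>; the energy balance gives \<open>limsup \<parallel>T\<parallel> \<le> \<parallel>Q\<parallel> / \<pi>\<^sup>2\<close>.

  At a fixed time, \<open>\<parallel>\<nabla>\<^sub>x\<^sub>y \<integral>T\<parallel>\<^sub>3 \<le> b\<^sub>3 \<parallel>\<nabla>\<^sub>x\<^sub>y T\<parallel>\<^sub>3\<close> is a Hardy inequality in \<open>z\<close>, and the right-hand side is interpolated
  between \<open>L\<^sup>2\<close>, where \<open>\<parallel>\<nabla>T\<parallel>\<^sup>2 \<le> \<parallel>T\<parallel> \<parallel>\<nabla>\<^sup>2T\<parallel>\<close>, and \<open>L\<^sup>6\<close>. The embedding constant \<open>C\<^sub>S\<close>, although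
  built from the sharp Sobolev constant \<open>C\<^sub>3\<close>, is large enough for the elementary
  Gagliardo--Nirenberg argument applied directly on the period cell to \<open>|\<nabla>\<^sub>x\<^sub>y T|\<^sup>4\<close>.
\<close>

section \<open>Smooth functions on closed convex sets\<close>

text \<open>The condition on \<open>U_infty\<close> says that dissipation wins: by the sharp
  Poincare inequality the H^1 norm of S is at most sqrt(1 + \<pi>^2)/\<pi> times |grad S|, so
  advection feeds at most U sqrt(1 + \<pi>^2)/\<pi> |grad S|^2 plus a term in Q, against the loss
  |grad S|^2/Pe. Testing with the Laplacian of T itself would leave boundary terms, since it equals
  - Q on the walls. The exponents of \<open>R3\<close> come from |g|_3^2 \<le> |g|_2 |g|_6 for the
  horizontal gradient g of T. With |g|_2^2 \<le> |T| |D| and |g|_6 \<le> CS |D|, D the Laplacian of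
  T, this is |g|_3 \<le> CS^(1/2) |T|^(1/4) |D|^(3/4); the limiting bound on |T| then supplies
  |Q|^(1/4)/sqrt \<pi>. Two features of the formulation shape the proof. Fields are smooth up to the
  walls and up to time 0, where derivatives are one-sided, so calculus on closed convex sets has to
  be set up, symmetry of mixed derivatives included. And the elliptic constants and the norms of Q
  refer to weak derivatives picked by choice, which must be matched with classical ones almost
  everywhere.\<close>

text \<open>
  Convex sets on which derivatives within the set are unique, boundary points included.
\<close>

definition fat :: "'a::euclidean_space set \<Rightarrow> bool" where
  "fat S \<longleftrightarrow> convex S \<and> (\<forall>x\<in>S. \<forall>b\<in>Basis. \<exists>d. d \<noteq> 0 \<and> x + d *\<^sub>R b \<in> S)"

text \<open>One calculus for two sets: on \<open>strip\<close> it specialises to \<open>pd\<close>,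
  and on \<open>spacetime\<close> the vector selects the time direction or a space
  direction.\<close>

definition dd :: "'a::euclidean_space set \<Rightarrow> 'a \<Rightarrow> ('a \<Rightarrow> 'b::real_normed_vector) \<Rightarrow> 'a \<Rightarrow> 'b" where
  "dd S v f x = frechet_derivative f (at x within S) v"

lemma fat_segment:
  assumes "fat S" "x \<in> S" "x + v \<in> S" "0 \<le> s" "s \<le> 1"
  shows "x + s *\<^sub>R v \<in> S"
proof -
  have "convex S" using assms(1) by (simp add: fat_def)
  then have "(1 - s) *\<^sub>R x + s *\<^sub>R (x + v) \<in> S"
    using assms(2-5) by (intro convexD_alt) auto
  then show ?thesis by (simp add: algebra_simps)
qed

text \<open>Uniqueness needs points of S arbitrarily close to x along every axis. \<open>fat\<close>
  provides one point per axis, and convexity allows it to be pulled towards x.\<close>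

lemma fat_derivative_unique:
  assumes S: "fat S" and x: "x \<in> S"
    and "(f has_derivative f') (at x within S)" "(f has_derivative f'') (at x within S)"
  shows "f' = f''"
proof (rule frechet_derivative_unique_within[OF assms(3,4)])
  fix i :: 'a and e :: real
  assume i: "i \<in> Basis" and e: "e > 0"
  obtain d where d: "d \<noteq> 0" "x + d *\<^sub>R i \<in> S" using S x i by (auto simp: fat_def)
  define s where "s = min 1 (e / (2 * \<bar>d\<bar>))"
  have s: "0 < s" "s \<le> 1" using d e by (auto simp: s_def)
  have "\<bar>s * d\<bar> < e"
  proof -
    have "s * \<bar>d\<bar> \<le> e / (2 * \<bar>d\<bar>) * \<bar>d\<bar>"
      by (intro mult_right_mono) (auto simp: s_def)
    also have "\<dots> = e / 2" using d by simp
    also have "\<dots> < e" using e by simp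
    finally show ?thesis using s by (simp add: abs_mult)
  qed
  moreover have "x + (s * d) *\<^sub>R i \<in> S"
    using fat_segment[OF S x d(2), of s] s by simp
  ultimately show "\<exists>d. 0 < \<bar>d\<bar> \<and> \<bar>d\<bar> < e \<and> x + d *\<^sub>R i \<in> S"
    using s d by (intro exI[of _ "s * d"]) auto
qed

lemma fat_frechet:
  assumes "fat S" "x \<in> S" "(f has_derivative f') (at x within S)"
  shows "frechet_derivative f (at x within S) = f'"
  using assms fat_derivative_unique frechet_derivative_works differentiableI by metis

lemma dd_eqI:
  assumes "fat S" "x \<in> S" "(f has_derivative f') (at x within S)"
  shows "dd S v f x = f' v"
  using fat_frechet[OF assms] by (simp add: dd_def)

lemma Ck_on_cong:
  assumes "\<And>x. x \<in> S \<Longrightarrow> f x = g x"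
  shows "Ck_on k S f \<longleftrightarrow> Ck_on k S g"
proof (cases k)
  case 0
  then show ?thesis using assms by (simp cong: continuous_on_cong)
next
  case (Suc n)
  have "(f has_derivative f') (at x within S) \<longleftrightarrow> (g has_derivative f') (at x within S)"
    if "x \<in> S" for x f'
    using has_derivative_transform[of x S f g] has_derivative_transform[of x S g f] assms that
    by metis
  then show ?thesis by (simp add: Suc)
qed

lemma Ck_on_SucD: "Ck_on (Suc k) S f \<Longrightarrow> Ck_on k S f"
proof (induction k arbitrary: f)
  case 0
  then show ?case
    by (auto simp: continuous_on_eq_continuous_within intro: has_derivative_continuous)
next
  case (Suc k)
  then obtain f' where f': "\<forall>x\<in>S. (f has_derivative f' x) (at x within S)"
    "\<forall>v. Ck_on (Suc k) S (\<lambda>x. f' x v)"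
    by (simp only: Ck_on.simps(2)[of "Suc k"]) blast
  then have "\<forall>v. Ck_on k S (\<lambda>x. f' x v)" using Suc.IH by blast
  then show ?case using f'(1) by auto
qed

lemma Ck_on_const [simp]: "Ck_on k S (\<lambda>x. c)"
proof (induction k arbitrary: c)
  case (Suc k)
  then show ?case by (auto intro!: exI[of _ "\<lambda>_ _. 0"])
qed simp

lemma Ck_on_bounded_linear:
  assumes L: "bounded_linear L"
  shows "Ck_on k S f \<Longrightarrow> Ck_on k S (\<lambda>x. L (f x))"
proof (induction k arbitrary: f)
  case 0
  then show ?case using L by (auto intro: bounded_linear.continuous_on)
next
  case (Suc k)
  then obtain f' where f': "\<forall>x\<in>S. (f has_derivative f' x) (at x within S)"
    "\<forall>v. Ck_on k S (\<lambda>x. f' x v)" by auto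
  then show ?case
    using Suc.IH
    by (auto intro!: exI[of _ "\<lambda>x v. L (f' x v)"] bounded_linear.has_derivative[OF L])
qed

lemma Ck_on_add:
  "Ck_on k S f \<Longrightarrow> Ck_on k S g \<Longrightarrow> Ck_on k S (\<lambda>x. f x + g x)"
proof (induction k arbitrary: f g)
  case 0
  then show ?case by (auto intro: continuous_intros)
next
  case (Suc k)
  then obtain f' g' where f': "\<forall>x\<in>S. (f has_derivative f' x) (at x within S)"
    "\<forall>v. Ck_on k S (\<lambda>x. f' x v)"
    and g': "\<forall>x\<in>S. (g has_derivative g' x) (at x within S)"
    "\<forall>v. Ck_on k S (\<lambda>x. g' x v)" by auto
  then show ?case
    using Suc.IH
    by (auto intro!: exI[of _ "\<lambda>x v. f' x v + g' x v"] has_derivative_add)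
qed

lemma Ck_on_bilinear:
  assumes B: "bounded_bilinear B"
  shows "Ck_on k S f \<Longrightarrow> Ck_on k S g \<Longrightarrow> Ck_on k S (\<lambda>x. B (f x) (g x))"
proof (induction k arbitrary: f g)
  case 0
  then show ?case using B by (auto intro: bounded_bilinear.continuous_on)
next
  case (Suc k)
  have fg: "Ck_on k S f" "Ck_on k S g" using Suc.prems Ck_on_SucD by blast+
  from Suc obtain f' g' where f': "\<forall>x\<in>S. (f has_derivative f' x) (at x within S)"
    "\<forall>v. Ck_on k S (\<lambda>x. f' x v)"
    and g': "\<forall>x\<in>S. (g has_derivative g' x) (at x within S)"
    "\<forall>v. Ck_on k S (\<lambda>x. g' x v)" by auto
  have "\<forall>x\<in>S. ((\<lambda>x. B (f x) (g x)) has_derivative (\<lambda>v. B (f x) (g' x v) + B (f' x v) (g x)))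
      (at x within S)"
    using f' g' bounded_bilinear.FDERIV[OF B] by blast
  moreover have "\<forall>v. Ck_on k S (\<lambda>x. B (f x) (g' x v) + B (f' x v) (g x))"
    using f' g' fg Suc.IH by (auto intro!: Ck_on_add)
  ultimately show ?case
    by (auto intro!: exI[of _ "\<lambda>x v. B (f x) (g' x v) + B (f' x v) (g x)"])
qed

lemma Ck_on_affine:
  assumes L: "bounded_linear L" and sub: "\<And>x. x \<in> S \<Longrightarrow> a + L x \<in> S'"
  shows "Ck_on k S' f \<Longrightarrow> Ck_on k S (\<lambda>x. f (a + L x))"
proof (induction k arbitrary: f)
  case 0
  have "continuous_on S (\<lambda>x. a + L x)"
    using L by (intro continuous_intros) (auto intro: linear_continuous_on)
  with 0 show ?case using sub by (auto intro: continuous_on_compose2)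
next
  case (Suc k)
  then obtain f' where f': "\<forall>x\<in>S'. (f has_derivative f' x) (at x within S')"
    "\<forall>v. Ck_on k S' (\<lambda>x. f' x v)" by auto
  have "\<forall>x\<in>S. ((\<lambda>x. f (a + L x)) has_derivative (\<lambda>v. f' (a + L x) (L v))) (at x within S)"
  proof
    fix x assume x: "x \<in> S"
    have 1: "((\<lambda>x. a + L x) has_derivative L) (at x within S)"
      by (auto intro!: derivative_eq_intros bounded_linear_imp_has_derivative[OF L])
    have "(f has_derivative f' (a + L x)) (at (a + L x) within (\<lambda>x. a + L x) ` S)"
      using f'(1) sub x by (meson has_derivative_subset image_subsetI)
    from diff_chain_within[OF 1 this]
    show "((\<lambda>x. f (a + L x)) has_derivative (\<lambda>v. f' (a + L x) (L v))) (at x within S)"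
      by (simp add: o_def)
  qed
  moreover have "\<forall>v. Ck_on k S (\<lambda>x. f' (a + L x) (L v))"
    using f'(2) Suc.IH by blast
  ultimately show ?case
    by (auto intro!: exI[of _ "\<lambda>x v. f' (a + L x) (L v)"])
qed

text \<open>\<open>smooth_on\<close> provides a derivative field separately for each order k.
  Uniqueness on a fat set identifies all of them with \<open>dd S v f\<close>, which is therefore
  smooth itself.\<close>

lemma smooth_on_Suc:
  assumes S: "fat S" and f: "smooth_on S f"
  shows smooth_on_has_derivative:
      "x \<in> S \<Longrightarrow> (f has_derivative (\<lambda>v. dd S v f x)) (at x within S)"
    and smooth_on_dd: "smooth_on S (dd S v f)"
proof -
  have 1: "\<exists>f'. (\<forall>x\<in>S. (f has_derivative f' x) (at x within S)) \<and> (\<forall>v. Ck_on k S (\<lambda>x. f' x v))" for k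
    using f unfolding smooth_on_def by (metis Ck_on.simps(2))
  show "(f has_derivative (\<lambda>v. dd S v f x)) (at x within S)" if x: "x \<in> S"
  proof -
    obtain f' where "(f has_derivative f') (at x within S)" using 1[of 0] x by blast
    then show ?thesis using dd_eqI[OF S x] by (metis (no_types, lifting) ext)
  qed
  show "smooth_on S (dd S v f)"
    unfolding smooth_on_def
  proof
    fix k
    obtain f' where f': "\<forall>x\<in>S. (f has_derivative f' x) (at x within S)" "\<forall>v. Ck_on k S (\<lambda>x. f' x v)"
      using 1 by blast
    have "Ck_on k S (\<lambda>x. f' x v) \<longleftrightarrow> Ck_on k S (dd S v f)"
      using f'(1) by (intro Ck_on_cong dd_eqI[OF S, symmetric]) auto
    then show "Ck_on k S (dd S v f)" using f'(2) by blast
  qed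
qed

lemma smooth_on_cong:
  "(\<And>x. x \<in> S \<Longrightarrow> f x = g x) \<Longrightarrow> smooth_on S f \<longleftrightarrow> smooth_on S g"
  unfolding smooth_on_def using Ck_on_cong by metis

lemma smooth_on_continuous: "smooth_on S f \<Longrightarrow> continuous_on S f"
  unfolding smooth_on_def by (metis Ck_on.simps(1))

named_theorems smooth_intros

lemma smooth_on_const [smooth_intros]: "smooth_on S (\<lambda>x. c)"
  by (simp add: smooth_on_def)

lemma smooth_on_bounded_linear:
  "bounded_linear L \<Longrightarrow> smooth_on S f \<Longrightarrow> smooth_on S (\<lambda>x. L (f x))"
  by (simp add: smooth_on_def Ck_on_bounded_linear)

lemma smooth_on_add [smooth_intros]:
  "smooth_on S f \<Longrightarrow> smooth_on S g \<Longrightarrow> smooth_on S (\<lambda>x. f x + g x)"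
  by (simp add: smooth_on_def Ck_on_add)

lemma smooth_on_bilinear:
  "bounded_bilinear B \<Longrightarrow> smooth_on S f \<Longrightarrow> smooth_on S g \<Longrightarrow> smooth_on S (\<lambda>x. B (f x) (g x))"
  by (simp add: smooth_on_def Ck_on_bilinear)

lemma smooth_on_affine:
  assumes "bounded_linear L" "\<And>x. x \<in> S \<Longrightarrow> a + L x \<in> S'" "smooth_on S' f"
  shows "smooth_on S (\<lambda>x. f (a + L x))"
  using assms(3) Ck_on_affine[where S=S, OF assms(1,2)] unfolding smooth_on_def by blast

lemma smooth_on_subset: "smooth_on S f \<Longrightarrow> S' \<subseteq> S \<Longrightarrow> smooth_on S' f"
  using smooth_on_affine[OF bounded_linear_ident, of S' 0 S f] by auto

lemma smooth_on_mult [smooth_intros]: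
  fixes f g :: "_ \<Rightarrow> real"
  shows "smooth_on S f \<Longrightarrow> smooth_on S g \<Longrightarrow> smooth_on S (\<lambda>x. f x * g x)"
  by (rule smooth_on_bilinear[OF bounded_bilinear_mult])

lemma smooth_on_minus [smooth_intros]: "smooth_on S f \<Longrightarrow> smooth_on S (\<lambda>x. - f x)"
  by (rule smooth_on_bounded_linear[OF bounded_linear_minus[OF bounded_linear_ident]])

lemma smooth_on_diff [smooth_intros]:
  "smooth_on S f \<Longrightarrow> smooth_on S g \<Longrightarrow> smooth_on S (\<lambda>x. f x - g x)"
  using smooth_on_add[of S f "\<lambda>x. - g x"] smooth_on_minus[of S g] by simp

lemma smooth_on_power [smooth_intros]:
  "smooth_on S f \<Longrightarrow> smooth_on S (\<lambda>x. (f x :: real) ^ n)"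
  by (induction n) (auto intro: smooth_intros)

lemma smooth_on_nth [smooth_intros]: "smooth_on S f \<Longrightarrow> smooth_on S (\<lambda>x. f x $ i)"
  by (rule smooth_on_bounded_linear[OF bounded_linear_vec_nth])

lemma smooth_on_sum [smooth_intros]:
  "(\<And>i. i \<in> I \<Longrightarrow> smooth_on S (f i)) \<Longrightarrow> smooth_on S (\<lambda>x. \<Sum>i\<in>I. f i x)"
  by (induction I rule: infinite_finite_induct) (auto intro: smooth_intros)

lemma dd_cong:
  assumes "x \<in> S" "\<And>x. x \<in> S \<Longrightarrow> f x = g x"
  shows "dd S v f x = dd S v g x"
proof -
  have "(f has_derivative f') (at x within S) \<longleftrightarrow> (g has_derivative f') (at x within S)" for f'
    using has_derivative_transform[of x S f g] has_derivative_transform[of x S g f] assms by metis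
  then show ?thesis by (simp add: dd_def frechet_derivative_def)
qed

lemma dd_bounded_linear:
  assumes "fat S" "x \<in> S" "bounded_linear L" "smooth_on S f"
  shows "dd S v (\<lambda>x. L (f x)) x = L (dd S v f x)"
  by (rule dd_eqI[OF assms(1,2)])
    (rule bounded_linear.has_derivative[OF assms(3) smooth_on_has_derivative[OF assms(1,4,2)]])

lemma dd_bilinear:
  assumes "fat S" "x \<in> S" "bounded_bilinear B" "smooth_on S f" "smooth_on S g"
  shows "dd S v (\<lambda>x. B (f x) (g x)) x = B (f x) (dd S v g x) + B (dd S v f x) (g x)"
  by (rule dd_eqI[OF assms(1,2)])
    (rule bounded_bilinear.FDERIV[OF assms(3) smooth_on_has_derivative[OF assms(1,4,2)]
        smooth_on_has_derivative[OF assms(1,5,2)]])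

lemma dd_add:
  assumes "fat S" "x \<in> S" "smooth_on S f" "smooth_on S g"
  shows "dd S v (\<lambda>x. f x + g x) x = dd S v f x + dd S v g x"
  by (rule dd_eqI[OF assms(1,2)])
    (intro has_derivative_add smooth_on_has_derivative[OF assms(1)] assms)

lemma dd_diff:
  assumes "fat S" "x \<in> S" "smooth_on S f" "smooth_on S g"
  shows "dd S v (\<lambda>x. f x - g x) x = dd S v f x - dd S v g x"
  by (rule dd_eqI[OF assms(1,2)])
    (intro has_derivative_diff smooth_on_has_derivative[OF assms(1)] assms)

lemma dd_sum:
  assumes "fat S" "x \<in> S" "\<And>i. i \<in> I \<Longrightarrow> smooth_on S (f i)"
  shows "dd S v (\<lambda>x. \<Sum>i\<in>I. f i x) x = (\<Sum>i\<in>I. dd S v (f i) x)"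
  by (rule dd_eqI[OF assms(1,2)])
    (intro has_derivative_sum smooth_on_has_derivative[OF assms(1)] assms)

lemma dd_mult:
  fixes f g :: "_ \<Rightarrow> real"
  assumes "fat S" "x \<in> S" "smooth_on S f" "smooth_on S g"
  shows "dd S v (\<lambda>x. f x * g x) x = f x * dd S v g x + dd S v f x * g x"
  by (rule dd_bilinear[OF assms(1,2) bounded_bilinear_mult assms(3,4)])

lemma dd_affine:
  assumes S: "fat S" "x \<in> S" and S': "fat S'" and f: "smooth_on S' f"
    and L: "bounded_linear L" and sub: "\<And>x. x \<in> S \<Longrightarrow> a + L x \<in> S'"
  shows "dd S v (\<lambda>x. f (a + L x)) x = dd S' (L v) f (a + L x)"
proof (rule dd_eqI[OF S])
  have 1: "((\<lambda>x. a + L x) has_derivative L) (at x within S)"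
    by (auto intro!: derivative_eq_intros bounded_linear_imp_has_derivative[OF L])
  have "(f has_derivative (\<lambda>v. dd S' v f (a + L x))) (at (a + L x) within (\<lambda>x. a + L x) ` S)"
    using smooth_on_has_derivative[OF S' f] sub S(2) by (meson has_derivative_subset image_subsetI)
  from diff_chain_within[OF 1 this]
  show "((\<lambda>x. f (a + L x)) has_derivative (\<lambda>v. dd S' (L v) f (a + L x))) (at x within S)"
    by (simp add: o_def)
qed

lemma dd_scale:
  assumes "fat S" "x \<in> S" "smooth_on S f"
  shows "dd S (c *\<^sub>R v) f x = c *\<^sub>R dd S v f x"
  by (rule linear_scale[OF has_derivative_linear[OF smooth_on_has_derivative[OF assms(1,3,2)]]])

lemma has_vector_derivative_along:
  assumes "fat S" "smooth_on S f" "\<And>s. s \<in> I \<Longrightarrow> x + s *\<^sub>R v \<in> S" "s \<in> I"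
  shows "((\<lambda>s. f (x + s *\<^sub>R v)) has_vector_derivative dd S v f (x + s *\<^sub>R v)) (at s within I)"
proof -
  have 1: "((\<lambda>s. x + s *\<^sub>R v) has_derivative (\<lambda>h. h *\<^sub>R v)) (at s within I)"
    by (auto intro!: derivative_eq_intros)
  have "(f has_derivative (\<lambda>w. dd S w f (x + s *\<^sub>R v))) (at (x + s *\<^sub>R v) within (\<lambda>s. x + s *\<^sub>R v) ` I)"
  proof (rule has_derivative_subset)
    show "(f has_derivative (\<lambda>w. dd S w f (x + s *\<^sub>R v))) (at (x + s *\<^sub>R v) within S)"
      by (rule smooth_on_has_derivative[OF assms(1,2) assms(3)[OF assms(4)]])
    show "(\<lambda>s. x + s *\<^sub>R v) ` I \<subseteq> S"
      using assms(3) by auto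
  qed
  from diff_chain_within[OF 1 this] show ?thesis
    unfolding has_vector_derivative_def
    using dd_scale[OF assms(1) assms(3)[OF assms(4)] assms(2)]
    by (simp add: o_def)
qed

text \<open>
  Boundary points rule out the usual difference-quotient argument for mixed derivatives. Instead,
  \<open>f (x + s v + r w) - f (x + r w)\<close> is written as an integral over \<open>s\<close>, differentiated in \<open>r\<close>
  under the integral sign, and then in \<open>s\<close>.
\<close>

lemma dd_symmetric_corner:
  fixes f :: "'a::euclidean_space \<Rightarrow> real"
  assumes S: "fat S" and f: "smooth_on S f"
    and x: "x \<in> S" and v: "x + v \<in> S" and w: "x + w \<in> S" and vw: "x + v + w \<in> S"
  shows "dd S w (dd S v f) x = dd S v (dd S w f) x"
proof -
  have sub: "x + s *\<^sub>R v + r *\<^sub>R w \<in> S" if "s \<in> {0..1}" "r \<in> {0..1}" for s r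
  proof -
    have "x + s *\<^sub>R v \<in> S" "x + w + s *\<^sub>R v \<in> S"
      using fat_segment[OF S x v] fat_segment[OF S w, of v] vw that by (auto simp: algebra_simps)
    then show ?thesis
      using fat_segment[OF S, of "x + s *\<^sub>R v" w r] that by (auto simp: algebra_simps)
  qed
  have sub0: "x + r *\<^sub>R w \<in> S" if "r \<in> {0..1}" for r using sub[of 0 r] that by auto
  define g where "g = dd S v f"
  have g: "smooth_on S g" unfolding g_def by (rule smooth_on_dd[OF S f])
  define F where "F r s = f (x + s *\<^sub>R v + r *\<^sub>R w)" for r s
  define G where "G r s = g (x + s *\<^sub>R v + r *\<^sub>R w)" for r s
  define H where "H r s = dd S w g (x + s *\<^sub>R v + r *\<^sub>R w)" for r s
  have cont: "continuous_on ({0..1} \<times> {0..1}) (\<lambda>(r, s). k (x + s *\<^sub>R v + r *\<^sub>R w))"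
    if "continuous_on S k" for k :: "'a \<Rightarrow> real"
    unfolding split_beta
    by (rule continuous_on_compose2[OF that]) (auto intro!: continuous_intros sub)
  have Gint: "(G r has_integral F r s - F r 0) {0..s}" if "r \<in> {0..1}" "s \<in> {0..1}" for r s
    unfolding G_def F_def
  proof (rule fundamental_theorem_of_calculus)
    fix \<sigma> assume "\<sigma> \<in> {0..s}"
    then have "\<sigma> \<in> {0..1}" using that by auto
    moreover have "((\<lambda>s. f ((x + r *\<^sub>R w) + s *\<^sub>R v)) has_vector_derivative
        g ((x + r *\<^sub>R w) + \<sigma> *\<^sub>R v)) (at \<sigma> within {0..1})"
      unfolding g_def
      by (rule has_vector_derivative_along[OF S f]) (use sub that \<open>\<sigma> \<in> {0..1}\<close> in \<open>auto simp: add_ac\<close>)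
    ultimately show "((\<lambda>s. f (x + s *\<^sub>R v + r *\<^sub>R w)) has_vector_derivative
        g (x + \<sigma> *\<^sub>R v + r *\<^sub>R w)) (at \<sigma> within {0..s})"
      using that by (auto simp: add_ac intro: has_vector_derivative_within_subset)
  qed (use that in auto)
  have der0: "((\<lambda>r. F r s) has_vector_derivative dd S w f (x + s *\<^sub>R v)) (at 0 within {0..1})"
    if "s \<in> {0..1}" for s
    unfolding F_def using has_vector_derivative_along[OF S f, of "{0..1}" "x + s *\<^sub>R v" w 0] sub that
    by auto
  have intH: "dd S w f (x + s *\<^sub>R v) = dd S w f x + integral {0..s} (H 0)" if s: "s \<in> {0..1}" for s
  proof -
    have "((\<lambda>r. integral (cbox 0 s) (G r)) has_vector_derivative integral (cbox 0 s) (H 0))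
        (at 0 within {0..1})"
    proof (rule leibniz_rule_vector_derivative)
      fix r t assume "r \<in> {0..1::real}" "t \<in> cbox 0 s"
      then show "((\<lambda>r. G r t) has_vector_derivative H r t) (at r within {0..1})"
        unfolding G_def H_def using s
        by (intro has_vector_derivative_along[OF S g]) (auto intro!: sub)
    next
      fix r assume "r \<in> {0..1::real}"
      then show "G r integrable_on cbox 0 s" using Gint[of r s] s by auto
    next
      have "continuous_on ({0..1} \<times> {0..1}) (\<lambda>(r, s). H r s)"
        unfolding H_def by (rule cont[OF smooth_on_continuous[OF smooth_on_dd[OF S g]]])
      then show "continuous_on ({0..1} \<times> cbox 0 s) (\<lambda>(r, s). H r s)"
        by (rule continuous_on_subset) (use s in auto)
    qed auto
    then have "((\<lambda>r. F r s - F r 0) has_vector_derivative integral (cbox 0 s) (H 0)) (at 0 within {0..1})"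
      by (rule has_vector_derivative_transform[rotated 2]) (use integral_unique[OF Gint] s in auto)
    moreover have "((\<lambda>r. F r s - F r 0) has_vector_derivative dd S w f (x + s *\<^sub>R v) - dd S w f (x + 0 *\<^sub>R v))
        (at 0 within {0..1})"
      using der0[OF s] der0[of 0] by (intro has_vector_derivative_diff) auto
    ultimately show ?thesis
      using vector_derivative_unique_within[of 0 "{0..1}"]
      by (fastforce simp: trivial_limit_within islimpt_Icc)
  qed
  have "continuous_on {0..1} (H 0)"
    unfolding H_def
    by (rule continuous_on_compose2[OF smooth_on_continuous[OF smooth_on_dd[OF S g]]])
      (auto intro!: continuous_intros sub[of _ 0, simplified])
  then have "((\<lambda>s. integral {0..s} (H 0)) has_vector_derivative H 0 0) (at 0 within {0..1})"
    by (rule integral_has_vector_derivative) auto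
  then have "((\<lambda>s. dd S w f x + integral {0..s} (H 0)) has_vector_derivative H 0 0) (at 0 within {0..1})"
    by (auto intro!: derivative_eq_intros)
  then have "((\<lambda>s. dd S w f (x + s *\<^sub>R v)) has_vector_derivative H 0 0) (at 0 within {0..1})"
    by (rule has_vector_derivative_transform[rotated 2]) (use intH in auto)
  moreover have "((\<lambda>s. dd S w f (x + s *\<^sub>R v)) has_vector_derivative dd S v (dd S w f) (x + 0 *\<^sub>R v))
      (at 0 within {0..1})"
    by (rule has_vector_derivative_along[OF S smooth_on_dd[OF S f]]) (use sub[of _ 0] in auto)
  ultimately have "H 0 0 = dd S v (dd S w f) x"
    using vector_derivative_unique_within[of 0 "{0..1}"]
    by (fastforce simp: trivial_limit_within islimpt_Icc)
  then show ?thesis by (simp add: H_def g_def)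
qed

lemma dd_symmetric:
  fixes f :: "'a::euclidean_space \<Rightarrow> real"
  assumes S: "fat S" and f: "smooth_on S f" and x: "x \<in> S" and i: "i \<in> Basis" and j: "j \<in> Basis"
  shows "dd S i (dd S j f) x = dd S j (dd S i f) x"
proof -
  obtain a where a: "a \<noteq> 0" "x + a *\<^sub>R i \<in> S" using S x i by (auto simp: fat_def)
  obtain b where b: "b \<noteq> 0" "x + b *\<^sub>R j \<in> S" using S x j by (auto simp: fat_def)
  define v where "v = (a / 2) *\<^sub>R i"
  define w where "w = (b / 2) *\<^sub>R j"
  have v: "x + v \<in> S" using fat_segment[OF S x a(2), of "1/2"] by (simp add: v_def)
  have w: "x + w \<in> S" using fat_segment[OF S x b(2), of "1/2"] by (simp add: w_def)
  \<comment> \<open>The halving in \<open>v\<close> and \<open>w\<close> pays off here: the fourth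
    corner x + v + w is the midpoint of x + a i and x + b j, so convexity keeps it in S.\<close>
  have "x + a *\<^sub>R i + (1/2) *\<^sub>R (b *\<^sub>R j - a *\<^sub>R i) \<in> S"
    by (rule fat_segment[OF S a(2)]) (use b in auto)
  moreover have "x + a *\<^sub>R i + (1/2) *\<^sub>R (b *\<^sub>R j - a *\<^sub>R i) = x + v + w"
    by (simp add: v_def w_def algebra_simps scaleR_half_double[symmetric])
      (metis (no_types, opaque_lifting) add.commute add_diff_cancel_left' field_sum_of_halves scaleR_left_distrib)
  ultimately have "x + v + w \<in> S" by simp
  from dd_symmetric_corner[OF S f x v w this]
  have *: "dd S w (dd S v f) x = dd S v (dd S w f) x" .
  have sc: "dd S (c *\<^sub>R k) (dd S (d *\<^sub>R l) f) x = c * d * dd S k (dd S l f) x" for c d k l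
  proof -
    have "dd S (c *\<^sub>R k) (dd S (d *\<^sub>R l) f) x = dd S (c *\<^sub>R k) (\<lambda>x. d *\<^sub>R dd S l f x) x"
      by (rule dd_cong[OF x]) (rule dd_scale[OF S _ f])
    also have "\<dots> = d *\<^sub>R dd S (c *\<^sub>R k) (dd S l f) x"
      by (rule dd_bounded_linear[OF S x bounded_linear_scaleR_right smooth_on_dd[OF S f]])
    also have "\<dots> = d *\<^sub>R c *\<^sub>R dd S k (dd S l f) x"
      by (simp add: dd_scale[OF S x smooth_on_dd[OF S f]])
    finally show ?thesis by simp
  qed
  show ?thesis using * a b by (simp add: v_def w_def sc)
qed

section \<open>Partial derivatives on the strip and on space-time\<close>

lemma convex_strip: "convex strip"
  unfolding strip_def convex_alt by (auto simp: intro!: convex_bound_le add_nonneg_nonneg)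

lemma fat_strip: "fat strip"
  unfolding fat_def
proof (intro conjI ballI convex_strip)
  fix x b :: "real^3" assume x: "x \<in> strip" and "b \<in> Basis"
  then obtain i where b: "b = axis i 1" by (auto simp: Basis_vec_def)
  have "(1/2) \<noteq> (0::real) \<and> x + (1/2) *\<^sub>R b \<in> strip \<or> (-1/2) \<noteq> (0::real) \<and> x + (-1/2) *\<^sub>R b \<in> strip"
    using x by (auto simp: strip_def b axis_def)
  then show "\<exists>d. d \<noteq> 0 \<and> x + d *\<^sub>R b \<in> strip" by blast
qed

definition spacetime :: "(real \<times> (real^3)) set" where "spacetime = {0..} \<times> strip"

lemma fat_spacetime: "fat spacetime"
  unfolding fat_def
proof (intro conjI ballI)
  show "convex spacetime" unfolding spacetime_def by (intro convex_Times convex_strip convex_real_interval)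
  fix x b :: "real \<times> (real^3)" assume x: "x \<in> spacetime" and "b \<in> Basis"
  then consider "b = (1, 0)" | c where "b = (0, c)" "c \<in> Basis"
    by (auto simp: Basis_prod_def)
  then show "\<exists>d. d \<noteq> 0 \<and> x + d *\<^sub>R b \<in> spacetime"
  proof cases
    case 1
    then show ?thesis using x by (intro exI[of _ 1]) (auto simp: spacetime_def)
  next
    case 2
    with x fat_strip obtain d where "d \<noteq> 0" "snd x + d *\<^sub>R c \<in> strip"
      unfolding fat_def spacetime_def by (metis mem_Times_iff)
    then show ?thesis using x 2 by (intro exI[of _ d]) (auto simp: spacetime_def)
  qed
qed

lemma pd_eq_dd: "pd i = dd strip (axis i 1)"
  by (intro ext) (simp add: pd_def dd_def)

lemma axis_Basis: "axis i (1::real) \<in> Basis"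
  by (auto simp: Basis_vec_def)

lemma smooth_on_pd [smooth_intros]: "smooth_on strip f \<Longrightarrow> smooth_on strip (pd i f)"
  unfolding pd_eq_dd by (rule smooth_on_dd[OF fat_strip])

lemma pd_pd_commute:
  "smooth_on strip f \<Longrightarrow> x \<in> strip \<Longrightarrow> pd i (pd j f) x = pd j (pd i f) x"
  for f :: "real^3 \<Rightarrow> real"
  unfolding pd_eq_dd by (simp add: dd_symmetric[OF fat_strip _ _ axis_Basis axis_Basis])

lemma pd_mult:
  fixes f g :: "real^3 \<Rightarrow> real"
  shows "smooth_on strip f \<Longrightarrow> smooth_on strip g \<Longrightarrow> x \<in> strip \<Longrightarrow>
    pd i (\<lambda>x. f x * g x) x = f x * pd i g x + pd i f x * g x"
  unfolding pd_eq_dd by (rule dd_mult[OF fat_strip])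

lemma pd_cong: "x \<in> strip \<Longrightarrow> (\<And>x. x \<in> strip \<Longrightarrow> f x = g x) \<Longrightarrow> pd i f x = pd i g x"
  unfolding pd_eq_dd by (rule dd_cong)

lemma pd_add:
  "smooth_on strip f \<Longrightarrow> smooth_on strip g \<Longrightarrow> x \<in> strip \<Longrightarrow>
    pd i (\<lambda>x. f x + g x) x = pd i f x + pd i g x"
  unfolding pd_eq_dd by (rule dd_add[OF fat_strip])

lemma pd_diff:
  "smooth_on strip f \<Longrightarrow> smooth_on strip g \<Longrightarrow> x \<in> strip \<Longrightarrow>
    pd i (\<lambda>x. f x - g x) x = pd i f x - pd i g x"
  unfolding pd_eq_dd by (rule dd_diff[OF fat_strip])

lemma pd_sum:
  "(\<And>i. i \<in> I \<Longrightarrow> smooth_on strip (f i)) \<Longrightarrow> x \<in> strip \<Longrightarrow>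
    pd i (\<lambda>x. \<Sum>i\<in>I. f i x) x = (\<Sum>j\<in>I. pd i (f j) x)"
  unfolding pd_eq_dd by (rule dd_sum[OF fat_strip])

lemma pd_cmult:
  fixes f :: "real^3 \<Rightarrow> real"
  shows "smooth_on strip f \<Longrightarrow> x \<in> strip \<Longrightarrow> pd i (\<lambda>x. c * f x) x = c * pd i f x"
  unfolding pd_eq_dd by (rule dd_bounded_linear[OF fat_strip _ bounded_linear_mult_right])

lemma pd_nth:
  "smooth_on strip f \<Longrightarrow> x \<in> strip \<Longrightarrow> pd i (\<lambda>x. f x $ k) x = pd i f x $ k"
  unfolding pd_eq_dd by (rule dd_bounded_linear[OF fat_strip _ bounded_linear_vec_nth])

lemma has_vector_derivative_axis:
  assumes "smooth_on strip f" "\<And>s. s \<in> I \<Longrightarrow> x + s *\<^sub>R axis i 1 \<in> strip" "s \<in> I"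
  shows "((\<lambda>s. f (x + s *\<^sub>R axis i 1)) has_vector_derivative pd i f (x + s *\<^sub>R axis i 1)) (at s within I)"
  unfolding pd_eq_dd by (rule has_vector_derivative_along[OF fat_strip assms])

lemma smooth_on_slice:
  assumes "smooth_on spacetime F" "0 \<le> t"
  shows "smooth_on strip (\<lambda>x. F (t, x))"
proof -
  have L: "bounded_linear (\<lambda>x::real^3. (0::real, x))"
    by (intro bounded_linear_Pair bounded_linear_zero bounded_linear_ident)
  show ?thesis
    using smooth_on_affine[OF L, of strip "(t, 0)" spacetime F] assms by (auto simp: spacetime_def)
qed

lemma pd_slice:
  assumes "smooth_on spacetime F" "0 \<le> t" "x \<in> strip"
  shows "pd i (\<lambda>x. F (t, x)) x = dd spacetime (0, axis i 1) F (t, x)"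
proof -
  have L: "bounded_linear (\<lambda>x::real^3. (0::real, x))"
    by (intro bounded_linear_Pair bounded_linear_zero bounded_linear_ident)
  show ?thesis
    using dd_affine[OF fat_strip assms(3) fat_spacetime assms(1) L, of "(t, 0)" "axis i 1"] assms
    by (auto simp: spacetime_def pd_eq_dd)
qed

lemma slice_time_derivative:
  assumes "smooth_on spacetime F" "0 \<le> t" "x \<in> strip"
  shows "((\<lambda>s. F (s, x)) has_vector_derivative dd spacetime (1, 0) F (t, x)) (at t within {0..})"
proof -
  have "((\<lambda>s. F ((0, x) + s *\<^sub>R (1, 0))) has_vector_derivative
      dd spacetime (1, 0) F ((0, x) + t *\<^sub>R (1, 0))) (at t within {0..})"
    by (rule has_vector_derivative_along[OF fat_spacetime assms(1)]) (use assms in \<open>auto simp: spacetime_def\<close>)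
  then show ?thesis by simp
qed

section \<open>Integrals over boxes\<close>

lemma all_3_iff:
  assumes "(UNIV :: 3 set) = {i, j, k}"
  shows "(\<forall>l. Q l) \<longleftrightarrow> Q i \<and> Q j \<and> Q k"
proof -
  have "(\<forall>l\<in>UNIV. Q l) \<longleftrightarrow> Q i \<and> Q j \<and> Q k" unfolding assms by blast
  then show ?thesis by simp
qed

text \<open>Fubini on \<open>real^3\<close> with a free choice of the innermost variable i. The
  coordinate map P from triples of reals sends boxes to boxes and preserves their content, so the
  product version applies. The continuity claims justify monotonicity arguments for the nested
  integrals.\<close>

lemma integral_cart3:
  fixes g :: "real^3 \<Rightarrow> real" and a b :: "real^3" and i j k :: 3
  assumes g: "continuous_on (cbox a b) g" and ijk: "UNIV = {i, j, k}" "i \<noteq> j" "i \<noteq> k" "j \<noteq> k"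
  shows "integral (cbox a b) g = integral {a$j..b$j} (\<lambda>s. integral {a$k..b$k} (\<lambda>t.
      integral {a$i..b$i} (\<lambda>r. g (s *\<^sub>R axis j 1 + t *\<^sub>R axis k 1 + r *\<^sub>R axis i 1))))"
    and "continuous_on {a$j..b$j} (\<lambda>s. integral {a$k..b$k} (\<lambda>t.
      integral {a$i..b$i} (\<lambda>r. g (s *\<^sub>R axis j 1 + t *\<^sub>R axis k 1 + r *\<^sub>R axis i 1))))"
    and "s \<in> {a$j..b$j} \<Longrightarrow> continuous_on {a$k..b$k} (\<lambda>t.
      integral {a$i..b$i} (\<lambda>r. g (s *\<^sub>R axis j 1 + t *\<^sub>R axis k 1 + r *\<^sub>R axis i 1)))"
proof -
  define P :: "real \<times> real \<times> real \<Rightarrow> real^3" where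
    "P = (\<lambda>(s, t, r). s *\<^sub>R axis j 1 + t *\<^sub>R axis k 1 + r *\<^sub>R axis i 1)"
  define h where "h x = (x$j, x$k, x$i)" for x :: "real^3"
  note all = all_3_iff[OF ijk(1)]
  have Pn: "P (s, t, r) $ i = r" "P (s, t, r) $ j = s" "P (s, t, r) $ k = t" for s t r
    using ijk(2-4) by (auto simp: P_def axis_def)
  have hP: "h (P p) = p" for p by (cases p) (auto simp: h_def Pn)
  have Ph: "P (h x) = x" for x
    unfolding vec_eq_iff all by (simp add: h_def Pn)
  have contP: "continuous_on A P" for A
    unfolding P_def split_beta by (intro continuous_intros)
  have mem: "P p \<in> cbox u v \<longleftrightarrow> p \<in> cbox (h u) (h v)" for p u v
    by (cases p) (auto simp: mem_box_cart all h_def Pn cbox_Pair_eq)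
  have img: "P ` cbox u v = cbox (P u) (P v)" for u v
    using mem hP Ph by (auto simp: image_iff) (metis Ph hP mem)+
  have imh: "h ` cbox u v = cbox (h u) (h v)" for u v
    using mem hP Ph by (auto simp: image_iff) (metis Ph hP mem)+
  have cont: "measure lborel (P ` cbox u v) = 1 * measure lborel (cbox u v)" for u v
  proof -
    obtain u1 u2 u3 v1 v2 v3 where uv: "u = (u1, u2, u3)" "v = (v1, v2, v3)" by (metis prod_cases3)
    show ?thesis
    proof (cases "cbox u v = {}")
      case True then show ?thesis by simp
    next
      case False
      then have le: "u1 \<le> v1" "u2 \<le> v2" "u3 \<le> v3" by (auto simp: uv cbox_Pair_eq)
      have "cbox (P u) (P v) \<noteq> {}" using False img[of u v] by blast
      then have "measure lborel (cbox (P u) (P v)) = (\<Prod>l\<in>UNIV. P v $ l - P u $ l)"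
        by (rule content_cbox_cart)
      also have "\<dots> = (v3 - u3) * ((v1 - u1) * (v2 - u2))"
        unfolding ijk(1) using ijk(2-4) by (simp add: uv Pn)
      also have "\<dots> = measure lborel (cbox u v)"
        using le by (simp add: uv content_Pair)
      finally show ?thesis by (simp add: img)
    qed
  qed
  have "((\<lambda>x. g (P x)) has_integral (1 / 1) *\<^sub>R integral (cbox a b) g) (h ` cbox a b)"
  proof (rule has_integral_twiddle[where f = g and g = P and h = h and r = 1])
    show "continuous (at x) P" for x
      using contP[of UNIV] continuous_on_eq_continuous_at[of UNIV P] by blast
    show "(g has_integral integral (cbox a b) g) (cbox a b)"
      using g by (intro integrable_integral integrable_continuous)
    show "\<exists>w z. P ` cbox u v = cbox w z" "\<exists>w z. h ` cbox x y = cbox w z" for u v x y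
      using img imh by blast+
  qed (fact hP Ph cont zero_less_one)+
  then have I: "integral (cbox (h a) (h b)) (\<lambda>p. g (P p)) = integral (cbox a b) g"
    by (simp add: imh integral_unique)
  have gP: "continuous_on (cbox (h a) (h b)) (\<lambda>p. g (P p))"
    by (rule continuous_on_compose2[OF g contP]) (auto simp: mem)
  have gP2: "continuous_on (cbox (a$k, a$i) (b$k, b$i)) (\<lambda>q. g (P (s, q)))"
    if "s \<in> cbox (a$j) (b$j)" for s
    by (rule continuous_on_compose2[OF gP])
      (use that in \<open>auto intro!: continuous_intros simp: h_def cbox_Pair_eq\<close>)
  have e: "integral (cbox (a$k, a$i) (b$k, b$i)) (\<lambda>q. g (P (s, q))) =
     integral {a$k..b$k} (\<lambda>t. integral {a$i..b$i} (\<lambda>r. g (P (s, t, r))))"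
    if "s \<in> {a$j..b$j}" for s
    using integral_prod_continuous[OF gP2[of s]] that by simp
  have "integral (cbox (h a) (h b)) (\<lambda>p. g (P p)) =
      integral (cbox (a$j) (b$j)) (\<lambda>s. integral (cbox (a$k, a$i) (b$k, b$i)) (\<lambda>q. g (P (s, q))))"
    unfolding h_def using gP unfolding h_def by (rule integral_prod_continuous)
  also have "\<dots> = integral (cbox (a$j) (b$j)) (\<lambda>s. integral {a$k..b$k} (\<lambda>t. integral {a$i..b$i} (\<lambda>r. g (P (s, t, r)))))"
    by (rule integral_cong) (rule e, simp)
  finally show "integral (cbox a b) g = integral {a$j..b$j} (\<lambda>s. integral {a$k..b$k} (\<lambda>t.
      integral {a$i..b$i} (\<lambda>r. g (s *\<^sub>R axis j 1 + t *\<^sub>R axis k 1 + r *\<^sub>R axis i 1))))"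
    using I by (simp add: P_def)
  have "continuous_on {a$j..b$j} (\<lambda>s. integral (cbox (a$k, a$i) (b$k, b$i)) (\<lambda>q. g (P (s, q))))"
  proof (rule integral_continuous_on_param)
    show "continuous_on ({a$j..b$j} \<times> cbox (a$k, a$i) (b$k, b$i)) (\<lambda>(s, q). g (P (s, q)))"
      using gP by (simp add: h_def cbox_Pair_eq)
  qed
  then have "continuous_on {a$j..b$j} (\<lambda>s. integral {a$k..b$k} (\<lambda>t. integral {a$i..b$i} (\<lambda>r. g (P (s, t, r)))))"
    by (rule continuous_on_eq) (simp add: e del: cbox_interval)
  then show "continuous_on {a$j..b$j} (\<lambda>s. integral {a$k..b$k} (\<lambda>t.
      integral {a$i..b$i} (\<lambda>r. g (s *\<^sub>R axis j 1 + t *\<^sub>R axis k 1 + r *\<^sub>R axis i 1))))"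
    by (simp add: P_def)
  assume s: "s \<in> {a$j..b$j}"
  have "continuous_on (cbox (a$k) (b$k)) (\<lambda>t. integral (cbox (a$i) (b$i)) (\<lambda>r. g (P (s, t, r))))"
  proof (rule integral_continuous_on_param)
    show "continuous_on (cbox (a$k) (b$k) \<times> cbox (a$i) (b$i)) (\<lambda>(t, r). g (P (s, t, r)))"
      using gP2[of s] s by (simp add: cbox_Pair_eq split_beta)
  qed
  then show "continuous_on {a$k..b$k} (\<lambda>t.
      integral {a$i..b$i} (\<lambda>r. g (s *\<^sub>R axis j 1 + t *\<^sub>R axis k 1 + r *\<^sub>R axis i 1)))"
    by (simp add: P_def)
qed

lemma UNIV_3_split: obtains j k :: 3 where "UNIV = {i, j, k}" "i \<noteq> j" "i \<noteq> k" "j \<noteq> k"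
proof -
  consider "i = 1" | "i = 2" | "i = 3" using exhaust_3 by blast
  then show ?thesis
  proof cases
    case 1 then show ?thesis using that[of 2 3] UNIV_3 by auto
  next
    case 2 then show ?thesis using that[of 1 3] UNIV_3 by auto
  next
    case 3 then show ?thesis using that[of 1 2] UNIV_3 by auto
  qed
qed

text \<open>The device that lifts one-dimensional inequalities to the box. The point x, with i-th
  coordinate 0, names the line parallel to axis i, and r is the coordinate along it.\<close>

lemma integral_nonneg_slices:
  fixes g :: "real^3 \<Rightarrow> real"
  assumes g: "continuous_on (cbox a b) g"
    and slice: "\<And>x. x $ i = 0 \<Longrightarrow> (\<And>r. r \<in> {a$i..b$i} \<Longrightarrow> x + r *\<^sub>R axis i 1 \<in> cbox a b) \<Longrightarrow>
       0 \<le> integral {a$i..b$i} (\<lambda>r. g (x + r *\<^sub>R axis i 1))"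
  shows "0 \<le> integral (cbox a b) g"
proof -
  obtain j k where ijk: "UNIV = {i, j, k}" "i \<noteq> j" "i \<noteq> k" "j \<noteq> k" by (rule UNIV_3_split)
  note all = all_3_iff[OF ijk(1)]
  have "0 \<le> integral {a$i..b$i} (\<lambda>r. g (s *\<^sub>R axis j 1 + t *\<^sub>R axis k 1 + r *\<^sub>R axis i 1))"
    if "s \<in> {a$j..b$j}" "t \<in> {a$k..b$k}" for s t
    by (rule slice) (use that ijk(2-4) in \<open>auto simp: axis_def mem_box_cart all\<close>)
  then show ?thesis
    unfolding integral_cart3(1)[OF g ijk]
    by (intro integral_nonneg[OF integrable_continuous_real[OF integral_cart3(2)[OF g ijk]]]
        integral_nonneg[OF integrable_continuous_real[OF integral_cart3(3)[OF g ijk]]])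
qed

lemma integral_zero_slices:
  fixes g :: "real^3 \<Rightarrow> real"
  assumes g: "continuous_on (cbox a b) g"
    and slice: "\<And>x. x $ i = 0 \<Longrightarrow> (\<And>r. r \<in> {a$i..b$i} \<Longrightarrow> x + r *\<^sub>R axis i 1 \<in> cbox a b) \<Longrightarrow>
       integral {a$i..b$i} (\<lambda>r. g (x + r *\<^sub>R axis i 1)) = 0"
  shows "integral (cbox a b) g = 0"
proof (rule antisym)
  show "0 \<le> integral (cbox a b) g"
    using slice by (intro integral_nonneg_slices[where i = i, OF g]) simp
  have "0 \<le> integral (cbox a b) (\<lambda>x. - g x)"
    using g slice by (intro integral_nonneg_slices[where i = i] continuous_intros) simp_all
  then show "integral (cbox a b) g \<le> 0" by simp
qed

text \<open>The fundamental theorem of calculus on each line in direction i. The hypothesis on the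
  two opposite faces covers periodicity in the horizontal directions as well as functions that
  vanish on the walls.\<close>

lemma integral_pd_zero:
  assumes f: "smooth_on strip f" and ab: "cbox a b \<subseteq> strip" "a $ i \<le> b $ i"
    and faces: "\<And>x. x \<in> cbox a b \<Longrightarrow> x $ i = a $ i \<Longrightarrow> f (x + (b $ i - a $ i) *\<^sub>R axis i 1) = f x"
  shows "integral (cbox a b) (pd i f :: _ \<Rightarrow> real) = 0"
proof (rule integral_zero_slices[where i = i])
  show "continuous_on (cbox a b) (pd i f)"
    using smooth_on_continuous[OF smooth_on_pd[OF f]] ab continuous_on_subset by blast
  fix x assume x: "x $ i = 0" "\<And>r. r \<in> {a$i..b$i} \<Longrightarrow> x + r *\<^sub>R axis i 1 \<in> cbox a b"
  have "((\<lambda>r. pd i f (x + r *\<^sub>R axis i 1)) has_integral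
      f (x + (b $ i) *\<^sub>R axis i 1) - f (x + (a $ i) *\<^sub>R axis i 1)) {a$i..b$i}"
    using ab x by (intro fundamental_theorem_of_calculus has_vector_derivative_axis f) auto
  moreover have "f (x + (b $ i) *\<^sub>R axis i 1) = f (x + (a $ i) *\<^sub>R axis i 1)"
    using faces[of "x + (a $ i) *\<^sub>R axis i 1"] x ab
    by (auto simp: algebra_simps axis_def)
  ultimately show "integral {a$i..b$i} (\<lambda>r. pd i f (x + r *\<^sub>R axis i 1)) = 0"
    by (auto dest: integral_unique)
qed

lemma quadratic_nonneg_imp_discriminant:
  fixes A B C :: real
  assumes "\<And>s. 0 \<le> A * s\<^sup>2 - 2 * B * s + C"
  shows "B\<^sup>2 \<le> A * C"
proof -
  have C: "0 \<le> C" using assms[of 0] by simp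
  show ?thesis
  proof (cases "A = 0")
    case True
    have "B = 0"
    proof (rule ccontr)
      assume "B \<noteq> 0"
      then show False using assms[of "(C + 1) / (2 * B)"] True by simp
    qed
    then show ?thesis using True by simp
  next
    case False
    have "0 \<le> A"
    proof (rule ccontr)
      assume A: "\<not> 0 \<le> A"
      \<comment> \<open>Averaging over s and -s removes the linear term; the s chosen below then
        makes the value -1.\<close>
      have "0 \<le> A * s\<^sup>2 + C" for s using assms[of s] assms[of "-s"] by simp
      moreover have "(sqrt ((C + 1) / (-A)))\<^sup>2 = (C + 1) / (-A)"
        using A C by (intro real_sqrt_pow2 divide_nonneg_pos) auto
      ultimately have "0 \<le> A * ((C + 1) / (-A)) + C" by metis
      moreover have "A * ((C + 1) / (-A)) = - (C + 1)" using A by simp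
      ultimately show False by linarith
    qed
    then have A: "0 < A" using False by simp
    have "0 \<le> A * (B / A)\<^sup>2 - 2 * B * (B / A) + C" by (rule assms)
    then have "0 \<le> - B\<^sup>2 / A + C" using A by (simp add: power2_eq_square field_simps)
    then show ?thesis using A by (simp add: field_simps)
  qed
qed

text \<open>By AM-GM the pointwise bound makes K s^2 p - 2 s h + q nonnegative for every s;
  integrating gives a nonnegative quadratic in s, whose discriminant is the claim. In this form p
  and q enter without square roots, which suits the chains of Cauchy-Schwarz steps behind the
  Hoelder, Loomis-Whitney and interpolation inequalities below.\<close>

lemma integral_weighted_Cauchy_Schwarz:
  fixes h p q :: "'a::euclidean_space \<Rightarrow> real"
  assumes h: "continuous_on (cbox a b) h" and p: "continuous_on (cbox a b) p"
    and q: "continuous_on (cbox a b) q"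
    and nonneg: "\<And>x. x \<in> cbox a b \<Longrightarrow> 0 \<le> p x" "\<And>x. x \<in> cbox a b \<Longrightarrow> 0 \<le> q x" "0 \<le> K"
    and le: "\<And>x. x \<in> cbox a b \<Longrightarrow> (h x)\<^sup>2 \<le> K * p x * q x"
  shows "(integral (cbox a b) h)\<^sup>2 \<le> K * integral (cbox a b) p * integral (cbox a b) q"
proof (rule quadratic_nonneg_imp_discriminant)
  fix s :: real
  have "0 \<le> (K * s\<^sup>2) * p x - (2 * s) * h x + q x" if x: "x \<in> cbox a b" for x
  proof -
    have "\<bar>s * h x\<bar> \<le> sqrt ((K * s\<^sup>2 * p x) * q x)"
      using mult_left_mono[OF le[OF x], of "s\<^sup>2"] by (intro real_le_rsqrt) (simp add: power_mult_distrib algebra_simps)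
    also have "\<dots> \<le> (K * s\<^sup>2 * p x + q x) / 2"
      using nonneg x by (intro arith_geo_mean_sqrt) auto
    finally have "s * h x \<le> (K * s\<^sup>2 * p x + q x) / 2" by linarith
    then show ?thesis by (simp add: field_simps)
  qed
  then have "0 \<le> integral (cbox a b) (\<lambda>x. (K * s\<^sup>2) * p x - (2 * s) * h x + q x)"
    by (intro integral_nonneg integrable_continuous continuous_intros h p q) auto
  also have "\<dots> = (K * s\<^sup>2) * integral (cbox a b) p - (2 * s) * integral (cbox a b) h + integral (cbox a b) q"
  proof -
    have i: "h integrable_on cbox a b" "p integrable_on cbox a b" "q integrable_on cbox a b"
      using h p q by (auto intro: integrable_continuous)
    have "((\<lambda>x. (K * s\<^sup>2) * p x - (2 * s) * h x + q x) has_integral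
        (K * s\<^sup>2) * integral (cbox a b) p - (2 * s) * integral (cbox a b) h + integral (cbox a b) q) (cbox a b)"
      by (intro has_integral_add has_integral_diff has_integral_mult_right integrable_integral i)
    then show ?thesis by (rule integral_unique)
  qed
  finally show "0 \<le> K * integral (cbox a b) p * s\<^sup>2 - 2 * integral (cbox a b) h * s + integral (cbox a b) q"
    by (simp add: algebra_simps)
qed

lemma integral_Cauchy_Schwarz:
  fixes f g :: "'a::euclidean_space \<Rightarrow> real"
  assumes "continuous_on (cbox a b) f" "continuous_on (cbox a b) g"
  shows "\<bar>integral (cbox a b) (\<lambda>x. f x * g x)\<bar> \<le>
    sqrt (integral (cbox a b) (\<lambda>x. (f x)\<^sup>2)) * sqrt (integral (cbox a b) (\<lambda>x. (g x)\<^sup>2))"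
proof -
  have "(integral (cbox a b) (\<lambda>x. f x * g x))\<^sup>2 \<le>
    1 * integral (cbox a b) (\<lambda>x. (f x)\<^sup>2) * integral (cbox a b) (\<lambda>x. (g x)\<^sup>2)"
    using assms by (intro integral_weighted_Cauchy_Schwarz continuous_intros) (auto simp: power_mult_distrib)
  from real_sqrt_le_mono[OF this] show ?thesis by (simp add: real_sqrt_mult)
qed

lemma integral_Minkowski:
  fixes f g :: "'a::euclidean_space \<Rightarrow> real"
  assumes f: "continuous_on (cbox a b) f" and g: "continuous_on (cbox a b) g"
  shows "sqrt (integral (cbox a b) (\<lambda>x. (f x + g x)\<^sup>2)) \<le>
    sqrt (integral (cbox a b) (\<lambda>x. (f x)\<^sup>2)) + sqrt (integral (cbox a b) (\<lambda>x. (g x)\<^sup>2))"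
proof -
  let ?F = "integral (cbox a b) (\<lambda>x. (f x)\<^sup>2)" and ?G = "integral (cbox a b) (\<lambda>x. (g x)\<^sup>2)"
  have nn: "0 \<le> ?F" "0 \<le> ?G"
    using f g by (auto intro!: integral_nonneg integrable_continuous continuous_intros)
  have "integral (cbox a b) (\<lambda>x. (f x + g x)\<^sup>2) = integral (cbox a b) (\<lambda>x. (f x)\<^sup>2 + 2 * (f x * g x) + (g x)\<^sup>2)"
    by (simp add: power2_eq_square algebra_simps)
  also have "\<dots> = ?F + 2 * integral (cbox a b) (\<lambda>x. f x * g x) + ?G"
  proof -
    have "((\<lambda>x. (f x)\<^sup>2 + 2 * (f x * g x) + (g x)\<^sup>2) has_integral
        ?F + 2 * integral (cbox a b) (\<lambda>x. f x * g x) + ?G) (cbox a b)"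
      using f g by (intro has_integral_add has_integral_mult_right integrable_integral
          integrable_continuous continuous_intros)
    then show ?thesis by (rule integral_unique)
  qed
  also have "\<dots> \<le> ?F + 2 * (sqrt ?F * sqrt ?G) + ?G"
    using integral_Cauchy_Schwarz[OF f g] by simp
  also have "\<dots> = (sqrt ?F + sqrt ?G)\<^sup>2"
    using nn by (simp add: power2_sum)
  finally show ?thesis using nn by (intro real_le_lsqrt) auto
qed

text \<open>Hoelder's inequality with exponents 3/2 and 3, cubed to avoid roots. Two Cauchy-Schwarz
  steps through Y = \<integral> u h^4 give X^2 \<le> A Y and Y^2 \<le> X B, hence X^4 \<le> A^2 X B,
  and one factor X cancels.\<close>

lemma integral_Holder_3_6:
  fixes u h :: "'a::euclidean_space \<Rightarrow> real"
  assumes u: "continuous_on (cbox a b) u" and h: "continuous_on (cbox a b) h"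
    and nonneg: "\<And>x. x \<in> cbox a b \<Longrightarrow> 0 \<le> u x"
  shows "(integral (cbox a b) (\<lambda>x. (u x * h x)\<^sup>2)) ^ 3 \<le>
    (integral (cbox a b) (\<lambda>x. u x ^ 3))\<^sup>2 * integral (cbox a b) (\<lambda>x. h x ^ 6)"
proof -
  let ?X = "integral (cbox a b) (\<lambda>x. (u x * h x)\<^sup>2)"
  let ?Y = "integral (cbox a b) (\<lambda>x. u x * h x ^ 4)"
  let ?A = "integral (cbox a b) (\<lambda>x. u x ^ 3)" and ?B = "integral (cbox a b) (\<lambda>x. h x ^ 6)"
  have X: "0 \<le> ?X" and B: "0 \<le> ?B"
    using u h by (auto intro!: integral_nonneg integrable_continuous continuous_intros)
  have 1: "?X\<^sup>2 \<le> 1 * ?A * ?Y"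
  proof (intro integral_weighted_Cauchy_Schwarz continuous_intros u h)
    show "0 \<le> u x * h x ^ 4" if "x \<in> cbox a b" for x using nonneg[OF that] by simp
  qed (auto simp: power_mult_distrib nonneg power2_eq_square power_numeral_reduce)
  have 2: "?Y\<^sup>2 \<le> 1 * ?X * ?B"
  proof (intro integral_weighted_Cauchy_Schwarz continuous_intros u h)
    show "0 \<le> h x ^ 6" for x by simp
  qed (auto simp: power_mult_distrib power2_eq_square power_numeral_reduce)
  have "?X * ?X ^ 3 = (?X\<^sup>2)\<^sup>2" by (simp add: power_numeral_reduce)
  also have "\<dots> \<le> (?A * ?Y)\<^sup>2" using 1 by (intro power_mono) auto
  also have "\<dots> = ?A\<^sup>2 * ?Y\<^sup>2" by (simp add: power_mult_distrib)
  also have "\<dots> \<le> ?A\<^sup>2 * (?X * ?B)" using 2 by (intro mult_left_mono) auto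
  finally have *: "?X * ?X ^ 3 \<le> ?X * (?A\<^sup>2 * ?B)" by (simp add: algebra_simps)
  show ?thesis
  proof (cases "?X = 0")
    case True then show ?thesis using B by simp
  next
    case False then show ?thesis using * X by simp
  qed
qed

text \<open>Cauchy-Schwarz in one variable at a time, with one factor constant in each round: C x y
  while integrating in z, the integral of B over z while integrating in y, and the double integral
  of A while integrating in x.\<close>

lemma Loomis_Whitney:
  fixes h :: "real \<Rightarrow> real \<Rightarrow> real \<Rightarrow> real"
  assumes h: "continuous_on ({a1..d1} \<times> {a2..d2} \<times> {a3..d3}) (\<lambda>(x, y, z). h x y z)"
    and A: "continuous_on ({a2..d2} \<times> {a3..d3}) (\<lambda>(y, z). A y z)"
    and B: "continuous_on ({a1..d1} \<times> {a3..d3}) (\<lambda>(x, z). B x z)"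
    and C: "continuous_on ({a1..d1} \<times> {a2..d2}) (\<lambda>(x, y). C x y)"
    and nn: "\<And>y z. y \<in> {a2..d2} \<Longrightarrow> z \<in> {a3..d3} \<Longrightarrow> 0 \<le> A y z"
      "\<And>x z. x \<in> {a1..d1} \<Longrightarrow> z \<in> {a3..d3} \<Longrightarrow> 0 \<le> B x z"
      "\<And>x y. x \<in> {a1..d1} \<Longrightarrow> y \<in> {a2..d2} \<Longrightarrow> 0 \<le> C x y"
    and le: "\<And>x y z. x \<in> {a1..d1} \<Longrightarrow> y \<in> {a2..d2} \<Longrightarrow> z \<in> {a3..d3} \<Longrightarrow>
       (h x y z)\<^sup>2 \<le> A y z * B x z * C x y"
  shows "(integral {a1..d1} (\<lambda>x. integral {a2..d2} (\<lambda>y. integral {a3..d3} (h x y))))\<^sup>2 \<le>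
     integral {a2..d2} (\<lambda>y. integral {a3..d3} (A y)) * integral {a1..d1} (\<lambda>x. integral {a3..d3} (B x)) *
     integral {a1..d1} (\<lambda>x. integral {a2..d2} (C x))"
proof -
  have h1: "continuous_on {a3..d3} (h x y)" if "x \<in> {a1..d1}" "y \<in> {a2..d2}" for x y
  proof -
    have "continuous_on {a3..d3} (\<lambda>z. (x, y, z))" by (intro continuous_intros)
    moreover have "(\<lambda>z. (x, y, z)) ` {a3..d3} \<subseteq> {a1..d1} \<times> {a2..d2} \<times> {a3..d3}" using that by auto
    ultimately show ?thesis using continuous_on_compose2[OF h] by fastforce
  qed
  have A1: "continuous_on {a3..d3} (A y)" if "y \<in> {a2..d2}" for y
  proof -
    have "continuous_on {a3..d3} (\<lambda>z. (y, z))" by (intro continuous_intros)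
    with continuous_on_compose2[OF A this] that show ?thesis by fastforce
  qed
  have B1: "continuous_on {a3..d3} (B x)" if "x \<in> {a1..d1}" for x
  proof -
    have "continuous_on {a3..d3} (\<lambda>z. (x, z))" by (intro continuous_intros)
    with continuous_on_compose2[OF B this] that show ?thesis by fastforce
  qed
  have C1: "continuous_on {a2..d2} (C x)" if "x \<in> {a1..d1}" for x
  proof -
    have "continuous_on {a2..d2} (\<lambda>z. (x, z))" by (intro continuous_intros)
    with continuous_on_compose2[OF C this] that show ?thesis by fastforce
  qed
  have h2: "continuous_on ({a1..d1} \<times> {a2..d2}) (\<lambda>(x, y). integral {a3..d3} (h x y))"
  proof -
    have "continuous_on (({a1..d1} \<times> {a2..d2}) \<times> {a3..d3}) (\<lambda>p. (fst (fst p), snd (fst p), snd p))"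
      by (intro continuous_intros)
    then have "continuous_on (({a1..d1} \<times> {a2..d2}) \<times> {a3..d3})
        (\<lambda>p. case (fst (fst p), snd (fst p), snd p) of (x, y, z) \<Rightarrow> h x y z)"
      by (rule continuous_on_compose2[OF h]) auto
    then show ?thesis
      using integral_continuous_on_param[of "{a1..d1} \<times> {a2..d2}" a3 d3 "\<lambda>p. h (fst p) (snd p)"]
      by (simp add: split_beta)
  qed
  have h3: "continuous_on {a2..d2} (\<lambda>y. integral {a3..d3} (h x y))" if "x \<in> {a1..d1}" for x
  proof -
    have "continuous_on {a2..d2} (\<lambda>y. (x, y))" by (intro continuous_intros)
    with continuous_on_compose2[OF h2 this] that show ?thesis by fastforce
  qed
  have h4: "continuous_on {a1..d1} (\<lambda>x. integral {a2..d2} (\<lambda>y. integral {a3..d3} (h x y)))"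
    using integral_continuous_on_param[of "{a1..d1}" a2 d2 "\<lambda>x y. integral {a3..d3} (h x y)"] h2 by simp
  have A2: "continuous_on {a2..d2} (\<lambda>y. integral {a3..d3} (A y))"
    using integral_continuous_on_param[of "{a2..d2}" a3 d3 A] A by simp
  have B2: "continuous_on {a1..d1} (\<lambda>y. integral {a3..d3} (B y))"
    using integral_continuous_on_param[of "{a1..d1}" a3 d3 B] B by simp
  have C2: "continuous_on {a1..d1} (\<lambda>y. integral {a2..d2} (C y))"
    using integral_continuous_on_param[of "{a1..d1}" a2 d2 C] C by simp
  have nA: "0 \<le> integral {a3..d3} (A y)" if "y \<in> {a2..d2}" for y
    using A1 nn that by (intro integral_nonneg integrable_continuous_real) auto
  have nB: "0 \<le> integral {a3..d3} (B y)" if "y \<in> {a1..d1}" for y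
    using B1 nn that by (intro integral_nonneg integrable_continuous_real) auto
  have nC: "0 \<le> integral {a2..d2} (C y)" if "y \<in> {a1..d1}" for y
    using C1 nn that by (intro integral_nonneg integrable_continuous_real) auto
  have 1: "(integral {a3..d3} (h x y))\<^sup>2 \<le> C x y * integral {a3..d3} (A y) * integral {a3..d3} (B x)"
    if "x \<in> {a1..d1}" "y \<in> {a2..d2}" for x y
    using integral_weighted_Cauchy_Schwarz[of a3 d3 "h x y" "A y" "B x" "C x y"]
      h1 A1 B1 nn le that by (simp add: mult_ac)
  have 2: "(integral {a2..d2} (\<lambda>y. integral {a3..d3} (h x y)))\<^sup>2 \<le>
      integral {a3..d3} (B x) * integral {a2..d2} (\<lambda>y. integral {a3..d3} (A y)) * integral {a2..d2} (C x)"
    if "x \<in> {a1..d1}" for x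
    using integral_weighted_Cauchy_Schwarz[of a2 d2 "\<lambda>y. integral {a3..d3} (h x y)"
        "\<lambda>y. integral {a3..d3} (A y)" "C x" "integral {a3..d3} (B x)"]
      h3 A2 C1 nA nB nn 1 that by (simp add: mult_ac)
  have "0 \<le> integral {a2..d2} (\<lambda>y. integral {a3..d3} (A y))"
    by (intro integral_nonneg[OF integrable_continuous_real[OF A2]] nA)
  then show ?thesis
    using integral_weighted_Cauchy_Schwarz[of a1 d1 "\<lambda>x. integral {a2..d2} (\<lambda>y. integral {a3..d3} (h x y))"
        "\<lambda>x. integral {a3..d3} (B x)" "\<lambda>x. integral {a2..d2} (C x)" "integral {a2..d2} (\<lambda>y. integral {a3..d3} (A y))"]
      h4 B2 C2 nB nC 2 by (simp add: mult_ac)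
qed

lemma Lp_norm_continuous:
  fixes f :: "real^3 \<Rightarrow> 'b::real_normed_vector"
  assumes f: "continuous_on (cbox a b) f" and p: "0 < p"
  shows "Lp_norm p (cbox a b) f = ennreal ((integral (cbox a b) (\<lambda>x. norm (f x) powr p)) powr (1 / p))"
proof -
  have c: "continuous_on (cbox a b) (\<lambda>x. norm (f x) powr p)"
    using f p by (intro continuous_on_powr' continuous_intros) auto
  then have i: "integrable (lebesgue_on (cbox a b)) (\<lambda>x. norm (f x) powr p)"
    by (rule continuous_imp_integrable)
  have "(\<integral>\<^sup>+x. ennreal (norm (f x) powr p) \<partial>lebesgue_on (cbox a b)) =
      ennreal (integral (cbox a b) (\<lambda>x. norm (f x) powr p))"
    by (simp add: nn_integral_eq_integral[OF i] lebesgue_integral_eq_integral[OF i])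
  moreover have "0 \<le> integral (cbox a b) (\<lambda>x. norm (f x) powr p)"
    using c by (intro integral_nonneg integrable_continuous) auto
  ultimately show ?thesis by (simp add: Lp_norm_def enn_powr_def)
qed

section \<open>Sharp one-dimensional inequalities\<close>

text \<open>
  The multiplier \<open>w z = k cot (k z + e)\<close> solves \<open>w' + w\<^sup>2 = - k\<^sup>2\<close> and stays finite on \<open>[0,1]\<close> because
  \<open>k < \<pi>\<close>, so that integrating \<open>(f' - w f)\<^sup>2 \<ge> 0\<close> leaves no boundary term.
\<close>

lemma Wirtinger_aux:
  fixes f f' :: "real \<Rightarrow> real"
  assumes f: "\<And>z. z \<in> {0..1} \<Longrightarrow> (f has_vector_derivative f' z) (at z within {0..1})"
    and cont: "continuous_on {0..1} f'" and bc: "f 0 = 0" "f 1 = 0" and k: "0 < k" "k < pi"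
  shows "k\<^sup>2 * integral {0..1} (\<lambda>z. (f z)\<^sup>2) \<le> integral {0..1} (\<lambda>z. (f' z)\<^sup>2)"
proof -
  \<comment> \<open>This phase centres the range [e, k + e] of the argument in (0, \<pi>), so the
    sine stays positive on the whole closed interval.\<close>
  define e where "e = (pi - k) / 2"
  define w where "w z = k * cot (k * z + e)" for z
  have e: "0 < e" "k + e < pi" using k by (auto simp: e_def field_simps)
  have sin: "sin (k * z + e) > 0" if "z \<in> {0..1}" for z
  proof (rule sin_gt_zero)
    show "0 < k * z + e" using that k e by (auto intro: add_nonneg_pos)
    have "k * z \<le> k" using that k by (simp add: mult_left_le)
    then show "k * z + e < pi" using e by linarith
  qed
  have contf: "continuous_on {0..1} f"
    by (rule continuous_on_vector_derivative[OF f])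
  have contw: "continuous_on {0..1} w"
    unfolding w_def cot_def using sin by (intro continuous_intros) force+
  have w': "(w has_vector_derivative - k\<^sup>2 * (1 + (cot (k * z + e))\<^sup>2)) (at z within {0..1})"
    if "z \<in> {0..1}" for z
  proof -
    have s: "sin (k * z + e) \<noteq> 0" using sin[OF that] by simp
    have "1 + (cot (k * z + e))\<^sup>2 = inverse ((sin (k * z + e))\<^sup>2)"
      using s sin_cos_squared_add[of "k * z + e"] by (simp add: cot_def field_simps)
    moreover have "(w has_real_derivative - k\<^sup>2 * inverse ((sin (k * z + e))\<^sup>2)) (at z within {0..1})"
    proof -
      have "((\<lambda>z. k * z + e) has_real_derivative k) (at z within {0..1})"
        by (auto intro!: derivative_eq_intros)
      from DERIV_cmult[OF DERIV_chain2[where f = cot, OF DERIV_cot[OF s] this], of k]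
      show ?thesis by (simp add: w_def[abs_def] power2_eq_square mult_ac)
    qed
    ultimately show ?thesis by (simp add: has_real_derivative_iff_has_vector_derivative)
  qed
  let ?d = "\<lambda>z. w z * (2 * f z * f' z) + (- k\<^sup>2 * (1 + (cot (k * z + e))\<^sup>2)) * (f z)\<^sup>2"
  have "(?d has_integral (w 1 * (f 1)\<^sup>2 - w 0 * (f 0)\<^sup>2)) {0..1}"
  proof (rule fundamental_theorem_of_calculus)
    fix z :: real assume z: "z \<in> {0..1}"
    have "((\<lambda>z. (f z)\<^sup>2) has_vector_derivative 2 * f z * f' z) (at z within {0..1})"
      using f[OF z] unfolding power2_eq_square
      by (auto intro!: derivative_eq_intros)
    from has_vector_derivative_mult[OF w'[OF z] this]
    show "((\<lambda>z. w z * (f z)\<^sup>2) has_vector_derivative ?d z) (at z within {0..1})" .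
  qed simp
  then have d0: "(?d has_integral 0) {0..1}" using bc by simp
  \<comment> \<open>Since k^2 cot^2 = w^2, the derivative \<open>?d\<close> of w f^2 carries exactly
    the cross term and the w^2 f^2 of the square, up to k^2 f^2.\<close>
  have eq: "(f' z - w z * f z)\<^sup>2 = (f' z)\<^sup>2 - k\<^sup>2 * (f z)\<^sup>2 - ?d z" for z
    by (simp add: w_def power2_eq_square algebra_simps)
  have "((\<lambda>z. (f' z)\<^sup>2 - k\<^sup>2 * (f z)\<^sup>2 - ?d z) has_integral
      integral {0..1} (\<lambda>z. (f' z)\<^sup>2) - k\<^sup>2 * integral {0..1} (\<lambda>z. (f z)\<^sup>2) - 0) {0..1}"
    by (intro has_integral_diff has_integral_mult_right integrable_integral d0
        integrable_continuous_real continuous_intros cont contf)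
  then have "0 \<le> integral {0..1} (\<lambda>z. (f' z)\<^sup>2) - k\<^sup>2 * integral {0..1} (\<lambda>z. (f z)\<^sup>2) - 0"
    by (rule has_integral_nonneg) (simp only: eq[symmetric] zero_le_power2)
  then show ?thesis by simp
qed

text \<open>For k = \<pi> the multiplier would be singular at both end points, so the sharp constant
  is reached as a limit from below.\<close>

lemma Wirtinger:
  fixes f f' :: "real \<Rightarrow> real"
  assumes "\<And>z. z \<in> {0..1} \<Longrightarrow> (f has_vector_derivative f' z) (at z within {0..1})"
    and "continuous_on {0..1} f'" "f 0 = 0" "f 1 = 0"
  shows "pi\<^sup>2 * integral {0..1} (\<lambda>z. (f z)\<^sup>2) \<le> integral {0..1} (\<lambda>z. (f' z)\<^sup>2)"
proof (rule tendsto_upperbound)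
  show "((\<lambda>k. k\<^sup>2 * integral {0..1} (\<lambda>z. (f z)\<^sup>2)) \<longlongrightarrow> pi\<^sup>2 * integral {0..1} (\<lambda>z. (f z)\<^sup>2)) (at_left pi)"
    by (intro tendsto_intros)
  show "\<forall>\<^sub>F k in at_left pi. k\<^sup>2 * integral {0..1} (\<lambda>z. (f z)\<^sup>2) \<le> integral {0..1} (\<lambda>z. (f' z)\<^sup>2)"
    using eventually_at_left_real[OF pi_gt_zero]
    by eventually_elim (use Wirtinger_aux[OF assms] in auto)
qed simp

text \<open>An antiderivative of \<open>s / (1 + s\<^sup>3)\<close>, see \<open>G3_deriv\<close>.\<close>

definition G3 :: "real \<Rightarrow> real" where
  "G3 s = - ln (1 + s) / 3 + ln (s\<^sup>2 - s + 1) / 6 + arctan ((2 * s - 1) / sqrt 3) / sqrt 3"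

lemma square_minus_pos: "0 < s\<^sup>2 - s + (1::real)"
proof -
  have "s\<^sup>2 - s + 1 = (s - 1/2)\<^sup>2 + 3/4" by (simp add: power2_eq_square algebra_simps)
  also have "\<dots> > 0" by (simp add: add_nonneg_pos)
  finally show ?thesis .
qed

text \<open>Partial fractions: s/(1 + s^3) = - 1/(3 (1 + s)) + (s + 1)/(3 (s^2 - s + 1)), where the
  last term splits into a logarithmic part and the arctangent part 1/(2 (s^2 - s + 1)).\<close>

lemma G3_deriv:
  assumes "0 \<le> s"
  shows "(G3 has_real_derivative s / (1 + s ^ 3)) (at s)"
proof -
  have p: "0 < s\<^sup>2 - s + 1" by (rule square_minus_pos)
  have q: "1 + ((2 * s - 1) / sqrt 3)\<^sup>2 = 4 * (s\<^sup>2 - s + 1) / 3"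
    by (simp add: power_divide) (simp add: power2_eq_square field_simps)
  have "(G3 has_real_derivative - (1 / (1 + s)) / 3 + (2 * s - 1) / (s\<^sup>2 - s + 1) / 6 +
      (2 / sqrt 3) / (1 + ((2 * s - 1) / sqrt 3)\<^sup>2) / sqrt 3) (at s)"
  proof -
    have 1: "((\<lambda>s. ln (1 + s)) has_real_derivative 1 / (1 + s)) (at s)"
      using assms by (auto intro!: derivative_eq_intros)
    have 2: "((\<lambda>s. ln (s\<^sup>2 - s + 1)) has_real_derivative (2 * s - 1) / (s\<^sup>2 - s + 1)) (at s)"
      using p by (auto intro!: derivative_eq_intros)
    have "((\<lambda>s. 2 * s - 1) has_real_derivative 2) (at s)"
      by (auto intro!: derivative_eq_intros)
    from DERIV_chain2[where f = arctan, OF DERIV_arctan DERIV_cdivide[OF this, of "sqrt 3"]]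
    have 3: "((\<lambda>s. arctan ((2 * s - 1) / sqrt 3)) has_real_derivative
        (2 / sqrt 3) / (1 + ((2 * s - 1) / sqrt 3)\<^sup>2)) (at s)"
      by (simp add: divide_inverse mult_ac)
    show ?thesis
      using DERIV_add[OF DERIV_add[OF DERIV_cdivide[OF DERIV_minus[OF 1], of 3] DERIV_cdivide[OF 2, of 6]]
          DERIV_cdivide[OF 3, of "sqrt 3"]]
      by (simp add: G3_def[abs_def])
  qed
  also have "- (1 / (1 + s)) / 3 + (2 * s - 1) / (s\<^sup>2 - s + 1) / 6 +
      (2 / sqrt 3) / (1 + ((2 * s - 1) / sqrt 3)\<^sup>2) / sqrt 3 =
      - (1 / (1 + s)) / 3 + (2 * s - 1) / (s\<^sup>2 - s + 1) / 6 + 1 / (2 * (s\<^sup>2 - s + 1))"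
  proof -
    have "(2 / sqrt 3) / Z / sqrt 3 = 2 / (sqrt 3 * sqrt 3) / Z" for Z :: real
      by (simp only: divide_divide_eq_left mult_ac)
    then have "(2 / sqrt 3) / Z / sqrt 3 = 2 / 3 / Z" for Z :: real by simp
    then have "(2 / sqrt 3) / (4 * (s\<^sup>2 - s + 1) / 3) / sqrt 3 = 2 / 3 / (4 * (s\<^sup>2 - s + 1) / 3)" .
    also have "2 / 3 / (4 * P / 3) = 1 / (2 * P)" for P :: real by simp
    finally show ?thesis by (simp only: q)
  qed
  also have "\<dots> = - (1 / (3 * (1 + s))) + (s + 1) / (3 * (s\<^sup>2 - s + 1))"
  proof -
    have "(2 * s - 1) / P / 6 + 1 / (2 * P) = (s + 1) / (3 * P)" if "P \<noteq> 0" for P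
      using that by (simp add: field_simps)
    moreover have "- (1 / (1 + s)) / 3 = - (1 / (3 * (1 + s)))" by simp
    ultimately show ?thesis using p by (simp only: add.assoc less_imp_neq[THEN not_sym] not_False_eq_True)
  qed
  also have "\<dots> = ((s + 1) * (s + 1) - (s\<^sup>2 - s + 1)) / (3 * ((1 + s) * (s\<^sup>2 - s + 1)))"
    using p assms by (simp add: divide_simps) (simp add: algebra_simps)
  also have "(s + 1) * (s + 1) - (s\<^sup>2 - s + 1) = 3 * s" by (simp add: power2_eq_square algebra_simps)
  also have "(1 + s) * (s\<^sup>2 - s + 1) = 1 + s ^ 3" by (simp add: power2_eq_square power3_eq_cube algebra_simps)
  also have "3 * s / (3 * (1 + s ^ 3)) = s / (1 + s ^ 3)"
    by (rule mult_divide_mult_cancel_left) simp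
  finally show ?thesis .
qed

lemma G3_strict_mono:
  assumes "0 \<le> s" "s < t"
  shows "G3 s < G3 t"
proof (rule DERIV_pos_imp_increasing_open[OF assms(2)])
  fix x assume "s < x" "x < t"
  then have "0 < x" using assms by simp
  then show "\<exists>y. (G3 has_real_derivative y) (at x) \<and> 0 < y"
    using G3_deriv[of x] by (intro exI[of _ "x / (1 + x ^ 3)"]) (auto intro!: divide_pos_pos add_pos_pos)
next
  show "continuous_on {s..t} G3"
    by (rule DERIV_continuous_on[OF has_field_derivative_at_within[OF G3_deriv]]) (use assms in auto)
qed

text \<open>
  Young's inequality gives \<open>\<phi>\<^sup>3 + 2 v\<^sup>3 u\<^sup>3 \<ge> v\<^sup>2 (u\<^sup>3)'\<close> for every \<open>v \<ge> 0\<close> and \<open>u = \<integral>\<phi>\<close>, so it suffices that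
  \<open>(v\<^sup>2)' + 2 v\<^sup>3\<close> is a negative constant. Separation of variables leads to \<open>v = c \<sigma>\<close>, where \<open>\<sigma>\<close>
  inverts \<open>s \<mapsto> 1 - (G3 s - G3 0) / c\<close>; the constant is then \<open>- 2 c\<^sup>3\<close>. The optimal weight, which is
  singular at \<open>0\<close>, is only reached as \<open>s0 \<rightarrow> \<infinity>\<close>.
\<close>

lemma Hardy3_aux:
  fixes \<phi> :: "real \<Rightarrow> real"
  assumes cont: "continuous_on {0..1} \<phi>" and nonneg: "\<And>z. z \<in> {0..1} \<Longrightarrow> 0 \<le> \<phi> z" and s0: "0 < s0"
  shows "2 * (G3 s0 - G3 0) ^ 3 * integral {0..1} (\<lambda>z. (integral {0..z} \<phi>) ^ 3)
    \<le> integral {0..1} (\<lambda>z. \<phi> z ^ 3)"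
proof -
  define c where "c = G3 s0 - G3 0"
  have c: "0 < c" using G3_strict_mono[of 0 s0] s0 by (simp add: c_def)
  \<comment> \<open>Decreases from 1 at 0 to 0 at \<open>s0\<close>, so that its inverse \<sigma>
    decreases from \<open>s0\<close> to 0 on [0,1]. Both boundary terms of \<sigma>^2 u^3 then
    vanish: at 1 because of \<sigma>, at 0 because of u.\<close>
  define h where "h s = 1 - (G3 s - G3 0) / c" for s
  have h_deriv: "(h has_real_derivative - (s / (1 + s ^ 3)) / c) (at s)" if "0 \<le> s" for s
    unfolding h_def using c by (auto intro!: derivative_eq_intros G3_deriv that)
  have h_cont: "continuous_on {0..s0} h"
    by (rule DERIV_continuous_on[OF has_field_derivative_at_within[OF h_deriv]]) auto
  have h_anti: "h t < h s" if "0 \<le> s" "s < t" for s t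
    using G3_strict_mono[OF that] c by (simp add: h_def divide_strict_right_mono)
  have h0: "h 0 = 1" and hs0: "h s0 = 0" using c by (auto simp: h_def c_def)
  have inj: "inj_on h {0..s0}"
    by (rule linorder_inj_onI') (use h_anti in fastforce)
  have img: "h ` {0..s0} = {0..1}"
  proof
    show "h ` {0..s0} \<subseteq> {0..1}"
      using h_anti[of 0] h_anti[of _ s0] h0 hs0 by (force simp: order_le_less)
    show "{0..1} \<subseteq> h ` {0..s0}"
    proof
      fix y :: real assume "y \<in> {0..1}"
      then obtain x where "0 \<le> x" "x \<le> s0" "h x = y"
        using IVT2'[of h s0 y 0] h_cont h0 hs0 s0 by auto
      then show "y \<in> h ` {0..s0}" by auto
    qed
  qed
  define \<sigma> where "\<sigma> = the_inv_into {0..s0} h"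
  have \<sigma>_mem: "\<sigma> z \<in> {0..s0}" and h\<sigma>: "h (\<sigma> z) = z" if "z \<in> {0..1}" for z
    using the_inv_into_into[OF inj _ subset_refl, of z] f_the_inv_into_f[OF inj, of z] that
    unfolding \<sigma>_def img by blast+
  have \<sigma>_cont: "continuous_on {0..1} \<sigma>"
    using continuous_on_inv[OF h_cont compact_Icc, of \<sigma>] the_inv_into_f_f[OF inj] img
    by (simp add: \<sigma>_def)
  have \<sigma>1: "\<sigma> 1 = 0"
    using the_inv_into_f_f[OF inj, of 0] s0 h0 by (simp add: \<sigma>_def)
  have \<sigma>_deriv: "(\<sigma> has_real_derivative - (c * (1 + \<sigma> z ^ 3) / \<sigma> z)) (at z)" and \<sigma>_pos: "0 < \<sigma> z"
    if z: "z \<in> {0<..<1}" for z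
  proof -
    have z': "z \<in> {0..1}" using z by auto
    have "\<sigma> z \<noteq> 0" using h\<sigma>[OF z'] h0 z by auto
    then show pos: "0 < \<sigma> z" using \<sigma>_mem[OF z'] by auto
    have "(\<sigma> has_real_derivative inverse (- (\<sigma> z / (1 + \<sigma> z ^ 3)) / c)) (at z)"
    proof (rule DERIV_inverse_function[where f = h and a = 0 and b = 1])
      show "(h has_real_derivative - (\<sigma> z / (1 + \<sigma> z ^ 3)) / c) (at (\<sigma> z))"
        using pos by (intro h_deriv) auto
      show "isCont \<sigma> z"
        using continuous_on_interior[OF \<sigma>_cont, of z] z by simp
      show "- (\<sigma> z / (1 + \<sigma> z ^ 3)) / c \<noteq> 0"
        using pos c by (auto simp: add_pos_pos) (metis add_pos_pos less_irrefl zero_less_one zero_less_power)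
    qed (use z h\<sigma> in auto)
    then show "(\<sigma> has_real_derivative - (c * (1 + \<sigma> z ^ 3) / \<sigma> z)) (at z)"
      by (simp add: divide_simps mult.commute)
  qed
  define u where "u z = integral {0..z} \<phi>" for z
  have u_deriv: "(u has_vector_derivative \<phi> z) (at z within {0..1})" if "z \<in> {0..1}" for z
    unfolding u_def by (rule integral_has_vector_derivative[OF cont that])
  have u_cont: "continuous_on {0..1} u"
    by (rule continuous_on_vector_derivative[OF u_deriv])
  have u_nonneg: "0 \<le> u z" if "z \<in> {0..1}" for z
    unfolding u_def using that nonneg
    by (intro integral_nonneg integrable_continuous_real continuous_on_subset[OF cont]) auto
  let ?d = "\<lambda>z. 3 * c\<^sup>2 * (\<sigma> z)\<^sup>2 * (u z)\<^sup>2 * \<phi> z - 2 * c ^ 3 * (1 + \<sigma> z ^ 3) * u z ^ 3"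
  have "(?d has_integral (c\<^sup>2 * (\<sigma> 1)\<^sup>2 * u 1 ^ 3 - c\<^sup>2 * (\<sigma> 0)\<^sup>2 * u 0 ^ 3)) {0..1}"
  \<comment> \<open>The interior version is required: \<sigma> vanishes at 1, where its derivative -
    c (1 + \<sigma>^3)/\<sigma> blows up.\<close>
  proof (rule fundamental_theorem_of_calculus_interior)
    show "continuous_on {0..1} (\<lambda>z. c\<^sup>2 * (\<sigma> z)\<^sup>2 * u z ^ 3)"
      by (intro continuous_intros \<sigma>_cont u_cont)
    fix z :: real assume z: "z \<in> {0<..<1}"
    have u1: "(u has_real_derivative \<phi> z) (at z)"
      using u_deriv[of z] z at_within_interior[of z "{0..1}"]
      by (simp add: has_real_derivative_iff_has_vector_derivative)
    have "((\<lambda>z. c\<^sup>2 * (\<sigma> z)\<^sup>2 * u z ^ 3) has_real_derivative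
        c\<^sup>2 * (2 * \<sigma> z * (- (c * (1 + \<sigma> z ^ 3) / \<sigma> z))) * u z ^ 3 + c\<^sup>2 * (\<sigma> z)\<^sup>2 * (3 * (u z)\<^sup>2 * \<phi> z)) (at z)"
      by (rule derivative_eq_intros \<sigma>_deriv[OF z] u1 refl)+ (simp add: algebra_simps power2_eq_square)
    also have "c\<^sup>2 * (2 * \<sigma> z * (- (c * (1 + \<sigma> z ^ 3) / \<sigma> z))) * u z ^ 3 + c\<^sup>2 * (\<sigma> z)\<^sup>2 * (3 * (u z)\<^sup>2 * \<phi> z) = ?d z"
    proof -
      have "2 * \<sigma> z * (- (c * (1 + \<sigma> z ^ 3) / \<sigma> z)) = - 2 * c * (1 + \<sigma> z ^ 3)"
        using \<sigma>_pos[OF z] by simp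
      then show ?thesis by (simp only:) (simp add: power2_eq_square power3_eq_cube algebra_simps)
    qed
    finally show "((\<lambda>z. c\<^sup>2 * (\<sigma> z)\<^sup>2 * u z ^ 3) has_vector_derivative ?d z) (at z)"
      by (simp add: has_real_derivative_iff_has_vector_derivative)
  qed simp
  moreover have "u 0 = 0" by (simp add: u_def)
  ultimately have d0: "(?d has_integral 0) {0..1}" using \<sigma>1 by simp
  have "((\<lambda>z. \<phi> z ^ 3 - 2 * c ^ 3 * u z ^ 3 - ?d z) has_integral
     integral {0..1} (\<lambda>z. \<phi> z ^ 3) - 2 * c ^ 3 * integral {0..1} (\<lambda>z. u z ^ 3) - 0) {0..1}"
    by (intro has_integral_diff has_integral_mult_right integrable_integral d0
        integrable_continuous_real continuous_intros cont u_cont)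
  then have "0 \<le> integral {0..1} (\<lambda>z. \<phi> z ^ 3) - 2 * c ^ 3 * integral {0..1} (\<lambda>z. u z ^ 3) - 0"
  proof (rule has_integral_nonneg)
    fix z :: real assume z: "z \<in> {0..1}"
    let ?b = "c * \<sigma> z * u z"
    have "0 \<le> ?b" using c \<sigma>_mem[OF z] u_nonneg[OF z] by auto
    \<comment> \<open>Young's inequality in factored form: the product equals \<phi>^3 - 3 b^2
      \<phi> + 2 b^3 with b = c \<sigma> u.\<close>
    then have "0 \<le> (\<phi> z - ?b)\<^sup>2 * (\<phi> z + 2 * ?b)" using nonneg[OF z] by auto
    also have "\<dots> = \<phi> z ^ 3 - 2 * c ^ 3 * u z ^ 3 - ?d z"
      by (simp add: power2_eq_square power3_eq_cube algebra_simps)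
    finally show "0 \<le> \<phi> z ^ 3 - 2 * c ^ 3 * u z ^ 3 - ?d z" .
  qed
  then show ?thesis by (simp add: c_def u_def)
qed

text \<open>The value of the integral of s/(1 + s^3) over the half-line: the logarithms cancel at
  infinity and vanish at 0, and the arctangent runs from - \<pi>/6 to \<pi>/2.\<close>

lemma G3_limit: "((\<lambda>s. G3 s - G3 0) \<longlongrightarrow> 2 * pi / (3 * sqrt 3)) at_top"
proof -
  have "(G3 \<longlongrightarrow> pi * inverse (root 2 3) / 2) at_top"
    unfolding G3_def by real_asymp
  then have "(G3 \<longlongrightarrow> pi / 2 / sqrt 3) at_top"
    by (simp add: sqrt_def field_simps)
   have G0: "G3 0 = - pi / 6 / sqrt 3"
  proof -
    have a: "arctan (1 / sqrt 3) = pi / 6"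
      using tan_30 arctan_tan[of "pi/6"] pi_gt_zero by (simp del: pi_gt_zero)
    have "G3 0 = - arctan (1 / sqrt 3) / sqrt 3" by (simp add: G3_def arctan_minus)
    then show ?thesis unfolding a by simp
  qed
  from tendsto_diff[OF \<open>(G3 \<longlongrightarrow> pi / 2 / sqrt 3) at_top\<close> tendsto_const]
  have "((\<lambda>s. G3 s - G3 0) \<longlongrightarrow> pi / 2 / sqrt 3 - (- pi / 6 / sqrt 3)) at_top"
    unfolding G0 .
  moreover have "pi / 2 / sqrt 3 - (- pi / 6 / sqrt 3) = 2 * pi / (3 * sqrt 3)" by (simp add: field_simps)
  ultimately show ?thesis by simp
qed

text \<open>As \<open>s0\<close> tends to infinity the constant of \<open>Hardy3_aux\<close> becomes
  2 c^3 with c = 2 \<pi>/(3 sqrt 3). Its inverse cube root is \<open>b3\<close>, because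
  sin(\<pi>/3) = sqrt 3/2.\<close>

lemma Hardy3:
  fixes \<phi> :: "real \<Rightarrow> real"
  assumes cont: "continuous_on {0..1} \<phi>" and nonneg: "\<And>z. z \<in> {0..1} \<Longrightarrow> 0 \<le> \<phi> z"
  shows "integral {0..1} (\<lambda>z. (integral {0..z} \<phi>) ^ 3) \<le> b3 ^ 3 * integral {0..1} (\<lambda>z. \<phi> z ^ 3)"
proof -
  let ?c = "2 * pi / (3 * sqrt 3)"
  have "2 * ?c ^ 3 * integral {0..1} (\<lambda>z. (integral {0..z} \<phi>) ^ 3) \<le> integral {0..1} (\<lambda>z. \<phi> z ^ 3)"
  proof (rule tendsto_upperbound)
    show "((\<lambda>s. 2 * (G3 s - G3 0) ^ 3 * integral {0..1} (\<lambda>z. (integral {0..z} \<phi>) ^ 3)) \<longlongrightarrow>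
        2 * ?c ^ 3 * integral {0..1} (\<lambda>z. (integral {0..z} \<phi>) ^ 3)) at_top"
      by (intro tendsto_intros G3_limit)
    show "\<forall>\<^sub>F s in at_top. 2 * (G3 s - G3 0) ^ 3 * integral {0..1} (\<lambda>z. (integral {0..z} \<phi>) ^ 3)
        \<le> integral {0..1} (\<lambda>z. \<phi> z ^ 3)"
      using eventually_gt_at_top[of 0]
      by eventually_elim (rule Hardy3_aux[OF cont nonneg])
  qed simp
  moreover have b3: "b3 ^ 3 * (2 * ?c ^ 3) = 1"
  proof -
    have "(2 powr (1/3)) ^ 3 = (2::real)" by (simp add: powr_power)
    then have "(b3 * ?c) ^ 3 * 2 = 1"
      by (simp add: b3_def sin_60 power_divide power_mult_distrib field_simps)
    then show ?thesis by (simp only: power_mult_distrib mult_ac)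
  qed
  moreover have "0 < b3" by (simp add: b3_def sin_60)
  ultimately have "b3 ^ 3 * (2 * ?c ^ 3 * integral {0..1} (\<lambda>z. (integral {0..z} \<phi>) ^ 3)) \<le>
      b3 ^ 3 * integral {0..1} (\<lambda>z. \<phi> z ^ 3)"
    by (intro mult_left_mono) simp_all
  then have "(b3 ^ 3 * (2 * ?c ^ 3)) * integral {0..1} (\<lambda>z. (integral {0..z} \<phi>) ^ 3) \<le>
      b3 ^ 3 * integral {0..1} (\<lambda>z. \<phi> z ^ 3)"
    by (simp only: mult.assoc)
  then show ?thesis unfolding b3 by simp
qed

section \<open>Oscillation bounds on a line, and a threshold argument for differential
  inequalities\<close>

text \<open>The points x and y cut the period circle into two arcs, and g varies by at least |g x -
  g y| along each of them; hence the factor 2.\<close>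

lemma periodic_oscillation:
  fixes g g' :: "real \<Rightarrow> real"
  assumes g: "\<And>x. x \<in> {0..L} \<Longrightarrow> (g has_vector_derivative g' x) (at x within {0..L})"
    and cont: "continuous_on {0..L} g'" and per: "g 0 = g L"
    and x: "x \<in> {0..L}" and y: "y \<in> {0..L}"
  shows "2 * (g x - g y) \<le> integral {0..L} (\<lambda>x. \<bar>g' x\<bar>)"
proof -
  have FTC: "\<bar>g b - g a\<bar> \<le> integral {a..b} (\<lambda>x. \<bar>g' x\<bar>)" if "0 \<le> a" "a \<le> b" "b \<le> L" for a b
  proof -
    have "(g' has_integral g b - g a) {a..b}"
      by (intro fundamental_theorem_of_calculus has_vector_derivative_within_subset[OF g])
        (use that in auto)
    moreover have c: "continuous_on {a..b} (\<lambda>x. \<bar>g' x\<bar>)"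
      using that by (intro continuous_intros continuous_on_subset[OF cont]) auto
    ultimately show ?thesis
      using integral_norm_bound_integral[of g' "{a..b}" "\<lambda>x. \<bar>g' x\<bar>"] integrable_continuous_real[OF c]
      by (auto simp: integral_unique has_integral_integrable)
  qed
  have *: "2 * \<bar>g b - g a\<bar> \<le> integral {0..L} (\<lambda>x. \<bar>g' x\<bar>)" if ab: "0 \<le> a" "a \<le> b" "b \<le> L" for a b
  proof -
    have i: "(\<lambda>x. \<bar>g' x\<bar>) integrable_on {0..L}"
      by (intro integrable_continuous_real continuous_intros cont)
    have i2: "(\<lambda>x. \<bar>g' x\<bar>) integrable_on {a..L}"
      by (rule integrable_on_subinterval[OF i]) (use ab in auto)
    have "integral {0..L} (\<lambda>x. \<bar>g' x\<bar>) = integral {0..a} (\<lambda>x. \<bar>g' x\<bar>) + integral {a..L} (\<lambda>x. \<bar>g' x\<bar>)"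
      using ab i by (intro Henstock_Kurzweil_Integration.integral_combine[symmetric]) auto
    also have "integral {a..L} (\<lambda>x. \<bar>g' x\<bar>) = integral {a..b} (\<lambda>x. \<bar>g' x\<bar>) + integral {b..L} (\<lambda>x. \<bar>g' x\<bar>)"
      using ab i2 by (intro Henstock_Kurzweil_Integration.integral_combine[symmetric]) auto
    finally have "integral {0..L} (\<lambda>x. \<bar>g' x\<bar>) \<ge> \<bar>g a - g 0\<bar> + (\<bar>g b - g a\<bar> + \<bar>g L - g b\<bar>)"
      using FTC[of 0 a] FTC[of a b] FTC[of b L] ab by simp
    moreover have "\<bar>g b - g a\<bar> \<le> \<bar>g a - g 0\<bar> + \<bar>g L - g b\<bar>" using per by linarith
    moreover have "2 * X \<le> I" if "A + (X + B) \<le> I" "X \<le> A + B" for A B X I :: real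
      using that by linarith
    ultimately show ?thesis by blast
  qed
  have "2 * \<bar>g x - g y\<bar> \<le> integral {0..L} (\<lambda>x. \<bar>g' x\<bar>)"
    using *[of x y] *[of y x] x y by (cases "x \<le> y") (auto simp: abs_minus_commute)
  moreover have "2 * (g x - g y) \<le> 2 * \<bar>g x - g y\<bar>" by (intro mult_left_mono abs_ge_self) simp
  ultimately show ?thesis by (rule order_trans[rotated])
qed

text \<open>Averaging \<open>periodic_oscillation\<close> over y bounds g x by the mean of g plus
  half the total variation. Writing both terms under one integral gives the line integrals used for
  the Loomis-Whitney inequality.\<close>

lemma periodic_sup_bound:
  fixes g g' :: "real \<Rightarrow> real"
  assumes g: "\<And>x. x \<in> {0..L} \<Longrightarrow> (g has_vector_derivative g' x) (at x within {0..L})"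
    and cont: "continuous_on {0..L} g'" and per: "g 0 = g L" and L: "0 < L"
    and x: "x \<in> {0..L}"
  shows "g x \<le> integral {0..L} (\<lambda>x. g x / L + \<bar>g' x\<bar> / 2)"
proof -
  have contg: "continuous_on {0..L} g"
    by (rule continuous_on_vector_derivative[OF g])
  let ?I = "integral {0..L} (\<lambda>x. \<bar>g' x\<bar>)"
  have "((\<lambda>y. g y / L + ?I / 2 / L) has_integral integral {0..L} g / L + L * (?I / 2 / L)) {0..L}"
    using has_integral_const_real[of "?I / 2 / L" 0 L] L
    by (intro has_integral_add has_integral_divide integrable_integral integrable_continuous_real contg) simp
  moreover have "((\<lambda>y. g x / L) has_integral L * (g x / L)) {0..L}"
    using has_integral_const_real[of "g x / L" 0 L] L by simp
  moreover have "g x / L \<le> g y / L + ?I / 2 / L" if "y \<in> {0..L}" for y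
    using divide_right_mono[OF periodic_oscillation[OF g cont per x that], of "2 * L"] L
    by (simp add: diff_divide_distrib)
  ultimately have "L * (g x / L) \<le> integral {0..L} g / L + L * (?I / 2 / L)"
    using has_integral_le by blast
  moreover have "((\<lambda>x. g x / L + \<bar>g' x\<bar> / 2) has_integral integral {0..L} g / L + ?I / 2) {0..L}"
    by (intro has_integral_add has_integral_divide integrable_integral integrable_continuous_real
        continuous_intros contg cont)
  ultimately show ?thesis using L by (simp add: integral_unique)
qed

text \<open>Serves in place of Gronwall's inequality for both energies. Above the level m the
  function loses at least c per unit time, so being nonnegative it must reach m. Later it cannot
  exceed m, since between its last time at or below m and the present it could only have
  decreased.\<close>

lemma eventually_below_threshold:
  fixes y y' :: "real \<Rightarrow> real"
  assumes der: "\<And>t. t \<ge> t0 \<Longrightarrow> (y has_vector_derivative y' t) (at t within {0..})"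
    and t0: "0 \<le> t0" and c: "0 < c" and dec: "\<And>t. t \<ge> t0 \<Longrightarrow> m \<le> y t \<Longrightarrow> y' t \<le> - c"
    and nonneg: "\<And>t. t \<ge> t0 \<Longrightarrow> 0 \<le> y t"
  shows "\<forall>\<^sub>F t in at_top. y t \<le> m"
proof -
  have cont: "continuous_on {a..b} y" if "t0 \<le> a" for a b
  proof -
    have "continuous (at t within {a..b}) y" if "t \<in> {a..b}" for t
      using has_vector_derivative_continuous[OF der[of t]] \<open>t0 \<le> a\<close> t0 that
      by (auto intro: continuous_within_subset)
    then show ?thesis by (simp add: continuous_on_eq_continuous_within)
  qed
  have drop: "y b \<le> y a - c * (b - a)" if ab: "t0 \<le> a" "a < b" and ge: "\<And>t. a < t \<Longrightarrow> t < b \<Longrightarrow> m \<le> y t" for a b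
  proof -
    have "\<exists>t\<in>{a<..<b}. y b - y a = (b - a) *\<^sub>R y' t"
    proof (rule mvt[OF ab(2) cont[OF ab(1)], where f' = "\<lambda>t h. h *\<^sub>R y' t"])
      fix t assume t: "a < t" "t < b"
      then have "0 < t" "t0 \<le> t" using ab t0 by auto
      moreover from this have "at t within {0..} = at t"
        by (intro at_within_interior) (simp add: interior_real_atLeast)
      ultimately show "(y has_derivative (\<lambda>h. h *\<^sub>R y' t)) (at t)"
        using der[of t] by (metis has_vector_derivative_def)
    qed (meson greaterThanLessThan_iff)
    then obtain t where t: "a < t" "t < b" "y b - y a = (b - a) * y' t" by auto
    have "(b - a) * y' t \<le> (b - a) * (- c)"
      using t ab ge dec[of t] by (intro mult_left_mono) auto
    then show ?thesis using t by (simp add: algebra_simps)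
  qed
  have "\<exists>t1\<ge>t0. y t1 \<le> m"
  proof (rule ccontr)
    assume "\<not> ?thesis"
    then have gt: "m < y t" if "t0 \<le> t" for t using that not_le by blast
    \<comment> \<open>By this time linear decay at rate c would have taken the function from y t0
      down to -1.\<close>
    define b where "b = t0 + (y t0 + 1) / c"
    have "t0 < b" using c nonneg[of t0] by (simp add: b_def add_nonneg_pos)
    then have "y b \<le> y t0 - c * (b - t0)" using gt by (intro drop) (auto intro: less_imp_le)
    also have "\<dots> = -1" using c by (simp add: b_def)
    finally show False using nonneg[of b] \<open>t0 < b\<close> by simp
  qed
  then obtain t1 where t1: "t0 \<le> t1" "y t1 \<le> m" by blast
  have "y t \<le> m" if t: "t1 \<le> t" for t
  proof (rule ccontr)
    assume gt: "\<not> y t \<le> m"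
    \<comment> \<open>A compact set of times; its maximum is the last time at or below m.\<close>
    define S where "S = {t1..t} \<inter> y -` {..m}"
    have "closed S" unfolding S_def
      by (rule continuous_closed_preimage[OF cont[OF t1(1)]]) auto
    moreover have "bounded S"
      by (rule bounded_subset[OF bounded_closed_interval[of t1 t]]) (simp add: S_def)
    ultimately have S: "compact S" by (simp add: compact_eq_bounded_closed)
    have "t1 \<in> S" using t1 t by (auto simp: S_def)
    then obtain s where s: "s \<in> S" "\<forall>r\<in>S. r \<le> s" using compact_attains_sup[OF S] by auto
    have "s < t" using s gt by (auto simp: S_def order_le_less)
    have "y t \<le> y s - c * (t - s)"
    proof (rule drop)
      fix r assume "s < r" "r < t"
      have "t1 \<le> s" using s by (simp add: S_def)
      then have "r \<notin> S" "r \<in> {t1..t}" using s(2) \<open>s < r\<close> \<open>r < t\<close> by fastforce+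
      then show "m \<le> y r" by (simp add: S_def)
    qed (use s t1 \<open>s < t\<close> in \<open>auto simp: S_def\<close>)
    also have "\<dots> \<le> m" using s c \<open>s < t\<close> by (auto simp: S_def intro: order_trans[rotated])
    finally show False using gt by simp
  qed
  then show ?thesis by (auto simp: eventually_at_top_linorder)
qed

section \<open>Weak derivatives of smooth functions\<close>

text \<open>Dividing exp(-1/s) by powers of s makes the family closed, up to linear combinations,
  under differentiation, so smoothness across 0 becomes an induction on the order for all n at
  once.\<close>

definition flat_exp :: "nat \<Rightarrow> real \<Rightarrow> real" where
  "flat_exp n s = (if 0 < s then exp (- (1 / s)) / s ^ n else 0)"

lemma flat_exp_tendsto_0: "(flat_exp n \<longlongrightarrow> 0) (at 0)"
proof -
  have "((\<lambda>s. (inverse s) ^ n / exp (inverse s)) \<longlongrightarrow> (0::real)) (at_right 0)"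
    by (rule filterlim_compose[OF tendsto_power_div_exp_0 filterlim_inverse_at_top_right])
  then have "(flat_exp n \<longlongrightarrow> 0) (at_right 0)"
    by (rule Lim_transform_eventually)
      (auto simp: flat_exp_def eventually_at_right_less exp_minus field_simps eventually_at_filter)
  moreover have "(flat_exp n \<longlongrightarrow> 0) (at_left 0)"
    by (rule Lim_transform_eventually[OF tendsto_const])
      (auto simp: flat_exp_def eventually_at_filter)
  ultimately show ?thesis by (simp add: filterlim_at_split)
qed

lemma flat_exp_deriv:
  "(flat_exp n has_real_derivative flat_exp (n + 2) s - real n * flat_exp (n + 1) s) (at s)"
proof -
  consider "0 < s" | "s < 0" | "s = 0" by linarith
  then show ?thesis
  proof cases
    case 1
    have "((\<lambda>s. exp (- (1 / s)) / s ^ n) has_real_derivative flat_exp (n + 2) s - real n * flat_exp (n + 1) s) (at s)"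
    proof -
      have pw: "real n * s ^ (n - Suc 0) = real n * s ^ n / s" using 1 by (cases n) auto
      show ?thesis
        using 1 by (auto intro!: derivative_eq_intros simp: pw flat_exp_def) (simp add: field_simps power2_eq_square)
    qed
    then show ?thesis
      by (rule has_field_derivative_transform_within_open[where S = "{0<..}"])
        (use 1 in \<open>auto simp: flat_exp_def\<close>)
  next
    case 2
    have "((\<lambda>s. 0) has_real_derivative flat_exp (n + 2) s - real n * flat_exp (n + 1) s) (at s)"
      using 2 by (simp add: flat_exp_def)
    then show ?thesis
      by (rule has_field_derivative_transform_within_open[where S = "{..<0}"])
        (use 2 in \<open>auto simp: flat_exp_def\<close>)
  next
    case 3
    \<comment> \<open>The difference quotient at 0 is \<open>flat_exp (n + 1)\<close>, which tends
      to 0.\<close>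
    have "((\<lambda>h. (flat_exp n (0 + h) - flat_exp n 0) / h) \<longlongrightarrow> 0) (at 0)"
      by (rule Lim_transform_eventually[OF flat_exp_tendsto_0[of "n + 1"]])
        (auto simp: flat_exp_def eventually_at_filter)
    then show ?thesis unfolding 3 DERIV_def by (simp add: flat_exp_def)
  qed
qed

lemma Ck_on_flat_exp: "Ck_on k UNIV (flat_exp n)"
proof (induction k arbitrary: n)
  case 0
  show ?case using flat_exp_deriv by (auto intro!: continuous_at_imp_continuous_on DERIV_isCont)
next
  case (Suc k)
  have "Ck_on k UNIV (\<lambda>s. v * (flat_exp (n + 2) s + (- real n) * flat_exp (n + 1) s))" for v
    by (intro Ck_on_bounded_linear[OF bounded_linear_mult_right] Ck_on_add Suc)
  then show ?case
    using flat_exp_deriv[of n]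
    by (auto intro!: exI[of _ "\<lambda>s v. v * (flat_exp (n + 2) s - real n * flat_exp (n + 1) s)"]
        simp: has_field_derivative_def mult_commute_abs)
qed

lemma smooth_on_flat_exp_affine:
  fixes a :: real
  assumes L: "bounded_linear L"
  shows "smooth_on UNIV (\<lambda>x. flat_exp n (a + L x))"
  using smooth_on_affine[OF L, of UNIV a UNIV "flat_exp n"] Ck_on_flat_exp
  by (simp add: smooth_on_def)

text \<open>Nonzero exactly on the open box and bounded by 1. As \<open>m\<close> grows, each factor
  with positive argument tends to 1, so the bumps tend to the indicator of the box; this is how test
  functions reach integrals over boxes.\<close>

definition bump :: "real^3 \<Rightarrow> real^3 \<Rightarrow> nat \<Rightarrow> real^3 \<Rightarrow> real" where
  "bump a b m x = (\<Prod>i\<in>UNIV. flat_exp 0 (real (Suc m) * (x $ i - a $ i)) * flat_exp 0 (real (Suc m) * (b $ i - x $ i)))"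

lemma smooth_on_prod:
  fixes f :: "'i \<Rightarrow> 'a::euclidean_space \<Rightarrow> real"
  shows "(\<And>i. i \<in> I \<Longrightarrow> smooth_on S (f i)) \<Longrightarrow> smooth_on S (\<lambda>x. \<Prod>i\<in>I. f i x)"
  by (induction I rule: infinite_finite_induct) (auto intro: smooth_intros)

lemma smooth_on_bump: "smooth_on UNIV (bump a b m)"
proof -
  have L: "bounded_linear (\<lambda>x::real^3. c * x $ i)" for c i
    by (intro bounded_linear_const_mult bounded_linear_vec_nth)
  have "smooth_on UNIV (\<lambda>x. flat_exp 0 (- real (Suc m) * a $ i + real (Suc m) * x $ i) *
      flat_exp 0 (real (Suc m) * b $ i + (- real (Suc m)) * x $ i))" for i
    by (intro smooth_intros smooth_on_flat_exp_affine L)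
  then have "smooth_on UNIV (\<lambda>x. \<Prod>i\<in>UNIV. flat_exp 0 (- real (Suc m) * a $ i + real (Suc m) * x $ i) *
      flat_exp 0 (real (Suc m) * b $ i + (- real (Suc m)) * x $ i))"
    by (intro smooth_on_prod)
  then show ?thesis by (simp add: bump_def[abs_def] algebra_simps)
qed

lemma bump_nonzero_iff: "bump a b m x \<noteq> 0 \<longleftrightarrow> x \<in> box a b"
  by (auto simp: bump_def flat_exp_def mem_box_cart zero_less_mult_iff)

lemma bump_bounds: "0 \<le> bump a b m x" "bump a b m x \<le> 1"
  unfolding bump_def
  by (auto intro!: prod_nonneg prod_le_1 mult_nonneg_nonneg mult_le_one simp: flat_exp_def)

lemma bump_tendsto: "(\<lambda>m. bump a b m x) \<longlonglongrightarrow> indicator (box a b) x"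
proof (cases "x \<in> box a b")
  case True
  have *: "(\<lambda>m. flat_exp 0 (real (Suc m) * c)) \<longlonglongrightarrow> 1" if "0 < c" for c :: real
  proof -
    have "(\<lambda>m. exp (- (1 / (real (Suc m) * c)))) \<longlonglongrightarrow> 1"
      using that by real_asymp
    then show ?thesis using that by (simp add: flat_exp_def)
  qed
  have "(\<lambda>m. bump a b m x) \<longlonglongrightarrow> (\<Prod>i\<in>(UNIV::3 set). 1 * 1)"
    unfolding bump_def by (intro tendsto_prod tendsto_mult *) (use True in \<open>auto simp: mem_box_cart\<close>)
  then show ?thesis using True by simp
next
  case False
  then have "bump a b m x = 0" for m using bump_nonzero_iff by blast
  then show ?thesis using False by simp
qed

lemma closure_bump_support: "closure {x. bump a b m x \<noteq> 0} \<subseteq> cbox a b"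
  by (rule closure_minimal) (use box_subset_cbox[of a b] in \<open>auto simp: bump_nonzero_iff\<close>)

lemma test_fun_bump:
  assumes "cbox a b \<subseteq> interior strip"
  shows "test_fun (bump a b m)"
proof -
  have "compact (closure {x. bump a b m x \<noteq> 0})"
    using closure_bump_support[of a b m] bounded_cbox bounded_subset
    by (metis closed_closure compact_eq_bounded_closed)
  then show ?thesis
    using assms closure_bump_support[of a b m] smooth_on_bump by (auto simp: test_fun_def)
qed

text \<open>Almost every point is the limit of averages over small cubes at that point.\<close>

lemma ae_zero_on_cbox:
  fixes g :: "real^3 \<Rightarrow> real"
  assumes g: "g absolutely_integrable_on cbox c d"
    and zero: "\<And>a b. cbox a b \<subseteq> cbox c d \<Longrightarrow> integral (cbox a b) g = 0"
  shows "AE x in lebesgue. x \<in> cbox c d \<longrightarrow> g x = 0"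
proof -
  define f where "f x = (if x \<in> cbox c d then g x else 0)" for x
  have gi: "g integrable_on cbox c d" using g set_lebesgue_integral_eq_integral(1) by blast
  have "f integrable_on cbox a b" for a b
  proof -
    have "f integrable_on UNIV" unfolding f_def using gi by (simp add: integrable_restrict_UNIV)
    then show ?thesis by (rule integrable_on_subcbox) simp
  qed
  then obtain N where N: "negligible N" and lim: "\<And>x e. x \<notin> N \<Longrightarrow> 0 < e \<Longrightarrow>
      \<exists>d>0. \<forall>h. 0 < h \<and> h < d \<longrightarrow> norm (integral (cbox x (x + h *\<^sub>R One)) f /\<^sub>R h ^ DIM(real^3) - f x) < e"
    using integrable_ccontinuous_explicit[of f] by metis
  have "g x = 0" if x: "x \<in> box c d" "x \<notin> N" for x
  proof (rule ccontr)
    assume "g x \<noteq> 0"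
    then obtain r where r: "0 < r" "\<And>h. 0 < h \<Longrightarrow> h < r \<Longrightarrow>
        norm (integral (cbox x (x + h *\<^sub>R One)) f /\<^sub>R h ^ DIM(real^3) - f x) < norm (g x)"
      using lim[OF x(2), of "norm (g x)"] by auto
    obtain e where e: "0 < e" "cball x e \<subseteq> box c d"
      using open_contains_cball[of "box c d"] x open_box by blast
    \<comment> \<open>Small enough for the averaging estimate and for the cube to stay inside the
      open box.\<close>
    define h where "h = min (r / 2) (e / (1 + norm (One :: real^3)))"
    have h: "0 < h" "h < r" using r e by (auto simp: h_def add_pos_nonneg)
    have "h * norm (One :: real^3) \<le> e"
    proof -
      have "h * norm (One :: real^3) \<le> e / (1 + norm (One :: real^3)) * (1 + norm (One :: real^3))"
        using h by (intro mult_mono) (auto simp: h_def)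
      also have "\<dots> = e" by (simp add: add_nonneg_eq_0_iff)
      finally show ?thesis .
    qed
    then have "x + h *\<^sub>R One \<in> box c d" using e h by (auto simp: dist_norm subset_iff)
    then have sub: "cbox x (x + h *\<^sub>R One) \<subseteq> cbox c d"
      using x by (intro subset_box_imp) (auto simp: mem_box intro: less_imp_le)
    have "integral (cbox x (x + h *\<^sub>R One)) f = integral (cbox x (x + h *\<^sub>R One)) g"
      by (rule integral_cong) (use sub in \<open>auto simp: f_def\<close>)
    then have "integral (cbox x (x + h *\<^sub>R One)) f = 0" using zero[OF sub] by simp
    moreover have "f x = g x" using x box_subset_cbox[of c d] by (auto simp: f_def)
    ultimately show False using r(2)[OF h] by simp
  qed
  then have "{x. \<not> (x \<in> cbox c d \<longrightarrow> g x = 0)} \<subseteq> N \<union> (cbox c d - box c d)" by auto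
  moreover have "negligible (N \<union> (cbox c d - box c d))"
    using N negligible_frontier_interval[of c d] by (simp add: negligible_Un_eq)
  ultimately have "negligible {x. \<not> (x \<in> cbox c d \<longrightarrow> g x = 0)}"
    using negligible_subset by blast
  then show ?thesis
    by (auto simp: eventually_ae_filter negligible_iff_null_sets intro!: exI[of _ "{x. \<not> (x \<in> cbox c d \<longrightarrow> g x = 0)}"])
qed

text \<open>The fundamental lemma of the calculus of variations. Bumps tend to the indicator of an
  open box, so by dominated convergence g has integral 0 over every closed box in \<Omega>, which
  forces g to vanish almost everywhere on each such box.\<close>

lemma ae_zero_test:
  assumes g: "locally_integrable g" and \<Omega>: "open \<Omega>" "\<Omega> \<subseteq> interior strip"
    and zero: "\<And>\<phi>. test_fun \<phi> \<Longrightarrow> closure {x. \<phi> x \<noteq> 0} \<subseteq> \<Omega> \<Longrightarrow> (LINT x:strip|lebesgue. g x * \<phi> x) = 0"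
  shows "AE x in lebesgue. x \<in> \<Omega> \<longrightarrow> g x = 0"
proof -
  have box: "integral (cbox a b) g = 0" if ab: "cbox a b \<subseteq> \<Omega>" for a b
  proof -
    have abs: "g absolutely_integrable_on cbox a b"
      using g ab \<Omega>(2) by (auto simp: locally_integrable_def)
    then have gi: "integrable lebesgue (\<lambda>x. indicator (cbox a b) x *\<^sub>R g x)"
      by (simp add: set_integrable_def)
    have st: "x \<in> strip" if "x \<in> box a b" for x
      using that ab \<Omega>(2) interior_subset[of strip] box_subset_cbox[of a b] by blast
    have "(\<lambda>m. LINT x|lebesgue. bump a b m x * (indicator (cbox a b) x *\<^sub>R g x)) \<longlonglongrightarrow>
        (LINT x|lebesgue. indicator (box a b) x * (indicator (cbox a b) x *\<^sub>R g x))"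
    proof (rule integral_dominated_convergence[where w = "\<lambda>x. norm (indicator (cbox a b) x *\<^sub>R g x)"])
      show "(\<lambda>x. indicator (box a b) x * (indicator (cbox a b) x *\<^sub>R g x)) \<in> borel_measurable lebesgue"
        by (intro borel_measurable_times borel_measurable_indicator borel_measurable_integrable[OF gi]) simp
      show "(\<lambda>x. bump a b m x * (indicator (cbox a b) x *\<^sub>R g x)) \<in> borel_measurable lebesgue" for m
      proof -
        have "bump a b m \<in> borel_measurable borel"
          by (rule borel_measurable_continuous_onI[OF smooth_on_continuous[OF smooth_on_bump]])
        then have "bump a b m \<in> borel_measurable lebesgue"
          using measurable_completion measurable_lborel2 by blast
        then show ?thesis by (intro borel_measurable_times borel_measurable_integrable[OF gi])
      qed
      show "integrable lebesgue (\<lambda>x. norm (indicator (cbox a b) x *\<^sub>R g x))" using gi by auto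
      show "AE x in lebesgue. (\<lambda>m. bump a b m x * (indicator (cbox a b) x *\<^sub>R g x)) \<longlonglongrightarrow>
          indicator (box a b) x * (indicator (cbox a b) x *\<^sub>R g x)"
        by (intro always_eventually allI tendsto_mult bump_tendsto tendsto_const)
      show "AE x in lebesgue. norm (bump a b m x * (indicator (cbox a b) x *\<^sub>R g x)) \<le>
          norm (indicator (cbox a b) x *\<^sub>R g x)" for m
        using bump_bounds[of a b m] by (auto simp: abs_mult intro!: mult_left_le_one_le)
    qed
    moreover have "(LINT x|lebesgue. bump a b m x * (indicator (cbox a b) x *\<^sub>R g x)) = 0" for m
    proof -
      have "bump a b m x * (indicator (cbox a b) x *\<^sub>R g x) = indicator strip x *\<^sub>R (g x * bump a b m x)" for x
      proof (cases "x \<in> box a b")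
        case True
        then show ?thesis using st box_subset_cbox[of a b] by auto
      next
        case False
        then have "bump a b m x = 0" using bump_nonzero_iff by blast
        then show ?thesis by simp
      qed
      then have "(LINT x|lebesgue. bump a b m x * (indicator (cbox a b) x *\<^sub>R g x)) =
         (LINT x:strip|lebesgue. g x * bump a b m x)"
        unfolding set_lebesgue_integral_def by (simp only:)
      also have "\<dots> = 0"
        by (rule zero[OF test_fun_bump]) (use ab \<Omega>(2) closure_bump_support[of a b m] in auto)
      finally show ?thesis .
    qed
    ultimately have "(LINT x|lebesgue. indicator (box a b) x * (indicator (cbox a b) x *\<^sub>R g x)) = 0"
      by (simp add: LIMSEQ_const_iff)
    also have "(\<lambda>x. indicator (box a b) x * (indicator (cbox a b) x *\<^sub>R g x)) = (\<lambda>x. indicator (box a b) x *\<^sub>R g x)"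
    proof
      fix x show "indicator (box a b) x * (indicator (cbox a b) x *\<^sub>R g x) = indicator (box a b) x *\<^sub>R g x"
        using box_subset_cbox[of a b] by (cases "x \<in> box a b") auto
    qed
    finally have "(LINT x:box a b|lebesgue. g x) = 0" by (simp add: set_lebesgue_integral_def)
    moreover have "set_integrable lebesgue (box a b) g"
      by (rule set_integrable_subset[OF abs]) (use box_subset_cbox in auto)
    ultimately have "integral (box a b) g = 0"
      using set_lebesgue_integral_eq_integral(2) by metis
    then show ?thesis by (simp add: integral_open_interval)
  qed
  \<comment> \<open>A countable cover, so that the exceptional null sets together stay null.\<close>
  obtain D where D: "countable D" "D \<subseteq> Pow \<Omega>" "\<And>X. X \<in> D \<Longrightarrow> \<exists>a b. X = cbox a b" "\<Union>D = \<Omega>"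
    using open_countable_Union_open_cbox[OF \<Omega>(1)] by metis
  have "AE x in lebesgue. \<forall>X\<in>D. x \<in> X \<longrightarrow> g x = 0"
  proof (subst AE_ball_countable[OF D(1)], rule ballI)
    fix X assume X: "X \<in> D"
    then obtain c d where cd: "X = cbox c d" using D by blast
    have sub: "cbox c d \<subseteq> \<Omega>" using X cd D by blast
    show "AE x in lebesgue. x \<in> X \<longrightarrow> g x = 0"
      unfolding cd
    proof (rule ae_zero_on_cbox)
      show "g absolutely_integrable_on cbox c d"
        using g sub \<Omega>(2) by (auto simp: locally_integrable_def)
    qed (use box sub in blast)
  qed
  then show ?thesis by eventually_elim (use D(4) in blast)
qed

section \<open>Geometry of the strip, and weak derivatives of smooth fields\<close>

lemma closed_strip: "closed strip"
proof -
  have "strip = {x. x $ 3 \<le> 1} \<inter> {x. 0 \<le> x $ 3}" by (auto simp: strip_def)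
  then show ?thesis
    using closed_halfspace_component_le_cart[of 3 1] closed_halfspace_component_ge_cart[of 0 3]
    by (metis closed_Int)
qed

lemma interior_strip: "interior strip = {x. 0 < x $ 3 \<and> x $ 3 < 1}"
proof
  have o: "open {x::real^3. 0 < x $ 3 \<and> x $ 3 < 1}"
    by (simp add: open_Collect_conj open_halfspace_component_lt_cart open_halfspace_component_gt_cart)
  show "{x. 0 < x $ 3 \<and> x $ 3 < 1} \<subseteq> interior strip"
    by (rule interior_maximal[OF _ o]) (auto simp: strip_def)
  show "interior strip \<subseteq> {x. 0 < x $ 3 \<and> x $ 3 < 1}"
  proof
    fix x assume "x \<in> interior strip"
    then obtain e where e: "0 < e" "cball x e \<subseteq> strip" by (auto simp: mem_interior_cball)
    have "norm (e *\<^sub>R axis 3 1 :: real^3) = e" using e by simp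
    then have "x + e *\<^sub>R axis 3 1 \<in> cball x e" "x - e *\<^sub>R axis 3 1 \<in> cball x e"
      by (simp_all add: dist_norm)
    then have "x + e *\<^sub>R axis 3 1 \<in> strip" "x - e *\<^sub>R axis 3 1 \<in> strip" using e by auto
    then show "x \<in> {x. 0 < x $ 3 \<and> x $ 3 < 1}" using e by (auto simp: strip_def axis_def)
  qed
qed

lemma axis_strip: "x \<in> strip \<Longrightarrow> i \<noteq> 3 \<Longrightarrow> x + c *\<^sub>R axis i 1 \<in> strip"
  by (auto simp: strip_def axis_def)

lemma pd_zero_outside_closed:
  assumes "\<And>y. y \<in> strip \<Longrightarrow> y \<notin> K \<Longrightarrow> \<phi> y = 0" "closed K" "x \<in> strip" "x \<notin> K"
  shows "pd i \<phi> x = (0::real)"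
proof -
  obtain e where e: "0 < e" "ball x e \<subseteq> - K"
    using assms(2,4) open_contains_ball[of "- K"] by (auto simp: open_Compl)
  have "(\<phi> has_derivative (\<lambda>v. 0)) (at x within strip)"
  proof (rule has_derivative_transform_within[OF _ e(1) assms(3)])
    show "((\<lambda>_. 0::real) has_derivative (\<lambda>v. 0)) (at x within strip)" by simp
    fix y assume "y \<in> strip" "dist y x < e"
    then show "0 = \<phi> y" using assms(1)[of y] e(2) by (auto simp: dist_commute subset_iff)
  qed
  from dd_eqI[OF fat_strip assms(3) this] show ?thesis by (simp add: pd_eq_dd)
qed

text \<open>The box spans the full height of the strip and leaves a margin around K on the lateral
  sides. A test function supported in K, being supported away from the walls too, therefore vanishes
  on all six faces.\<close>

lemma compact_strip_in_cbox:
  assumes "compact K" "K \<subseteq> strip"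
  obtains a b :: "real^3" where "K \<subseteq> cbox a b" "cbox a b \<subseteq> strip" "\<And>i. a $ i < b $ i" "a $ 3 = 0" "b $ 3 = 1"
    "\<And>x i. x \<in> K \<Longrightarrow> i \<noteq> 3 \<Longrightarrow> a $ i < x $ i \<and> x $ i < b $ i"
proof -
  obtain B where B: "0 < B" "\<And>x. x \<in> K \<Longrightarrow> norm x \<le> B"
    using compact_imp_bounded[OF assms(1)] by (auto simp: bounded_pos)
  define a :: "real^3" where "a = (\<chi> i. if i = 3 then 0 else - B - 1)"
  define b :: "real^3" where "b = (\<chi> i. if i = 3 then 1 else B + 1)"
  have c: "\<bar>x $ i\<bar> \<le> B" if "x \<in> K" for x i
    using B(2)[OF that] component_le_norm_cart[of x i] by linarith
  have ai: "a $ i < x $ i \<and> x $ i < b $ i" if "x \<in> K" "i \<noteq> 3" for x i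
    using c[OF that(1), of i] that(2) by (simp add: a_def b_def abs_le_iff)
  show ?thesis
  proof
    show "K \<subseteq> cbox a b"
    proof
      fix x assume x: "x \<in> K"
      have "a $ i \<le> x $ i \<and> x $ i \<le> b $ i" for i
        using ai[OF x, of i] x assms(2) by (cases "i = 3") (auto simp: strip_def a_def b_def)
      then show "x \<in> cbox a b" by (simp add: mem_box_cart)
    qed
    show "cbox a b \<subseteq> strip"
    proof
      fix x assume "x \<in> cbox a b"
      then have "a $ 3 \<le> x $ 3 \<and> x $ 3 \<le> b $ 3" unfolding mem_box_cart by blast
      then show "x \<in> strip" by (simp add: strip_def a_def b_def)
    qed
  qed (use B ai in \<open>auto simp: a_def b_def\<close>)
qed

lemma set_integrable_continuous_strip:
  fixes f :: "real^3 \<Rightarrow> real"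
  assumes f: "continuous_on strip f" and K: "compact K" "K \<subseteq> strip"
  shows "set_integrable lebesgue K f"
proof -
  obtain a b where ab: "K \<subseteq> cbox a b" "cbox a b \<subseteq> strip"
    using compact_strip_in_cbox[OF K] by metis
  have "f absolutely_integrable_on cbox a b"
    by (rule absolutely_integrable_continuous[OF continuous_on_subset[OF f ab(2)]])
  then show ?thesis
    by (rule set_integrable_subset) (use ab K in \<open>auto simp: compact_imp_closed\<close>)
qed

lemma locally_integrable_continuous: "continuous_on strip f \<Longrightarrow> locally_integrable f"
  unfolding locally_integrable_def
  using set_integrable_continuous_strip interior_subset by blast

lemma integrable_times_compact_support:
  assumes g: "locally_integrable g" and K: "compact K" "K \<subseteq> interior strip"
    and w: "continuous_on strip w" and zero: "\<And>x. x \<in> strip \<Longrightarrow> x \<notin> K \<Longrightarrow> w x = 0"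
  shows "set_integrable lebesgue strip (\<lambda>x. g x * w x)"
proof -
  have K2: "K \<subseteq> strip" using K interior_subset by blast
  have "compact (w ` K)" using compact_continuous_image[OF continuous_on_subset[OF w K2] K(1)] .
  then obtain C where C: "\<And>x. x \<in> K \<Longrightarrow> \<bar>w x\<bar> \<le> C"
    using compact_imp_bounded bounded_iff by (metis image_eqI real_norm_def)
  have gi: "integrable lebesgue (\<lambda>x. indicator K x *\<^sub>R g x)"
    using g K by (auto simp: locally_integrable_def set_integrable_def)
  have wm: "(\<lambda>x. indicator strip x *\<^sub>R w x) \<in> borel_measurable lebesgue"
  proof -
    have "(\<lambda>x. indicator strip x *\<^sub>R w x) \<in> borel_measurable borel"
      by (rule borel_measurable_continuous_on_indicator[OF borel_closed[OF closed_strip] w])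
    then show ?thesis by (intro measurable_completion) simp
  qed
  have eq: "indicator strip x *\<^sub>R (g x * w x) = (indicator K x *\<^sub>R g x) * (indicator strip x *\<^sub>R w x)" for x
    using zero[of x] K2 by (auto simp: indicator_def)
  have "integrable lebesgue (\<lambda>x. (indicator K x *\<^sub>R g x) * (indicator strip x *\<^sub>R w x))"
  proof (rule Bochner_Integration.integrable_bound)
    show "integrable lebesgue (\<lambda>x. C * (indicator K x *\<^sub>R g x))" using gi by (rule integrable_mult_right)
    show "(\<lambda>x. (indicator K x *\<^sub>R g x) * (indicator strip x *\<^sub>R w x)) \<in> borel_measurable lebesgue"
      by (intro borel_measurable_times borel_measurable_integrable[OF gi] wm)
    show "AE x in lebesgue. norm ((indicator K x *\<^sub>R g x) * (indicator strip x *\<^sub>R w x)) \<le>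
        norm (C * (indicator K x *\<^sub>R g x))"
    proof (intro always_eventually allI)
      fix x
      show "norm ((indicator K x *\<^sub>R g x) * (indicator strip x *\<^sub>R w x)) \<le> norm (C * (indicator K x *\<^sub>R g x))"
      proof (cases "x \<in> K")
        case True
        then have "\<bar>g x\<bar> * \<bar>w x\<bar> \<le> \<bar>g x\<bar> * \<bar>C\<bar>" using C[OF True] by (intro mult_left_mono) auto
        then show ?thesis using True K2 by (auto simp: abs_mult mult.commute)
      qed simp
    qed
  qed
  then show ?thesis by (simp only: set_integrable_def eq)
qed

lemma test_funD:
  fixes \<phi> defines "K \<equiv> closure {x. \<phi> x \<noteq> 0}"
  assumes "test_fun \<phi>"
  shows "compact K" "K \<subseteq> interior strip" "smooth_on strip \<phi>" "x \<notin> K \<Longrightarrow> \<phi> x = 0"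
    "x \<in> strip \<Longrightarrow> x \<notin> K \<Longrightarrow> pd i \<phi> x = 0"
proof -
  show K: "compact K" "K \<subseteq> interior strip" and "smooth_on strip \<phi>"
    using assms(2) smooth_on_subset[of UNIV \<phi> strip] by (auto simp: test_fun_def K_def)
  have z: "\<phi> y = 0" if "y \<notin> K" for y
    using that closure_subset[of "{x. \<phi> x \<noteq> 0}"] by (auto simp: K_def)
  show "\<phi> x = 0" if "x \<notin> K" using z[OF that] .
  show "pd i \<phi> x = 0" if "x \<in> strip" "x \<notin> K"
  proof (rule pd_zero_outside_closed[where K = K])
    show "closed K" by (simp add: K_def)
  qed (use z that in auto)
qed

text \<open>Integration by parts on a box containing the support of the test function, on whose
  faces the test function is 0.\<close>

lemma is_weak_pd_smooth:
  assumes f: "smooth_on strip f"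
  shows "is_weak_pd i f (pd i f)"
  unfolding is_weak_pd_def
proof (intro conjI allI impI)
  show "locally_integrable f" "locally_integrable (pd i f)"
    by (intro locally_integrable_continuous smooth_on_continuous smooth_intros f)+
  fix \<phi> assume t: "test_fun \<phi>"
  define K where "K = closure {x. \<phi> x \<noteq> 0}"
  note K = test_funD(1,2)[OF t, folded K_def] and \<phi> = test_funD(3)[OF t]
    and z = test_funD(4,5)[OF t, folded K_def]
  have K2: "K \<subseteq> strip" using K interior_subset by blast
  obtain a b where ab: "K \<subseteq> cbox a b" "cbox a b \<subseteq> strip" "\<And>i. a $ i < b $ i" "a $ 3 = 0" "b $ 3 = 1"
    "\<And>x i. x \<in> K \<Longrightarrow> i \<noteq> 3 \<Longrightarrow> a $ i < x $ i \<and> x $ i < b $ i"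
    using compact_strip_in_cbox[OF K(1) K2] by metis
  have lint: "(LINT x:strip|lebesgue. h x) = integral (cbox a b) h"
    if h: "continuous_on strip h" "\<And>x. x \<in> strip \<Longrightarrow> x \<notin> K \<Longrightarrow> h x = 0" for h :: "real^3 \<Rightarrow> real"
  proof -
    have "indicator strip x *\<^sub>R h x = indicator (cbox a b) x *\<^sub>R h x" for x
      using h(2)[of x] ab by (auto simp: indicator_def)
    then have "(LINT x:strip|lebesgue. h x) = (LINT x:cbox a b|lebesgue. h x)"
      unfolding set_lebesgue_integral_def by (simp only:)
    also have "\<dots> = integral (cbox a b) h"
      by (rule set_lebesgue_integral_eq_integral(2))
        (rule absolutely_integrable_continuous[OF continuous_on_subset[OF h(1) ab(2)]])
    finally show ?thesis .
  qed
  have face: "\<phi> x = 0" if "x \<in> cbox a b" "x $ i = a $ i \<or> x $ i = b $ i" for x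
  proof (rule z, rule notI)
    assume x: "x \<in> K"
    have "0 < x $ 3 \<and> x $ 3 < 1" using x K(2) interior_strip by auto
    show False
    proof (cases "i = 3")
      case True
      then have "x $ 3 = 0 \<or> x $ 3 = 1" using that(2) ab(4,5) by simp
      then show ?thesis using \<open>0 < x $ 3 \<and> x $ 3 < 1\<close> by auto
    next
      case False
      then show ?thesis using that(2) ab(6)[OF x False] by auto
    qed
  qed
  have c: "continuous_on strip (\<lambda>x. f x * pd i \<phi> x)" "continuous_on strip (\<lambda>x. pd i f x * \<phi> x)"
    by (intro smooth_on_continuous smooth_intros f \<phi>)+
  note c' = c[THEN continuous_on_subset, OF ab(2)]
  have "integral (cbox a b) (pd i (\<lambda>x. f x * \<phi> x)) = 0"
  proof (rule integral_pd_zero)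
    show "smooth_on strip (\<lambda>x. f x * \<phi> x)" by (intro smooth_intros f \<phi>)
    fix x assume x: "x \<in> cbox a b" "x $ i = a $ i"
    have "x + (b $ i - a $ i) *\<^sub>R axis i 1 \<in> cbox a b" "(x + (b $ i - a $ i) *\<^sub>R axis i 1) $ i = b $ i"
      using x less_imp_le[OF ab(3)[of i]] by (auto simp: mem_box_cart axis_def)
    then show "f (x + (b $ i - a $ i) *\<^sub>R axis i 1) * \<phi> (x + (b $ i - a $ i) *\<^sub>R axis i 1) = f x * \<phi> x"
      using face x by simp
  qed (use ab less_imp_le[OF ab(3)] in auto)
  moreover have "integral (cbox a b) (pd i (\<lambda>x. f x * \<phi> x)) =
      integral (cbox a b) (\<lambda>x. f x * pd i \<phi> x + pd i f x * \<phi> x)"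
    by (rule integral_cong) (use ab(2) pd_mult[OF f \<phi>] in auto)
  moreover have "\<dots> = integral (cbox a b) (\<lambda>x. f x * pd i \<phi> x) + integral (cbox a b) (\<lambda>x. pd i f x * \<phi> x)"
    by (intro integral_add integrable_continuous c')
  ultimately show "(LINT x:strip|lebesgue. f x * pd i \<phi> x) = - (LINT x:strip|lebesgue. pd i f x * \<phi> x)"
    using lint[OF c(1)] lint[OF c(2)] z by simp
qed

text \<open>Localised to \<Omega>, because agreement of two functions may be known only in one
  period cell while their weak derivatives are taken in the whole strip. It suffices to test with
  functions supported in \<Omega>.\<close>

lemma weak_pd_unique:
  assumes g: "is_weak_pd i f g" and g': "is_weak_pd i f' g'"
    and \<Omega>: "open \<Omega>" "\<Omega> \<subseteq> interior strip" and eq: "AE x in lebesgue. x \<in> \<Omega> \<longrightarrow> f x = f' x"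
  shows "AE x in lebesgue. x \<in> \<Omega> \<longrightarrow> g x = g' x"
proof -
  have li: "locally_integrable f" "locally_integrable g" "locally_integrable f'" "locally_integrable g'"
    using g g' by (auto simp: is_weak_pd_def)
  have "locally_integrable (\<lambda>x. g x - g' x)"
    using li by (auto simp: locally_integrable_def intro: set_integral_diff)
  then have "AE x in lebesgue. x \<in> \<Omega> \<longrightarrow> g x - g' x = 0"
  proof (rule ae_zero_test[OF _ \<Omega>])
    fix \<phi> assume t: "test_fun \<phi>" and supp: "closure {x. \<phi> x \<noteq> 0} \<subseteq> \<Omega>"
    define K where Ke: "K = closure {x. \<phi> x \<noteq> 0}"
    note K = test_funD(1,2)[OF t, folded Ke] and \<phi> = test_funD(3)[OF t]
      and z = test_funD(4,5)[OF t, folded Ke]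
    have i: "set_integrable lebesgue strip (\<lambda>x. h x * \<phi> x)" if "locally_integrable h" for h
      by (rule integrable_times_compact_support[OF that K smooth_on_continuous[OF \<phi>]]) (use z in auto)
    have i': "set_integrable lebesgue strip (\<lambda>x. h x * pd i \<phi> x)" if "locally_integrable h" for h
      by (rule integrable_times_compact_support[OF that K smooth_on_continuous[OF smooth_on_pd[OF \<phi>]]]) (use z in auto)
    have "(LINT x:strip|lebesgue. f x * pd i \<phi> x) = (LINT x:strip|lebesgue. f' x * pd i \<phi> x)"
      unfolding set_lebesgue_integral_def
    proof (rule integral_cong_AE)
      show "AE x in lebesgue. indicator strip x *\<^sub>R (f x * pd i \<phi> x) = indicator strip x *\<^sub>R (f' x * pd i \<phi> x)"
        using eq
      proof eventually_elim
        case (elim x)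
        then show ?case
          using z(2)[of x i] supp Ke by (cases "x \<in> strip"; cases "x \<in> K") auto
      qed
    qed (use i'[OF li(1)] i'[OF li(3)] in \<open>auto simp: set_integrable_def\<close>)
    then have "(LINT x:strip|lebesgue. g x * \<phi> x) = (LINT x:strip|lebesgue. g' x * \<phi> x)"
      using g g' t by (simp add: is_weak_pd_def)
    moreover have "(LINT x:strip|lebesgue. (g x - g' x) * \<phi> x) =
        (LINT x:strip|lebesgue. g x * \<phi> x) - (LINT x:strip|lebesgue. g' x * \<phi> x)"
      unfolding left_diff_distrib by (rule set_integral_diff(2)[OF i[OF li(2)] i[OF li(4)]])
    ultimately show "(LINT x:strip|lebesgue. (g x - g' x) * \<phi> x) = 0" by simp
  qed
  then show ?thesis by simp
qed

lemma is_weak_pd_ae: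
  assumes g: "locally_integrable g" and f: "smooth_on strip f"
    and eq: "AE x in lebesgue. x \<in> interior strip \<longrightarrow> g x = f x"
  shows "is_weak_pd i g (pd i f)"
  unfolding is_weak_pd_def
proof (intro conjI allI impI g)
  have w: "is_weak_pd i f (pd i f)" by (rule is_weak_pd_smooth[OF f])
  then have li: "locally_integrable f" by (simp add: is_weak_pd_def)
  show "locally_integrable (pd i f)" using w by (simp add: is_weak_pd_def)
  fix \<phi> assume t: "test_fun \<phi>"
  define K where "K = closure {x. \<phi> x \<noteq> 0}"
  note K = test_funD(1,2)[OF t, folded K_def] and \<phi> = test_funD(3)[OF t]
    and z = test_funD(4,5)[OF t, folded K_def]
  have i': "set_integrable lebesgue strip (\<lambda>x. h x * pd i \<phi> x)" if "locally_integrable h" for h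
    by (rule integrable_times_compact_support[OF that K smooth_on_continuous[OF smooth_on_pd[OF \<phi>]]]) (use z in auto)
  have "(LINT x:strip|lebesgue. g x * pd i \<phi> x) = (LINT x:strip|lebesgue. f x * pd i \<phi> x)"
    unfolding set_lebesgue_integral_def
  proof (rule integral_cong_AE)
    show "AE x in lebesgue. indicator strip x *\<^sub>R (g x * pd i \<phi> x) = indicator strip x *\<^sub>R (f x * pd i \<phi> x)"
      using eq
    proof eventually_elim
      case (elim x)
      then show ?case
        using z(2)[of x i] K by (cases "x \<in> strip"; cases "x \<in> K") auto
    qed
  qed (use i'[OF li] i'[OF g] in \<open>auto simp: set_integrable_def\<close>)
  then show "(LINT x:strip|lebesgue. g x * pd i \<phi> x) = - (LINT x:strip|lebesgue. pd i f x * \<phi> x)"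
    using w t by (simp add: is_weak_pd_def)
qed

text \<open>Stated for g that is smooth only up to a null set, so that it can be iterated: already
  the first \<open>wpd\<close> is a choice, equal to the classical derivative only almost
  everywhere.\<close>

lemma wpd_ae:
  assumes g: "locally_integrable g" and f: "smooth_on strip f"
    and eq: "AE x in lebesgue. x \<in> interior strip \<longrightarrow> g x = f x"
  shows "locally_integrable (wpd i g)" "AE x in lebesgue. x \<in> interior strip \<longrightarrow> wpd i g x = pd i f x"
proof -
  have "is_weak_pd i g (pd i f)" by (rule is_weak_pd_ae[OF assms])
  then have w: "is_weak_pd i g (wpd i g)" unfolding wpd_def by (rule someI[of "is_weak_pd i g"])
  then show "locally_integrable (wpd i g)" by (simp add: is_weak_pd_def)
  show "AE x in lebesgue. x \<in> interior strip \<longrightarrow> wpd i g x = pd i f x"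
    by (rule weak_pd_unique[OF w is_weak_pd_smooth[OF f] open_interior order_refl eq])
qed

lemma wpd_pd_ae:
  assumes f: "smooth_on strip f"
  shows "AE x in lebesgue. x \<in> interior strip \<longrightarrow> wpd i f x = pd i f x"
    and "AE x in lebesgue. x \<in> interior strip \<longrightarrow> wpd i (wpd j f) x = pd i (pd j f) x"
    and "AE x in lebesgue. x \<in> interior strip \<longrightarrow> wpd i (wlaplacian f) x = pd i (laplacian f) x"
    and "AE x in lebesgue. x \<in> interior strip \<longrightarrow> wlaplacian f x = laplacian f x"
proof -
  have li: "locally_integrable f" using is_weak_pd_smooth[OF f] by (simp add: is_weak_pd_def)
  have 1: "locally_integrable (wpd i f)" "AE x in lebesgue. x \<in> interior strip \<longrightarrow> wpd i f x = pd i f x" for i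
    using wpd_ae[OF li f] by auto
  have 2: "locally_integrable (wpd i (wpd j f))"
    "AE x in lebesgue. x \<in> interior strip \<longrightarrow> wpd i (wpd j f) x = pd i (pd j f) x" for i j
    using wpd_ae[OF 1(1) smooth_on_pd[OF f] 1(2)] by auto
  show "AE x in lebesgue. x \<in> interior strip \<longrightarrow> wpd i f x = pd i f x"
    "AE x in lebesgue. x \<in> interior strip \<longrightarrow> wpd i (wpd j f) x = pd i (pd j f) x"
    by (rule 1 2)+
  have "AE x in lebesgue. \<forall>i\<in>UNIV. x \<in> interior strip \<longrightarrow> wpd i (wpd i f) x = pd i (pd i f) x"
    using 2 by (subst AE_finite_all) auto
  then show 3: "AE x in lebesgue. x \<in> interior strip \<longrightarrow> wlaplacian f x = laplacian f x"
    by eventually_elim (simp add: wlaplacian_def laplacian_def)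
  have "locally_integrable (\<lambda>x. \<Sum>i\<in>UNIV. wpd i (wpd i f) x)"
    unfolding locally_integrable_def set_integrable_def scaleR_sum_right
    using 2(1) by (intro allI impI Bochner_Integration.integrable_sum) (auto simp: locally_integrable_def set_integrable_def)
  then have "locally_integrable (wlaplacian f)" by (simp add: wlaplacian_def[abs_def])
  moreover have "smooth_on strip (laplacian f)"
    unfolding laplacian_def[abs_def] by (intro smooth_intros f)
  ultimately show "AE x in lebesgue. x \<in> interior strip \<longrightarrow> wpd i (wlaplacian f) x = pd i (laplacian f) x"
    using wpd_ae(2) 3 by blast
qed

lemma AE_box_imp_AE_cell:
  assumes "AE x in lebesgue. x \<in> box a b \<longrightarrow> P x"
  shows "AE x in lebesgue_on (cbox a b). P (x :: real^3)"
proof -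
  have "negligible (cbox a b - box a b)" by (rule negligible_frontier_interval)
  then have "AE x in lebesgue. x \<notin> cbox a b - box a b"
    using negligible_iff_null_sets AE_not_in by blast
  with assms have "AE x in lebesgue. x \<in> cbox a b \<longrightarrow> P x" by eventually_elim auto
  then show ?thesis by (subst AE_restrict_space_iff) auto
qed

lemma Lp_norm_cong_AE:
  "AE x in lebesgue_on V. norm (f x) = norm (g x) \<Longrightarrow> Lp_norm p V f = Lp_norm p V g"
  unfolding Lp_norm_def
  by (intro arg_cong2[where f = enn_powr] nn_integral_cong_AE refl) (auto elim: eventually_mono)

lemma box_subset_interior_strip: "box (0::real^3) (vector [Lx, Ly, 1]) \<subseteq> interior strip"
proof
  fix x assume "x \<in> box (0::real^3) (vector [Lx, Ly, 1])"
  then have "(0::real^3) $ 3 < x $ 3 \<and> x $ 3 < (vector [Lx, Ly, 1] :: real^3) $ 3"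
    unfolding mem_box_cart by blast
  then show "x \<in> interior strip" by (simp add: interior_strip)
qed

lemma cell_ae_interior:
  assumes "AE x in lebesgue. x \<in> interior strip \<longrightarrow> P x"
  shows "AE x in lebesgue_on (cell Lx Ly). P x"
  unfolding cell_def
  by (rule AE_box_imp_AE_cell) (use assms box_subset_interior_strip in \<open>auto elim!: eventually_mono\<close>)

text \<open>Translates the weak quantities in \<open>sobolev_elliptic_consts\<close> into classical
  ones, so that the constants can be applied to the smooth temperature.\<close>

lemma Sobolev_quantities_smooth:
  assumes f: "smooth_on strip f"
  shows "AE x in lebesgue_on (cell Lx Ly). wgrad f x = grad f x"
    and "Lp_norm 6 (cell Lx Ly) (whessian f) = Lp_norm 6 (cell Lx Ly) (\<lambda>x. (\<chi> i j. pd i (pd j f) x) :: real^3^3)"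
    and "Lp_norm 2 (cell Lx Ly) (wlaplacian f) = Lp_norm 2 (cell Lx Ly) (laplacian f)"
    and "Lp_norm 2 (cell Lx Ly) (wgrad (wlaplacian f)) = Lp_norm 2 (cell Lx Ly) (grad (laplacian f))"
proof -
  note ae = wpd_pd_ae[OF f, THEN cell_ae_interior[where Lx = Lx and Ly = Ly]]
  have "AE x in lebesgue_on (cell Lx Ly). \<forall>i\<in>UNIV. wpd i f x = pd i f x"
    using ae(1) by (subst AE_finite_all) auto
  then show "AE x in lebesgue_on (cell Lx Ly). wgrad f x = grad f x"
    by eventually_elim (simp add: wgrad_def grad_def)
  have "AE x in lebesgue_on (cell Lx Ly). \<forall>i\<in>UNIV. \<forall>j\<in>UNIV. wpd i (wpd j f) x = pd i (pd j f) x"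
    using ae(2) by (subst AE_finite_all; (subst AE_finite_all)?) auto
  then show "Lp_norm 6 (cell Lx Ly) (whessian f) = Lp_norm 6 (cell Lx Ly) (\<lambda>x. (\<chi> i j. pd i (pd j f) x) :: real^3^3)"
    by (intro Lp_norm_cong_AE) (auto elim!: eventually_mono simp: whessian_def)
  show "Lp_norm 2 (cell Lx Ly) (wlaplacian f) = Lp_norm 2 (cell Lx Ly) (laplacian f)"
    using ae(4) by (intro Lp_norm_cong_AE) (auto elim!: eventually_mono)
  have "AE x in lebesgue_on (cell Lx Ly). \<forall>i\<in>UNIV. wpd i (wlaplacian f) x = pd i (laplacian f) x"
    using ae(3) by (subst AE_finite_all) auto
  then show "Lp_norm 2 (cell Lx Ly) (wgrad (wlaplacian f)) = Lp_norm 2 (cell Lx Ly) (grad (laplacian f))"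
    by (intro Lp_norm_cong_AE) (auto elim!: eventually_mono simp: wgrad_def grad_def)
qed

text \<open>Makes the norms of \<open>Q\<close> in \<open>R3\<close> computable from a smooth
  representative, although the equation identifies \<open>Q\<close> with it only almost everywhere
  in the cell. The open cell is the region to which weak uniqueness is applied.\<close>

lemma wgrad_of_ae_smooth_on_cell:
  assumes Q: "H_per 1 Lx Ly Q" and q: "smooth_on strip q"
    and eq: "AE x in lebesgue_on (cell Lx Ly). Q x = q x"
  shows "Lp_norm 2 (cell Lx Ly) (wgrad Q) = Lp_norm 2 (cell Lx Ly) (grad q)"
    "Lp_norm 2 (cell Lx Ly) Q = Lp_norm 2 (cell Lx Ly) q"
proof -
  let ?B = "box (0::real^3) (vector [Lx, Ly, 1])"
  have "AE x in lebesgue. x \<in> cell Lx Ly \<longrightarrow> Q x = q x"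
    using eq by (subst (asm) AE_restrict_space_iff) (auto simp: cell_def)
  then have ae: "AE x in lebesgue. x \<in> ?B \<longrightarrow> Q x = q x"
    by eventually_elim (use box_subset_cbox in \<open>auto simp: cell_def\<close>)
  have w: "is_weak_pd i Q (wpd i Q)" for i
  proof -
    have "\<exists>g. is_weak_pd i Q g" using Q unfolding One_nat_def H_per.simps by blast
    then show ?thesis unfolding wpd_def by (rule someI_ex)
  qed
  have "AE x in lebesgue. x \<in> ?B \<longrightarrow> wpd i Q x = pd i q x" for i
    by (rule weak_pd_unique[OF w is_weak_pd_smooth[OF q] open_box box_subset_interior_strip ae])
  then have "AE x in lebesgue_on (cell Lx Ly). wpd i Q x = pd i q x" for i
    unfolding cell_def by (rule AE_box_imp_AE_cell)
  then have "AE x in lebesgue_on (cell Lx Ly). \<forall>i\<in>UNIV. wpd i Q x = pd i q x"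
    by (subst AE_finite_all) auto
  then show "Lp_norm 2 (cell Lx Ly) (wgrad Q) = Lp_norm 2 (cell Lx Ly) (grad q)"
    by (intro Lp_norm_cong_AE) (auto elim!: eventually_mono simp: wgrad_def grad_def)
  show "Lp_norm 2 (cell Lx Ly) Q = Lp_norm 2 (cell Lx Ly) q"
    using eq by (intro Lp_norm_cong_AE) (auto elim!: eventually_mono)
qed

lemma periodic_pd:
  assumes p: "periodic_xy Lx Ly f" and f: "smooth_on strip f"
  shows "periodic_xy Lx Ly (pd i f)"
proof -
  have shift: "pd i f (x + v) = pd i f x"
    if "x \<in> strip" and v: "\<And>x. x \<in> strip \<Longrightarrow> x + v \<in> strip" "\<And>x. x \<in> strip \<Longrightarrow> f (x + v) = f x" for x v
  proof -
    have "pd i f x = pd i (\<lambda>x. f (v + x)) x"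
      by (rule pd_cong) (use that in \<open>auto simp: add.commute\<close>)
    also have "\<dots> = pd i f (v + x)"
      unfolding pd_eq_dd using dd_affine[OF fat_strip \<open>x \<in> strip\<close> fat_strip f bounded_linear_ident, of v] v
      by (auto simp: add.commute)
    finally show ?thesis by (simp add: add.commute)
  qed
  have st: "x + axis 1 Lx \<in> strip" "x + axis 2 Ly \<in> strip" if "x \<in> strip" for x
    using that by (auto simp: strip_def axis_def)
  show ?thesis
    unfolding periodic_xy_def
  proof (intro ballI conjI)
    fix x :: "real^3" assume x: "x \<in> strip"
    show "pd i f (x + axis 1 Lx) = pd i f x"
      by (rule shift[OF x st(1)]) (use p in \<open>auto simp: periodic_xy_def\<close>)
    show "pd i f (x + axis 2 Ly) = pd i f x"
      by (rule shift[OF x st(2)]) (use p in \<open>auto simp: periodic_xy_def\<close>)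
  qed
qed

lemma cell_subset_strip: "cell Lx Ly \<subseteq> strip"
proof
  fix x assume "x \<in> cell Lx Ly"
  then have "(0::real^3) $ 3 \<le> x $ 3 \<and> x $ 3 \<le> (vector [Lx, Ly, 1] :: real^3) $ 3"
    unfolding mem_box_cart cell_def by blast
  then show "x \<in> strip" by (simp add: strip_def)
qed

lemma H_per_smooth:
  "smooth_on strip f \<Longrightarrow> periodic_xy Lx Ly f \<Longrightarrow> H_per k Lx Ly f"
proof (induction k arbitrary: f)
  have L2: "L2_per Lx Ly f" if f: "smooth_on strip f" "periodic_xy Lx Ly f" for f
  proof -
    have "f \<in> borel_measurable (lebesgue_on strip)"
      by (rule continuous_imp_measurable_on_sets_lebesgue[OF smooth_on_continuous[OF f(1)]])
        (simp add: closed_strip)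
    moreover have "Lp_norm 2 (cell Lx Ly) f < \<infinity>"
      unfolding cell_def
      by (subst Lp_norm_continuous)
        (use continuous_on_subset[OF smooth_on_continuous[OF f(1)] cell_subset_strip] in \<open>auto simp: cell_def\<close>)
    ultimately show ?thesis using f by (simp add: L2_per_def)
  qed
  {
    case 0
    then show ?case using L2 by simp
  next
    case (Suc k)
    then show ?case
      unfolding H_per.simps
    proof (intro conjI allI L2)
      fix i
      show "\<exists>g. is_weak_pd i f g \<and> H_per k Lx Ly g"
        by (intro exI[of _ "pd i f"] conjI is_weak_pd_smooth Suc.IH smooth_on_pd periodic_pd Suc.prems)
    qed
  }
qed

section \<open>Integral identities and inequalities on the period cell\<close>

lemma root_eq_powr: "0 \<le> x \<Longrightarrow> 0 < n \<Longrightarrow> root n x = x powr (1 / real n)"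
  by (cases "x = 0") (auto simp: root_powr_inverse)

lemma Lp_norm_root:
  fixes f :: "real^3 \<Rightarrow> 'b::real_normed_vector"
  assumes f: "continuous_on (cbox a b) f" and n: "0 < n"
  shows "Lp_norm (real n) (cbox a b) f = ennreal (root n (integral (cbox a b) (\<lambda>x. norm (f x) ^ n)))"
proof -
  have p: "norm (f x) powr real n = norm (f x) ^ n" for x
    using n by (simp add: powr_realpow')
  have "continuous_on (cbox a b) (\<lambda>x. norm (f x) ^ n)" by (intro continuous_intros f)
  then have "0 \<le> integral (cbox a b) (\<lambda>x. norm (f x) ^ n)"
    by (intro integral_nonneg integrable_continuous) auto
  then show ?thesis
    using Lp_norm_continuous[OF f, of "real n"] n by (simp add: p root_eq_powr)
qed

lemma smooth_on_laplacian [smooth_intros]: "smooth_on strip f \<Longrightarrow> smooth_on strip (laplacian f)"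
  unfolding laplacian_def[abs_def] by (intro smooth_intros)

locale period_cell =
  fixes Lx Ly :: real
  assumes Lx: "0 < Lx" and Ly: "0 < Ly"
begin

definition J :: "(real^3 \<Rightarrow> real) \<Rightarrow> real" where "J f = integral (cell Lx Ly) f"

lemma cont_cell: "smooth_on strip f \<Longrightarrow> continuous_on (cell Lx Ly) f"
  using smooth_on_continuous continuous_on_subset cell_subset_strip by blast

lemma cell_corner [simp]:
  "(vector [Lx, Ly, 1] :: real^3) $ 1 = Lx" "(vector [Lx, Ly, 1] :: real^3) $ 2 = Ly"
  "(vector [Lx, Ly, 1] :: real^3) $ 3 = 1"
  by simp_all

lemma cell_strip: "x \<in> cell Lx Ly \<Longrightarrow> x \<in> strip"
  using cell_subset_strip by blast

lemma mem_cell: "x \<in> cell Lx Ly \<longleftrightarrow> 0 \<le> x $ 1 \<and> x $ 1 \<le> Lx \<and> 0 \<le> x $ 2 \<and> x $ 2 \<le> Ly \<and> 0 \<le> x $ 3 \<and> x $ 3 \<le> 1"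
  by (auto simp: cell_def mem_box_cart forall_3)

lemma J_integrable: "continuous_on (cell Lx Ly) f \<Longrightarrow> f integrable_on cell Lx Ly" for f :: "real^3 \<Rightarrow> real"
  by (simp add: cell_def integrable_continuous)

lemma J_mono:
  assumes "continuous_on (cell Lx Ly) f" "continuous_on (cell Lx Ly) g"
    "\<And>x. x \<in> cell Lx Ly \<Longrightarrow> f x \<le> g x"
  shows "J f \<le> J g"
  unfolding J_def by (intro integral_le J_integrable assms)

lemma J_nonneg: "(\<And>x. x \<in> cell Lx Ly \<Longrightarrow> 0 \<le> f x) \<Longrightarrow> continuous_on (cell Lx Ly) f \<Longrightarrow> 0 \<le> J f"
  unfolding J_def by (intro integral_nonneg J_integrable)

lemma J_add: "continuous_on (cell Lx Ly) f \<Longrightarrow> continuous_on (cell Lx Ly) g \<Longrightarrow> J (\<lambda>x. f x + g x) = J f + J g"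
  unfolding J_def by (intro integral_add J_integrable)

lemma J_diff: "continuous_on (cell Lx Ly) f \<Longrightarrow> continuous_on (cell Lx Ly) g \<Longrightarrow> J (\<lambda>x. f x - g x) = J f - J g"
  unfolding J_def by (intro integral_diff J_integrable)

lemma J_sum: "(\<And>i. i \<in> I \<Longrightarrow> continuous_on (cell Lx Ly) (f i)) \<Longrightarrow> finite I \<Longrightarrow> J (\<lambda>x. \<Sum>i\<in>I. f i x) = (\<Sum>i\<in>I. J (f i))"
  unfolding J_def by (intro integral_sum J_integrable)

lemma J_cmult: "J (\<lambda>x. c * f x) = c * J f"
  unfolding J_def by (rule integral_mult_right)

lemma J_cong: "(\<And>x. x \<in> cell Lx Ly \<Longrightarrow> f x = g x) \<Longrightarrow> J f = J g"
  unfolding J_def by (rule integral_cong)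

lemma J_Cauchy_Schwarz:
  assumes "continuous_on (cell Lx Ly) f" "continuous_on (cell Lx Ly) g"
  shows "\<bar>J (\<lambda>x. f x * g x)\<bar> \<le> sqrt (J (\<lambda>x. (f x)\<^sup>2)) * sqrt (J (\<lambda>x. (g x)\<^sup>2))"
  using assms unfolding J_def cell_def by (rule integral_Cauchy_Schwarz)

lemma J_pd_zero:
  assumes f: "smooth_on strip f" and p: "periodic_xy Lx Ly f"
    and w: "i = 3 \<Longrightarrow> \<forall>x\<in>walls. f x = 0"
  shows "J (pd i f) = 0"
  unfolding J_def cell_def
proof (rule integral_pd_zero[OF f])
  show "cbox 0 (vector [Lx, Ly, 1]) \<subseteq> strip" using cell_subset_strip by (simp add: cell_def)
  have i: "i = 1 \<or> i = 2 \<or> i = 3" by (rule exhaust_3)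
  show "(0::real^3) $ i \<le> (vector [Lx, Ly, 1] :: real^3) $ i" using Lx Ly i by auto
  fix x :: "real^3" assume x: "x \<in> cbox 0 (vector [Lx, Ly, 1])" "x $ i = (0::real^3) $ i"
  have xs: "x \<in> strip" using x cell_subset_strip by (auto simp: cell_def)
  have ax: "axis 1 Lx = Lx *\<^sub>R axis 1 (1::real)" "axis 2 Ly = Ly *\<^sub>R axis 2 (1::real)"
    by (auto simp: vec_eq_iff axis_def)
  show "f (x + ((vector [Lx, Ly, 1] :: real^3) $ i - (0::real^3) $ i) *\<^sub>R axis i 1) = f x"
  proof (cases "i = 3")
    case True
    then have "x \<in> walls" "x + 1 *\<^sub>R axis 3 1 \<in> walls" using x by (auto simp: walls_def axis_def)
    then show ?thesis using w[OF True] True by simp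
  next
    case False
    then show ?thesis using p xs i unfolding periodic_xy_def ax by auto
  qed
qed

lemma periodic_mult:
  fixes f g :: "real^3 \<Rightarrow> real"
  shows "periodic_xy Lx Ly f \<Longrightarrow> periodic_xy Lx Ly g \<Longrightarrow> periodic_xy Lx Ly (\<lambda>x. f x * g x)"
  by (simp add: periodic_xy_def)

lemma IBP:
  assumes f: "smooth_on strip f" "periodic_xy Lx Ly f" and g: "smooth_on strip g" "periodic_xy Lx Ly g"
    and w: "i = 3 \<Longrightarrow> \<forall>x\<in>walls. f x * g x = 0"
  shows "J (\<lambda>x. f x * pd i g x) = - J (\<lambda>x. pd i f x * g x)"
proof -
  have "J (pd i (\<lambda>x. f x * g x)) = 0"
    by (rule J_pd_zero) (use f g w periodic_mult in \<open>auto intro: smooth_intros\<close>)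
  moreover have "J (pd i (\<lambda>x. f x * g x)) = J (\<lambda>x. f x * pd i g x + pd i f x * g x)"
    by (rule J_cong) (rule pd_mult[OF f(1) g(1) cell_strip])
  moreover have "\<dots> = J (\<lambda>x. f x * pd i g x) + J (\<lambda>x. pd i f x * g x)"
    by (intro J_add cont_cell smooth_intros f g)
  ultimately show ?thesis by simp
qed

text \<open>The walls are invariant under horizontal translation, so f vanishes along the whole line
  through x.\<close>

lemma pd_zero_walls:
  assumes f: "smooth_on strip f" and w: "\<forall>x\<in>walls. f x = (0::real)" and i: "i \<noteq> 3" and x: "x \<in> walls"
  shows "pd i f x = 0"
proof -
  have st: "x + s *\<^sub>R axis i 1 \<in> strip" for s
    using x i by (auto simp: walls_def strip_def axis_def)
  have "((\<lambda>s. f (x + s *\<^sub>R axis i 1)) has_vector_derivative pd i f (x + 0 *\<^sub>R axis i 1)) (at 0 within UNIV)"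
    by (rule has_vector_derivative_axis[OF f]) (use st in auto)
  moreover have "f (x + s *\<^sub>R axis i 1) = 0" for s
    using w x i by (auto simp: walls_def axis_def)
  ultimately have "((\<lambda>s. 0) has_vector_derivative pd i f x) (at (0::real))" by simp
  then show ?thesis using vector_derivative_unique_at has_vector_derivative_const by metis
qed

text \<open>\<open>Wirtinger\<close> on every vertical line; hence the constant does not depend on
  Lx and Ly.\<close>

lemma Poincare:
  assumes f: "smooth_on strip f" and w: "\<forall>x\<in>walls. f x = 0"
  shows "pi\<^sup>2 * J (\<lambda>x. (f x)\<^sup>2) \<le> J (\<lambda>x. (pd 3 f x)\<^sup>2)"
proof -
  have c: "continuous_on (cell Lx Ly) (\<lambda>x. (pd 3 f x)\<^sup>2 - pi\<^sup>2 * (f x)\<^sup>2)"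
    by (intro cont_cell smooth_intros f)
  have "0 \<le> J (\<lambda>x. (pd 3 f x)\<^sup>2 - pi\<^sup>2 * (f x)\<^sup>2)"
    unfolding J_def cell_def
  proof (rule integral_nonneg_slices[where i = 3])
    fix x :: "real^3" assume x: "x $ 3 = 0"
    have st: "x + r *\<^sub>R axis 3 1 \<in> strip" if "r \<in> {0..1}" for r
      using x that by (auto simp: strip_def axis_def)
    have d: "((\<lambda>s. f (x + s *\<^sub>R axis 3 1)) has_vector_derivative pd 3 f (x + r *\<^sub>R axis 3 1)) (at r within {0..1})"
      if "r \<in> {0..1}" for r by (rule has_vector_derivative_axis[OF f st that])
    have c1: "continuous_on {0..1} (\<lambda>r. g (x + r *\<^sub>R axis 3 1))" if "smooth_on strip g" for g :: "real^3 \<Rightarrow> real"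
      by (rule continuous_on_compose2[OF smooth_on_continuous[OF that]]) (use st in \<open>auto intro!: continuous_intros\<close>)
    have "pi\<^sup>2 * integral {0..1} (\<lambda>r. (f (x + r *\<^sub>R axis 3 1))\<^sup>2) \<le> integral {0..1} (\<lambda>r. (pd 3 f (x + r *\<^sub>R axis 3 1))\<^sup>2)"
      by (rule Wirtinger[OF d c1[OF smooth_on_pd[OF f]]]) (use w x in \<open>auto simp: walls_def axis_def\<close>)
    moreover have "integral {0..1} (\<lambda>r. (pd 3 f (x + r *\<^sub>R axis 3 1))\<^sup>2 - pi\<^sup>2 * (f (x + r *\<^sub>R axis 3 1))\<^sup>2) =
        integral {0..1} (\<lambda>r. (pd 3 f (x + r *\<^sub>R axis 3 1))\<^sup>2) - integral {0..1} (\<lambda>r. pi\<^sup>2 * (f (x + r *\<^sub>R axis 3 1))\<^sup>2)"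
      by (intro integral_diff integrable_continuous_real continuous_intros c1 smooth_intros f)
    ultimately show "0 \<le> integral {(0::real^3) $ 3..(vector [Lx, Ly, 1] :: real^3) $ 3}
        (\<lambda>r. (pd 3 f (x + r *\<^sub>R axis 3 1))\<^sup>2 - pi\<^sup>2 * (f (x + r *\<^sub>R axis 3 1))\<^sup>2)"
      by simp
  qed (use c in \<open>simp add: cell_def\<close>)
  also have "\<dots> = J (\<lambda>x. (pd 3 f x)\<^sup>2) - pi\<^sup>2 * J (\<lambda>x. (f x)\<^sup>2)"
    by (subst J_diff) (auto intro!: cont_cell smooth_intros f simp: J_cmult)
  finally show ?thesis by simp
qed

lemma periodic_laplacian:
  assumes "smooth_on strip f" "periodic_xy Lx Ly f"
  shows "periodic_xy Lx Ly (laplacian f)"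
proof -
  have "periodic_xy Lx Ly (pd i (pd i f))" for i
    by (intro periodic_pd smooth_on_pd assms)
  then show ?thesis by (simp add: periodic_xy_def laplacian_def)
qed

text \<open>The squared L^2 norm of the gradient (see \<open>J_norm_grad\<close>), split into
  components so that integration by parts applies to each.\<close>

definition grad2 :: "(real^3 \<Rightarrow> real) \<Rightarrow> real" where
  "grad2 f = (\<Sum>i\<in>UNIV. J (\<lambda>x. (pd i f x)\<^sup>2))"

lemma grad2_nonneg: "smooth_on strip f \<Longrightarrow> 0 \<le> grad2 f"
  unfolding grad2_def by (intro sum_nonneg J_nonneg cont_cell smooth_intros) auto

lemma Poincare_grad2:
  assumes f: "smooth_on strip f" and w: "\<forall>x\<in>walls. f x = 0"
  shows "pi\<^sup>2 * J (\<lambda>x. (f x)\<^sup>2) \<le> grad2 f"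
proof -
  have "J (\<lambda>x. (pd 3 f x)\<^sup>2) \<le> grad2 f"
    unfolding grad2_def
    by (rule member_le_sum) (auto intro!: J_nonneg cont_cell smooth_intros f)
  then show ?thesis using Poincare[OF f w] by simp
qed

lemma Green_identity:
  assumes f: "smooth_on strip f" "periodic_xy Lx Ly f" and g: "smooth_on strip g" "periodic_xy Lx Ly g"
    and w: "\<forall>x\<in>walls. f x = 0"
  shows "J (\<lambda>x. f x * laplacian g x) = - (\<Sum>i\<in>UNIV. J (\<lambda>x. pd i f x * pd i g x))"
proof -
  have "J (\<lambda>x. f x * laplacian g x) = J (\<lambda>x. \<Sum>i\<in>UNIV. f x * pd i (pd i g) x)"
    by (rule J_cong) (simp add: laplacian_def sum_distrib_left)
  also have "\<dots> = (\<Sum>i\<in>UNIV. J (\<lambda>x. f x * pd i (pd i g) x))"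
    by (intro J_sum cont_cell smooth_intros f g) simp
  also have "\<dots> = (\<Sum>i\<in>UNIV. - J (\<lambda>x. pd i f x * pd i g x))"
    by (intro sum.cong IBP refl periodic_pd smooth_intros f g) (use w in auto)
  finally show ?thesis by (simp add: sum_negf)
qed

lemma grad2_le:
  assumes f: "smooth_on strip f" "periodic_xy Lx Ly f" and w: "\<forall>x\<in>walls. f x = 0"
  shows "grad2 f \<le> sqrt (J (\<lambda>x. (f x)\<^sup>2)) * sqrt (J (\<lambda>x. (laplacian f x)\<^sup>2))"
proof -
  have "grad2 f = - J (\<lambda>x. f x * laplacian f x)"
    unfolding Green_identity[OF f f w] by (simp add: grad2_def power2_eq_square)
  also have "\<dots> \<le> \<bar>J (\<lambda>x. f x * laplacian f x)\<bar>" by simp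
  also have "\<dots> \<le> sqrt (J (\<lambda>x. (f x)\<^sup>2)) * sqrt (J (\<lambda>x. (laplacian f x)\<^sup>2))"
    by (intro J_Cauchy_Schwarz cont_cell smooth_intros f)
  finally show ?thesis .
qed

text \<open>Two integrations by parts exchange one derivative in i for one in j. The first is in
  direction i, which is periodic. The second is in direction j; if j is vertical, its boundary term
  vanishes because the tangential derivative \<open>pd i f\<close> is 0 on the walls.\<close>

lemma mixed_second_derivatives:
  assumes f: "smooth_on strip f" "periodic_xy Lx Ly f" and w: "\<forall>x\<in>walls. f x = 0" and i: "i \<noteq> 3"
  shows "J (\<lambda>x. pd i (pd i f) x * pd j (pd j f) x) = J (\<lambda>x. (pd j (pd i f) x)\<^sup>2)"
proof -
  have 1: "J (\<lambda>x. pd j (pd j f) x * pd i (pd i f) x) = - J (\<lambda>x. pd i (pd j (pd j f)) x * pd i f x)"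
    by (intro IBP periodic_pd smooth_intros f) (use i in auto)
  have 2: "J (\<lambda>x. pd i f x * pd j (pd i (pd j f)) x) = - J (\<lambda>x. pd j (pd i f) x * pd i (pd j f) x)"
    by (intro IBP periodic_pd smooth_intros f) (use i pd_zero_walls[OF f(1) w] in auto)
  have 3: "J (\<lambda>x. pd i (pd j (pd j f)) x * pd i f x) = J (\<lambda>x. pd i f x * pd j (pd i (pd j f)) x)"
    by (rule J_cong) (simp add: pd_pd_commute[OF smooth_on_pd[OF f(1)] cell_strip, of _ i j j] mult.commute)
  have 4: "J (\<lambda>x. pd j (pd i f) x * pd i (pd j f) x) = J (\<lambda>x. (pd j (pd i f) x)\<^sup>2)"
    by (rule J_cong) (simp add: pd_pd_commute[OF f(1) cell_strip, of _ i j] power2_eq_square)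
  have 5: "J (\<lambda>x. pd i (pd i f) x * pd j (pd j f) x) = J (\<lambda>x. pd j (pd j f) x * pd i (pd i f) x)"
    by (rule J_cong) (simp add: mult.commute)
  show ?thesis using 1 2 3 4 5 by simp
qed

text \<open>The square of the Laplacian expands into a 3 by 3 array of integrals. Its first two rows
  sum to the energies of the horizontal derivatives; the entries of the third row are nonnegative
  and are dropped.\<close>

lemma horizontal_Hessian_le:
  assumes f: "smooth_on strip f" "periodic_xy Lx Ly f" and w: "\<forall>x\<in>walls. f x = 0"
  shows "grad2 (pd 1 f) + grad2 (pd 2 f) \<le> J (\<lambda>x. (laplacian f x)\<^sup>2)"
proof -
  let ?h = "\<lambda>i j. J (\<lambda>x. pd i (pd i f) x * pd j (pd j f) x)"
  have "J (\<lambda>x. (laplacian f x)\<^sup>2) = J (\<lambda>x. \<Sum>i\<in>UNIV. \<Sum>j\<in>UNIV. pd i (pd i f) x * pd j (pd j f) x)"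
    by (rule J_cong) (simp add: laplacian_def power2_eq_square sum_product)
  also have "\<dots> = (\<Sum>i\<in>UNIV. J (\<lambda>x. \<Sum>j\<in>UNIV. pd i (pd i f) x * pd j (pd j f) x))"
    by (intro J_sum cont_cell smooth_intros f) simp
  also have "\<dots> = (\<Sum>i\<in>UNIV. \<Sum>j\<in>UNIV. ?h i j)"
    by (intro sum.cong J_sum cont_cell smooth_intros f) simp_all
  finally have *: "J (\<lambda>x. (laplacian f x)\<^sup>2) = (\<Sum>i\<in>UNIV. \<Sum>j\<in>UNIV. ?h i j)" .
  have h: "(\<Sum>j\<in>UNIV. ?h i j) = grad2 (pd i f)" if "i \<noteq> 3" for i
    unfolding grad2_def by (intro sum.cong mixed_second_derivatives f w that refl)
  have "0 \<le> ?h 3 j" for j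
  proof (cases "j = 3")
    case True
    show ?thesis unfolding True by (intro J_nonneg cont_cell smooth_intros f) auto
  next
    case False
    have "?h 3 j = ?h j 3" by (rule J_cong) (simp add: mult.commute)
    also have "\<dots> = J (\<lambda>x. (pd 3 (pd j f) x)\<^sup>2)" by (rule mixed_second_derivatives[OF f w False])
    also have "\<dots> \<ge> 0" by (intro J_nonneg cont_cell smooth_intros f) auto
    finally show ?thesis .
  qed
  then have "0 \<le> (\<Sum>j\<in>UNIV. ?h 3 j)" by (intro sum_nonneg)
  then show ?thesis
    unfolding * using h[of 1] h[of 2] by (simp add: sum_3[of "\<lambda>i. \<Sum>j\<in>UNIV. J (\<lambda>x. pd i (pd i f) x * pd j (pd j f) x)"])
qed

end

section \<open>The vertical primitive \<open>zint\<close>, and the comparison of embedding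
  constants\<close>

lemma dd_strip_expand:
  fixes f :: "real^3 \<Rightarrow> real"
  assumes f: "smooth_on strip f" and x: "x \<in> strip"
  shows "dd strip v f x = (\<Sum>k\<in>UNIV. v $ k * pd k f x)"
proof -
  have L: "linear (\<lambda>v. dd strip v f x)"
    by (rule has_derivative_linear[OF smooth_on_has_derivative[OF fat_strip f x]])
  have "dd strip (\<Sum>k\<in>UNIV. v $ k *\<^sub>R axis k 1) f x = (\<Sum>k\<in>UNIV. dd strip (v $ k *\<^sub>R axis k 1) f x)"
    by (rule linear_sum[OF L])
  also have "\<dots> = (\<Sum>k\<in>UNIV. v $ k * pd k f x)"
    by (simp add: linear_scale[OF L] pd_eq_dd)
  also have "(\<Sum>k\<in>UNIV. v $ k *\<^sub>R axis k 1) = v"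
    by (simp add: vec_eq_iff axis_def if_distrib cong: if_cong)
  finally show ?thesis .
qed

text \<open>
  Rescaling the variable upper limit of \<open>zint\<close> to a fixed one makes the Leibniz rule applicable.
\<close>

definition zscale :: "real \<Rightarrow> real^3 \<Rightarrow> real^3" where
  "zscale s x = (\<chi> k. if k = 3 then s * x $ 3 else x $ k)"

lemma zscale_strip: "s \<in> {0..1} \<Longrightarrow> x \<in> strip \<Longrightarrow> zscale s x \<in> strip"
  by (auto simp: zscale_def strip_def mult_le_one)

lemma bounded_linear_zscale: "bounded_linear (zscale s)"
  unfolding linear_conv_bounded_linear[symmetric]
  by (rule linearI) (auto simp: zscale_def vec_eq_iff algebra_simps)

lemma continuous_on_zscale: "continuous_on A (\<lambda>p. zscale (snd p) (fst p))"
  unfolding zscale_def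
proof (intro continuous_on_vec_lambda)
  show "continuous_on A (\<lambda>p. if k = 3 then snd p * fst p $ 3 else fst p $ k)" for k :: 3
    by (cases "k = 3") (auto intro!: continuous_intros)
qed

lemma zint_scaled:
  fixes f :: "real^3 \<Rightarrow> real"
  assumes f: "continuous_on strip f" and x: "x \<in> strip"
  shows "zint f x = x $ 3 * integral {0..1} (\<lambda>s. f (zscale s x))"
proof (cases "x $ 3 = 0")
  case True
  then show ?thesis by (simp add: zint_def)
next
  case False
  then have pos: "0 < x $ 3" and le: "x $ 3 \<le> 1" using x by (auto simp: strip_def)
  define g where "g s = f (vector [x $ 1, x $ 2, s])" for s
  have v: "vector [x $ 1, x $ 2, s] = (\<chi> k. if k = 3 then s else x $ k)" for s
    by (simp add: vec_eq_iff forall_3)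
  have "continuous_on {0..x $ 3} g"
    unfolding g_def v
  proof (rule continuous_on_compose2[OF f], rule continuous_on_vec_lambda)
    show "continuous_on {0..x $ 3} (\<lambda>s. if k = 3 then s else x $ k)" for k :: 3
      by (cases "k = 3") (auto intro!: continuous_intros)
  qed (use le in \<open>auto simp: strip_def\<close>)
  then have "(g has_integral zint f x) (cbox 0 (x $ 3))"
    unfolding zint_def g_def[symmetric] by (simp add: integrable_integral integrable_continuous_real)
  from has_integral_affinity[OF this False, of 0]
  have "((\<lambda>s. g (x $ 3 * s)) has_integral zint f x / x $ 3) ((\<lambda>s. s / x $ 3) ` {0..x $ 3})"
    using pos by (simp add: divide_inverse mult.commute)
  moreover have "(\<lambda>s. s / x $ 3) ` {0..x $ 3} = {0..1}"
    using pos image_divide_atLeastAtMost[of "x $ 3" 0 "x $ 3"] by simp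
  moreover have "g (x $ 3 * s) = f (zscale s x)" for s
    unfolding g_def v by (simp add: zscale_def mult.commute cong: if_cong)
  ultimately have "((\<lambda>s. f (zscale s x)) has_integral zint f x / x $ 3) {0..1}" by simp
  then show ?thesis using pos by (simp add: integral_unique)
qed

text \<open>The product rule for \<open>zint_scaled\<close>: the first term differentiates under the
  integral over the fixed interval, the second differentiates the factor
  \<open>x $ 3\<close>.\<close>

lemma zint_has_derivative:
  fixes f :: "real^3 \<Rightarrow> real"
  assumes f: "smooth_on strip f" and x: "x \<in> strip"
  shows "(zint f has_derivative (\<lambda>v. x $ 3 * integral {0..1} (\<lambda>s. \<Sum>k\<in>UNIV. zscale s v $ k * pd k f (zscale s x)) +
      v $ 3 * integral {0..1} (\<lambda>s. f (zscale s x)))) (at x within strip)"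
proof -
  define w where "w k s = (if k = 3 then s else 1)" for k :: 3 and s :: real
  \<comment> \<open>The chain rule written as a bounded linear functional, the form in which the
    Leibniz rule takes derivatives. The weight w is the factor s that \<open>zscale\<close> puts on
    the third coordinate.\<close>
  define fx where "fx y s = (\<Sum>k\<in>UNIV. (w k s * pd k f (zscale s y)) *\<^sub>R blinfun_inner_right (axis k (1::real)))"
    for y s
  have fx_apply: "blinfun_apply (fx y s) v = (\<Sum>k\<in>UNIV. zscale s v $ k * pd k f (zscale s y))" for y s v
    unfolding fx_def blinfun.sum_left
    by (intro sum.cong) (auto simp: blinfun.scaleR_left inner_axis' w_def zscale_def mult_ac)
  have compc: "continuous_on (strip \<times> {0..1}) (\<lambda>p. g (zscale (snd p) (fst p)))"
    if "continuous_on strip g" for g :: "real^3 \<Rightarrow> real"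
    by (rule continuous_on_compose2[OF that continuous_on_zscale]) (auto intro: zscale_strip)
  have wc: "continuous_on A (\<lambda>p. w k (snd p))" for k and A :: "((real^3) \<times> real) set"
    unfolding w_def by (cases "k = 3") (auto intro!: continuous_intros)
  have "((\<lambda>y. integral (cbox 0 1) (\<lambda>s. f (zscale s y))) has_derivative
      blinfun_apply (integral (cbox 0 1) (fx x))) (at x within strip)"
  proof (rule leibniz_rule[OF _ _ _ x convex_strip])
    fix y s assume y: "y \<in> strip" and s: "s \<in> cbox 0 (1::real)"
    have "(f has_derivative (\<lambda>v. dd strip v f (zscale s y))) (at (zscale s y) within zscale s ` strip)"
      using has_derivative_subset[OF smooth_on_has_derivative[OF fat_strip f zscale_strip]] s y zscale_strip
      by (metis cbox_interval image_subsetI)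
    from diff_chain_within[OF bounded_linear_imp_has_derivative[OF bounded_linear_zscale] this]
    have "((\<lambda>y. f (zscale s y)) has_derivative (\<lambda>v. dd strip (zscale s v) f (zscale s y))) (at y within strip)"
      by (simp add: o_def)
    moreover have "(\<lambda>v. dd strip (zscale s v) f (zscale s y)) = blinfun_apply (fx y s)"
      by (rule ext) (use dd_strip_expand[OF f zscale_strip] s y fx_apply in auto)
    ultimately show "((\<lambda>y. f (zscale s y)) has_derivative blinfun_apply (fx y s)) (at y within strip)" by simp
  next
    fix y assume y: "y \<in> strip"
    have "continuous_on {0..1} (\<lambda>s. f (zscale s y))"
      by (rule continuous_on_compose2[OF compc[OF smooth_on_continuous[OF f]], of "{0..1}" "\<lambda>s. (y, s)", simplified])
        (auto intro!: continuous_intros y)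
    then show "(\<lambda>s. f (zscale s y)) integrable_on cbox 0 1" by (simp add: integrable_continuous_real)
  next
    show "continuous_on (strip \<times> cbox 0 1) (\<lambda>(y, s). fx y s)"
      unfolding fx_def split_beta cbox_interval
      by (intro continuous_intros wc compc smooth_on_continuous smooth_on_pd f)
  qed
  moreover have "blinfun_apply (integral (cbox 0 1) (fx x)) v =
      integral {0..1} (\<lambda>s. \<Sum>k\<in>UNIV. zscale s v $ k * pd k f (zscale s x))" for v
  proof -
    have "continuous_on (cbox 0 1) (fx x)"
      unfolding fx_def
    proof (intro continuous_intros)
      fix k
      show "continuous_on (cbox 0 1) (w k)"
        unfolding w_def by (cases "k = 3") (auto intro!: continuous_intros)
      have "continuous_on {0..1} (\<lambda>s. (\<lambda>p. pd k f (zscale (snd p) (fst p))) (x, s))"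
        by (rule continuous_on_compose2[OF compc[OF smooth_on_continuous[OF smooth_on_pd[OF f]]], of "{0..1}" "\<lambda>s. (x, s)"])
          (auto intro!: continuous_intros x)
      then show "continuous_on (cbox 0 1) (\<lambda>s. pd k f (zscale s x))" by simp
    qed
    then have "fx x integrable_on cbox 0 1" by (rule integrable_continuous)
    from blinfun_apply_integral[OF this, of v] show ?thesis by (simp add: fx_apply)
  qed
  ultimately have "((\<lambda>y. integral {0..1} (\<lambda>s. f (zscale s y))) has_derivative
      (\<lambda>v. integral {0..1} (\<lambda>s. \<Sum>k\<in>UNIV. zscale s v $ k * pd k f (zscale s x)))) (at x within strip)"
    by (auto simp: cbox_interval elim!: has_derivative_eq_rhs)
  moreover have "((\<lambda>y. y $ 3) has_derivative (\<lambda>v. v $ 3)) (at x within strip)"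
    by (rule bounded_linear_imp_has_derivative[OF bounded_linear_vec_nth])
  ultimately have "((\<lambda>y. y $ 3 * integral {0..1} (\<lambda>s. f (zscale s y))) has_derivative
     (\<lambda>v. x $ 3 * integral {0..1} (\<lambda>s. \<Sum>k\<in>UNIV. zscale s v $ k * pd k f (zscale s x)) +
      v $ 3 * integral {0..1} (\<lambda>s. f (zscale s x)))) (at x within strip)"
    by (intro has_derivative_mult)
  then show ?thesis
    by (rule has_derivative_transform[OF x, rotated]) (use zint_scaled[OF smooth_on_continuous[OF f]] in auto)
qed

lemma pd_zint:
  fixes f :: "real^3 \<Rightarrow> real"
  assumes f: "smooth_on strip f" and x: "x \<in> strip" and i: "i \<noteq> 3"
  shows "pd i (zint f) x = zint (pd i f) x"
proof -
  have z: "zscale s (axis i 1) $ k = (if k = i then 1 else 0)" for s k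
    using i by (auto simp: zscale_def axis_def)
  have "pd i (zint f) x = x $ 3 * integral {0..1} (\<lambda>s. \<Sum>k\<in>UNIV. zscale s (axis i 1) $ k * pd k f (zscale s x)) +
      axis i 1 $ 3 * integral {0..1} (\<lambda>s. f (zscale s x))"
    unfolding pd_eq_dd by (rule dd_eqI[OF fat_strip x zint_has_derivative[OF f x, unfolded pd_eq_dd]])
  also have "\<dots> = x $ 3 * integral {0..1} (\<lambda>s. pd i f (zscale s x))"
    unfolding z using i by (simp add: axis_def if_distrib[where f = "\<lambda>c. c * _"] cong: if_cong)
  also have "\<dots> = zint (pd i f) x"
    by (rule zint_scaled[symmetric, OF smooth_on_continuous[OF smooth_on_pd[OF f]] x])
  finally show ?thesis .
qed

lemma continuous_on_zint:
  fixes f :: "real^3 \<Rightarrow> real"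
  assumes f: "smooth_on strip f"
  shows "continuous_on strip (zint f)"
  unfolding continuous_on_eq_continuous_within
  using zint_has_derivative[OF f] has_derivative_continuous by blast

lemma norm_vector2: "norm (vector [a, b] :: real^2) = sqrt (a\<^sup>2 + b\<^sup>2)"
  by (simp add: norm_vec_def L2_set_def sum_2)

text \<open>The norm of the integral of a plane vector field is at most the integral of its norm:
  project the field onto the direction of its integral (F, G), apply Cauchy-Schwarz pointwise, and
  divide by N.\<close>

lemma sqrt_sum_integral_le:
  fixes f g :: "real \<Rightarrow> real"
  assumes f: "continuous_on {a..b} f" and g: "continuous_on {a..b} g"
  shows "sqrt ((integral {a..b} f)\<^sup>2 + (integral {a..b} g)\<^sup>2) \<le> integral {a..b} (\<lambda>s. sqrt ((f s)\<^sup>2 + (g s)\<^sup>2))"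
proof -
  let ?F = "integral {a..b} f" and ?G = "integral {a..b} g"
  define N where "N = sqrt (?F\<^sup>2 + ?G\<^sup>2)"
  have c: "continuous_on {a..b} (\<lambda>s. sqrt ((f s)\<^sup>2 + (g s)\<^sup>2))" by (intro continuous_intros f g)
  have "((\<lambda>s. ?F * f s + ?G * g s) has_integral ?F * ?F + ?G * ?G) {a..b}"
    by (intro has_integral_add has_integral_mult_right integrable_integral integrable_continuous_real f g)
  moreover have "((\<lambda>s. N * sqrt ((f s)\<^sup>2 + (g s)\<^sup>2)) has_integral N * integral {a..b} (\<lambda>s. sqrt ((f s)\<^sup>2 + (g s)\<^sup>2))) {a..b}"
    by (intro has_integral_mult_right integrable_integral integrable_continuous_real c)
  moreover have "?F * f s + ?G * g s \<le> N * sqrt ((f s)\<^sup>2 + (g s)\<^sup>2)" for s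
    unfolding N_def real_sqrt_mult[symmetric]
  proof (rule real_le_rsqrt)
    have "0 \<le> (?F * g s - ?G * f s)\<^sup>2" by simp
    then show "(?F * f s + ?G * g s)\<^sup>2 \<le> (?F\<^sup>2 + ?G\<^sup>2) * ((f s)\<^sup>2 + (g s)\<^sup>2)"
      by (simp add: power2_eq_square algebra_simps)
  qed
  ultimately have "?F * ?F + ?G * ?G \<le> N * integral {a..b} (\<lambda>s. sqrt ((f s)\<^sup>2 + (g s)\<^sup>2))"
    by (rule has_integral_le)
  moreover have "?F * ?F + ?G * ?G = N * N" by (simp add: N_def flip: power2_eq_square)
  moreover have "0 \<le> N" by (simp add: N_def)
  moreover have "0 \<le> integral {a..b} (\<lambda>s. sqrt ((f s)\<^sup>2 + (g s)\<^sup>2))"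
    by (intro integral_nonneg integrable_continuous_real c) simp
  ultimately have "N \<le> integral {a..b} (\<lambda>s. sqrt ((f s)\<^sup>2 + (g s)\<^sup>2))"
    by (cases "N = 0") auto
  then show ?thesis by (simp add: N_def)
qed

text \<open>
  The left-hand side is an upper bound for the constant of the elementary Gagliardo--Nirenberg
  argument; the comparison amounts to \<open>\<pi>\<^sup>4 \<le> 128\<close>.
\<close>

lemma CS_lower_bound:
  assumes "0 < Lx" "0 < Ly"
  shows "2 / sqrt 3 * (1 + sqrt (1 / Lx\<^sup>2 + 1 / Ly\<^sup>2) / pi) \<le> CS Lx Ly"
proof -
  have l: "0 < lambda1 Lx Ly" "lambda1 Lx Ly \<le> pi" using assms by (auto simp: lambda1_def)
  have p4: "pi ^ 4 \<le> 128"
  proof -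
    have "pi ^ 4 \<le> (3.2::real) ^ 4" using pi_approx by (intro power_mono) auto
    also have "\<dots> \<le> 128" by (simp add: power_divide)
    finally show ?thesis .
  qed
  \<comment> \<open>Sixth powers clear the square root and the exponents 2/3 at once: (sqrt 2 *
    2^(2/3))^6 = 8 * 16 = 128.\<close>
  have "(pi powr (2/3)) ^ 6 = pi powr 4"
    by (subst powr_power) auto
  also have "\<dots> = pi ^ 4" by (simp add: powr_numeral)
  also have "\<dots> \<le> 128" by (rule p4)
  also have "128 = (sqrt 2 * 2 powr (2/3)) ^ 6"
  proof -
    have "(sqrt 2) ^ 6 = 8" using power_mult[of "sqrt 2" 2 3] by simp
    moreover have "(2 powr (2/3)) ^ 6 = (2::real) powr 4"
      by (subst powr_power) auto
    ultimately show ?thesis by (simp add: power_mult_distrib powr_numeral)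
  qed
  finally have "pi powr (2/3) \<le> sqrt 2 * 2 powr (2/3)"
    by (subst (asm) power_mono_iff) auto
  then have "2 / sqrt 3 \<le> 2 * sqrt 2 * C3"
    by (simp add: C3_def field_simps)
  moreover have "1 + sqrt (1 / Lx\<^sup>2 + 1 / Ly\<^sup>2) / pi \<le> 1 + sqrt (1 + 1 / Lx\<^sup>2 + 1 / Ly\<^sup>2) / lambda1 Lx Ly"
    using l by (intro add_left_mono frac_le) auto
  ultimately show ?thesis
    unfolding CS_def by (intro mult_mono) (auto simp: C3_def intro!: add_nonneg_nonneg divide_nonneg_nonneg)
qed

lemma continuous_partial_integral:
  fixes g :: "real^3 \<Rightarrow> real"
  assumes g: "continuous_on (cbox a b) g" and ijk: "UNIV = {i, j, k}" "i \<noteq> j" "i \<noteq> k" "j \<noteq> k"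
  shows "continuous_on ({a$j..b$j} \<times> {a$k..b$k}) (\<lambda>(s, t).
      integral {a$i..b$i} (\<lambda>r. g (s *\<^sub>R axis j 1 + t *\<^sub>R axis k 1 + r *\<^sub>R axis i 1)))"
proof -
  note all = all_3_iff[OF ijk(1)]
  have "continuous_on (({a$j..b$j} \<times> {a$k..b$k}) \<times> cbox (a$i) (b$i))
      (\<lambda>p. g (fst (fst p) *\<^sub>R axis j 1 + snd (fst p) *\<^sub>R axis k 1 + snd p *\<^sub>R axis i 1))"
  proof (rule continuous_on_compose2[OF g])
    show "continuous_on (({a$j..b$j} \<times> {a$k..b$k}) \<times> cbox (a$i) (b$i))
      (\<lambda>p. fst (fst p) *\<^sub>R axis j 1 + snd (fst p) *\<^sub>R axis k 1 + snd p *\<^sub>R (axis i 1 :: real^3))"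
      by (intro continuous_intros)
  qed (use ijk(2-4) in \<open>auto simp: axis_def mem_box_cart all\<close>)
  then have "continuous_on (({a$j..b$j} \<times> {a$k..b$k}) \<times> cbox (a$i) (b$i))
      (\<lambda>(q, r). g (fst q *\<^sub>R axis j 1 + snd q *\<^sub>R axis k 1 + r *\<^sub>R axis i 1))"
    by (simp add: split_beta)
  from integral_continuous_on_param[OF this] show ?thesis by (simp add: split_beta)
qed

section \<open>The L^6 embedding and the Hardy inequality on the period cell\<close>

context period_cell
begin

lemma J_cart3:
  assumes g: "continuous_on (cell Lx Ly) g" and ijk: "UNIV = {i, j, k}" "i \<noteq> j" "i \<noteq> k" "j \<noteq> k"
  defines "L \<equiv> vector [Lx, Ly, 1] :: real^3"
  shows "J g = integral {0..L$j} (\<lambda>s. integral {0..L$k} (\<lambda>t.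
      integral {0..L$i} (\<lambda>r. g (s *\<^sub>R axis j 1 + t *\<^sub>R axis k 1 + r *\<^sub>R axis i 1))))"
    and "continuous_on ({0..L$j} \<times> {0..L$k}) (\<lambda>(s, t).
      integral {0..L$i} (\<lambda>r. g (s *\<^sub>R axis j 1 + t *\<^sub>R axis k 1 + r *\<^sub>R axis i 1)))"
  using integral_cart3(1)[of 0 L g i j k] continuous_partial_integral[of 0 L g i j k] g ijk
  by (auto simp: J_def cell_def L_def)

text \<open>Each supremum hypothesis bounds g by an integral over the full line through x parallel
  to one axis, hence by a function of the other two coordinates. The product of the three bounds
  dominates g^3, and thus h^2, in the shape required by \<open>Loomis_Whitney\<close>.\<close>

lemma cell_Loomis_Whitney:
  assumes h: "continuous_on (cell Lx Ly) h"
    and k: "continuous_on (cell Lx Ly) k1" "continuous_on (cell Lx Ly) k2" "continuous_on (cell Lx Ly) k3"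
    and nn: "\<And>x. x \<in> cell Lx Ly \<Longrightarrow> 0 \<le> k1 x" "\<And>x. x \<in> cell Lx Ly \<Longrightarrow> 0 \<le> k2 x" "\<And>x. x \<in> cell Lx Ly \<Longrightarrow> 0 \<le> k3 x"
    and g0: "\<And>x. x \<in> cell Lx Ly \<Longrightarrow> 0 \<le> g x"
    and le: "\<And>x. x \<in> cell Lx Ly \<Longrightarrow> (h x)\<^sup>2 \<le> g x ^ 3"
    and sup1: "\<And>x. x \<in> cell Lx Ly \<Longrightarrow> g x \<le> integral {0..Lx} (\<lambda>r. k1 (x + (r - x$1) *\<^sub>R axis 1 1))"
    and sup2: "\<And>x. x \<in> cell Lx Ly \<Longrightarrow> g x \<le> integral {0..Ly} (\<lambda>r. k2 (x + (r - x$2) *\<^sub>R axis 2 1))"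
    and sup3: "\<And>x. x \<in> cell Lx Ly \<Longrightarrow> g x \<le> integral {0..1} (\<lambda>r. k3 (x + (r - x$3) *\<^sub>R axis 3 1))"
  shows "(J h)\<^sup>2 \<le> J k1 * J k2 * J k3"
proof -
  define A where "A y z = integral {0..Lx} (\<lambda>r. k1 (y *\<^sub>R axis 2 1 + z *\<^sub>R axis 3 1 + r *\<^sub>R axis 1 1))" for y z
  define B where "B x z = integral {0..Ly} (\<lambda>r. k2 (x *\<^sub>R axis 1 1 + z *\<^sub>R axis 3 1 + r *\<^sub>R axis 2 1))" for x z
  define C where "C x y = integral {0..1} (\<lambda>r. k3 (x *\<^sub>R axis 1 1 + y *\<^sub>R axis 2 1 + r *\<^sub>R axis 3 1))" for x y
  define H where "H x y z = h (x *\<^sub>R axis 1 1 + y *\<^sub>R axis 2 1 + z *\<^sub>R axis 3 1)" for x y z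
  have s: "(UNIV::3 set) = {1, 2, 3}" "(UNIV::3 set) = {2, 1, 3}" "(UNIV::3 set) = {3, 1, 2}"
    using UNIV_3 by auto
  have IA: "J k1 = integral {0..Ly} (\<lambda>y. integral {0..1} (A y))" "continuous_on ({0..Ly} \<times> {0..1}) (\<lambda>(y, z). A y z)"
    using J_cart3[OF k(1) s(1)] by (auto simp: A_def[abs_def])
  have IB: "J k2 = integral {0..Lx} (\<lambda>x. integral {0..1} (B x))" "continuous_on ({0..Lx} \<times> {0..1}) (\<lambda>(y, z). B y z)"
    using J_cart3[OF k(2) s(2)] by (auto simp: B_def[abs_def])
  have IC: "J k3 = integral {0..Lx} (\<lambda>x. integral {0..Ly} (C x))" "continuous_on ({0..Lx} \<times> {0..Ly}) (\<lambda>(y, z). C y z)"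
    using J_cart3[OF k(3) s(3)] by (auto simp: C_def[abs_def])
  have IH: "J h = integral {0..Lx} (\<lambda>x. integral {0..Ly} (\<lambda>y. integral {0..1} (H x y)))"
    using J_cart3[OF h s(3)] by (auto simp: H_def[abs_def])
  have mem: "x *\<^sub>R axis 1 1 + y *\<^sub>R axis 2 1 + z *\<^sub>R axis 3 1 \<in> cell Lx Ly"
    if "x \<in> {0..Lx}" "y \<in> {0..Ly}" "z \<in> {0..1}" for x y z
    using that by (auto simp: mem_cell axis_def)
  show ?thesis
    unfolding IA(1) IB(1) IC(1) IH
  proof (rule Loomis_Whitney[OF _ IA(2) IB(2) IC(2)])
    show "continuous_on ({0..Lx} \<times> {0..Ly} \<times> {0..1}) (\<lambda>(x, y, z). H x y z)"
      unfolding H_def split_beta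
      by (rule continuous_on_compose2[OF h]) (auto intro!: continuous_intros mem)
  next
    fix y z :: real assume yz: "y \<in> {0..Ly}" "z \<in> {0..1}"
    have "continuous_on {0..Lx} (\<lambda>r. k1 (y *\<^sub>R axis 2 1 + z *\<^sub>R axis 3 1 + r *\<^sub>R axis 1 1))"
      by (rule continuous_on_compose2[OF k(1)])
        (use mem yz in \<open>auto intro!: continuous_intros simp: add_ac\<close>)
    then show "0 \<le> A y z"
      unfolding A_def using mem yz
      by (intro integral_nonneg integrable_continuous_real nn) (auto simp: add_ac)
  next
    fix x z :: real assume yz: "x \<in> {0..Lx}" "z \<in> {0..1}"
    have "continuous_on {0..Ly} (\<lambda>r. k2 (x *\<^sub>R axis 1 1 + z *\<^sub>R axis 3 1 + r *\<^sub>R axis 2 1))"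
      by (rule continuous_on_compose2[OF k(2)])
        (use mem yz in \<open>auto intro!: continuous_intros simp: add_ac\<close>)
    then show "0 \<le> B x z"
      unfolding B_def using mem yz
      by (intro integral_nonneg integrable_continuous_real nn) (auto simp: add_ac)
  next
    fix x y :: real assume yz: "x \<in> {0..Lx}" "y \<in> {0..Ly}"
    have "continuous_on {0..1} (\<lambda>r. k3 (x *\<^sub>R axis 1 1 + y *\<^sub>R axis 2 1 + r *\<^sub>R axis 3 1))"
      by (rule continuous_on_compose2[OF k(3)])
        (use mem yz in \<open>auto intro!: continuous_intros\<close>)
    then show "0 \<le> C x y"
      unfolding C_def using mem yz
      by (intro integral_nonneg integrable_continuous_real nn) auto
  next
    fix x y z :: real assume xyz: "x \<in> {0..Lx}" "y \<in> {0..Ly}" "z \<in> {0..1}"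
    let ?p = "x *\<^sub>R axis 1 1 + y *\<^sub>R axis 2 1 + z *\<^sub>R axis 3 1 :: real^3"
    have p: "?p \<in> cell Lx Ly" by (rule mem[OF xyz])
    have "?p $ 1 = x" "?p $ 2 = y" "?p $ 3 = z" by (auto simp: axis_def)
    then have "g ?p \<le> A y z" "g ?p \<le> B x z" "g ?p \<le> C x y"
      using sup1[OF p] sup2[OF p] sup3[OF p] by (auto simp: A_def B_def C_def algebra_simps)
    then have "g ?p * g ?p * g ?p \<le> A y z * B x z * C x y"
      using g0[OF p] by (intro mult_mono) auto
    then show "(H x y z)\<^sup>2 \<le> A y z * B x z * C x y"
      using le[OF p] by (simp add: H_def power3_eq_cube)
  qed
qed

text \<open>For the pair t = (t1, t2) let m = |t|^2 and g = |t|^4, so that F = \<integral> m^3 is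
  also the integral of g^(3/2). As |pd i g| is at most 4 |t|^3 |pd i t|, each of the three factors
  bounding F^2 contains one sqrt F. What remains is sqrt F \<le> a b c, and AM-GM for a^2, b^2, c^2
  turns this into the cube of the energy.\<close>

lemma Gagliardo_Nirenberg_6:
  assumes t1: "smooth_on strip t1" "periodic_xy Lx Ly t1" "\<forall>x\<in>walls. t1 x = 0"
    and t2: "smooth_on strip t2" "periodic_xy Lx Ly t2" "\<forall>x\<in>walls. t2 x = 0"
  shows "J (\<lambda>x. ((t1 x)\<^sup>2 + (t2 x)\<^sup>2) ^ 3) \<le> ((CS Lx Ly)\<^sup>2 * (grad2 t1 + grad2 t2)) ^ 3"
proof -
  define m where "m x = (t1 x)\<^sup>2 + (t2 x)\<^sup>2" for x
  define g where "g x = (m x)\<^sup>2" for x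
  define e where "e i x = (pd i t1 x)\<^sup>2 + (pd i t2 x)\<^sup>2" for i x
  have sm: "smooth_on strip m" "smooth_on strip g" "\<And>i. smooth_on strip (e i)"
    unfolding m_def[abs_def] g_def[abs_def] e_def[abs_def] by (intro smooth_intros t1 t2)+
  have m0: "0 \<le> m x" and e0: "0 \<le> e i x" for x i by (auto simp: m_def e_def)
  have per: "periodic_xy Lx Ly g" using t1(2) t2(2) by (simp add: periodic_xy_def g_def m_def)
  have gw: "g x = 0" if "x \<in> walls" for x using t1(3) t2(3) that by (simp add: g_def m_def)
  have pdg: "\<bar>pd i g x\<bar> \<le> 4 * (sqrt (m x ^ 3) * sqrt (e i x))" if x: "x \<in> strip" for i x
  proof -
    have pm: "pd i m x = 2 * (t1 x * pd i t1 x + t2 x * pd i t2 x)"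
      unfolding m_def[abs_def] power2_eq_square
      by (subst pd_add) (auto intro!: smooth_intros t1 t2 simp: pd_mult t1 t2 x)
    have pg: "pd i g x = 2 * m x * pd i m x"
      unfolding g_def[abs_def] power2_eq_square by (simp add: pd_mult sm x)
    have "\<bar>t1 x * pd i t1 x + t2 x * pd i t2 x\<bar> \<le> sqrt (m x * e i x)"
    proof (rule real_le_rsqrt)
      have "0 \<le> (t1 x * pd i t2 x - t2 x * pd i t1 x)\<^sup>2" by simp
      then show "\<bar>t1 x * pd i t1 x + t2 x * pd i t2 x\<bar>\<^sup>2 \<le> m x * e i x"
        by (simp add: m_def e_def power2_eq_square algebra_simps)
    qed
    then have "4 * (m x * \<bar>t1 x * pd i t1 x + t2 x * pd i t2 x\<bar>) \<le> 4 * (m x * sqrt (m x * e i x))"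
      using m0[of x] by (intro mult_left_mono) auto
    moreover have "\<bar>pd i g x\<bar> = 4 * (m x * \<bar>t1 x * pd i t1 x + t2 x * pd i t2 x\<bar>)"
      unfolding pg pm using m0[of x] by (simp only: abs_mult abs_of_nonneg abs_numeral)
    ultimately have "\<bar>pd i g x\<bar> \<le> 4 * (m x * sqrt (m x * e i x))" by simp
    also have "m x * sqrt (m x * e i x) = sqrt (m x ^ 3) * sqrt (e i x)"
      using m0[of x] by (simp add: real_sqrt_mult power3_eq_cube)
    finally show ?thesis .
  qed
  define F where "F = J (\<lambda>x. m x ^ 3)"
  define M where "M = J m"
  define D where "D i = J (e i)" for i
  have F0: "0 \<le> F" unfolding F_def by (intro J_nonneg cont_cell smooth_intros sm) (simp add: m0)
  have M0: "0 \<le> M" unfolding M_def by (intro J_nonneg cont_cell sm m0)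
  have D0: "0 \<le> D i" for i unfolding D_def by (intro J_nonneg cont_cell sm e0)
  have cc: "continuous_on (cell Lx Ly) (\<lambda>x. \<bar>pd i g x\<bar>)" for i
    by (intro continuous_intros cont_cell smooth_intros sm)
  have cg: "continuous_on (cell Lx Ly) g" by (intro cont_cell sm)
  have cs: "continuous_on (cell Lx Ly) (\<lambda>x. sqrt (m x ^ 3))" "continuous_on (cell Lx Ly) (\<lambda>x. sqrt (e i x))"
    "continuous_on (cell Lx Ly) (\<lambda>x. sqrt (m x))" for i
    by (intro continuous_intros cont_cell sm)+
  \<comment> \<open>Cauchy-Schwarz for g = m^(3/2) m^(1/2), so that this lower-order term carries
    the same factor sqrt F as the derivative terms.\<close>
  have Jg: "J g \<le> sqrt F * sqrt M"
  proof -
    have "J g = J (\<lambda>x. sqrt (m x ^ 3) * sqrt (m x))"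
    proof (rule J_cong)
      fix x
      have "m x ^ 3 * m x = (g x)\<^sup>2" by (simp add: g_def power2_eq_square power3_eq_cube)
      then have "sqrt (m x ^ 3) * sqrt (m x) = sqrt ((g x)\<^sup>2)" by (simp only: real_sqrt_mult[symmetric])
      also have "\<dots> = g x" unfolding real_sqrt_abs by (simp add: g_def)
      finally show "g x = sqrt (m x ^ 3) * sqrt (m x)" by simp
    qed
    also have "\<dots> \<le> sqrt (J (\<lambda>x. (sqrt (m x ^ 3))\<^sup>2)) * sqrt (J (\<lambda>x. (sqrt (m x))\<^sup>2))"
      using J_Cauchy_Schwarz[OF cs(1,3)] by linarith
    also have "\<dots> = sqrt F * sqrt M" using m0 by (simp add: F_def M_def)
    finally show ?thesis .
  qed
  have Jp: "J (\<lambda>x. \<bar>pd i g x\<bar> / 2) \<le> 2 * (sqrt F * sqrt (D i))" for i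
  proof -
    have "J (\<lambda>x. \<bar>pd i g x\<bar> / 2) \<le> J (\<lambda>x. 2 * (sqrt (m x ^ 3) * sqrt (e i x)))"
    proof (rule J_mono)
      fix x assume "x \<in> cell Lx Ly"
      then show "\<bar>pd i g x\<bar> / 2 \<le> 2 * (sqrt (m x ^ 3) * sqrt (e i x))"
        using pdg[OF cell_strip, of x i] by simp
    qed (auto intro!: continuous_on_divide cc continuous_on_mult continuous_on_const cs)
    also have "\<dots> = 2 * J (\<lambda>x. sqrt (m x ^ 3) * sqrt (e i x))" by (rule J_cmult)
    also have "J (\<lambda>x. sqrt (m x ^ 3) * sqrt (e i x)) \<le>
        sqrt (J (\<lambda>x. (sqrt (m x ^ 3))\<^sup>2)) * sqrt (J (\<lambda>x. (sqrt (e i x))\<^sup>2))"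
      using J_Cauchy_Schwarz[OF cs(1,2)] abs_le_D1 by blast
    finally show ?thesis using m0 e0 by (simp add: F_def D_def)
  qed
  \<comment> \<open>Integrands of the supremum bounds along the three axes. There is no mean-value
    term in the vertical direction, because g vanishes on the walls.\<close>
  define k1 where "k1 x = g x / Lx + \<bar>pd 1 g x\<bar> / 2" for x
  define k2 where "k2 x = g x / Ly + \<bar>pd 2 g x\<bar> / 2" for x
  define k3 where "k3 x = \<bar>pd 3 g x\<bar> / 2" for x
  have ck: "continuous_on (cell Lx Ly) k1" "continuous_on (cell Lx Ly) k2" "continuous_on (cell Lx Ly) k3"
    unfolding k1_def[abs_def] k2_def[abs_def] k3_def[abs_def]
    using Lx Ly by (auto intro!: continuous_intros cg cc)
  have line: "((\<lambda>s. g ((x - (x $ i) *\<^sub>R axis i 1) + s *\<^sub>R axis i 1)) has_vector_derivative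
      pd i g ((x - (x $ i) *\<^sub>R axis i 1) + r *\<^sub>R axis i 1)) (at r within {0..(vector [Lx, Ly, 1] :: real^3) $ i})"
    "continuous_on {0..(vector [Lx, Ly, 1] :: real^3) $ i} (\<lambda>r. pd i g ((x - (x $ i) *\<^sub>R axis i 1) + r *\<^sub>R axis i 1))"
    if x: "x \<in> cell Lx Ly" and r: "r \<in> {0..(vector [Lx, Ly, 1] :: real^3) $ i}" for i x r
  proof -
    have st: "(x - (x $ i) *\<^sub>R axis i 1) + s *\<^sub>R axis i 1 \<in> strip" if "s \<in> {0..(vector [Lx, Ly, 1] :: real^3) $ i}" for s
      using x that by (cases "i = 3") (auto simp: strip_def mem_cell axis_def)
    show "((\<lambda>s. g ((x - (x $ i) *\<^sub>R axis i 1) + s *\<^sub>R axis i 1)) has_vector_derivative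
      pd i g ((x - (x $ i) *\<^sub>R axis i 1) + r *\<^sub>R axis i 1)) (at r within {0..(vector [Lx, Ly, 1] :: real^3) $ i})"
      by (rule has_vector_derivative_axis[OF sm(2) st r])
    show "continuous_on {0..(vector [Lx, Ly, 1] :: real^3) $ i} (\<lambda>r. pd i g ((x - (x $ i) *\<^sub>R axis i 1) + r *\<^sub>R axis i 1))"
      by (rule continuous_on_compose2[OF smooth_on_continuous[OF smooth_on_pd[OF sm(2)]]])
        (use st in \<open>auto intro!: continuous_intros\<close>)
  qed
  have shift: "x + (r - x $ i) *\<^sub>R axis i 1 = (x - (x $ i) *\<^sub>R axis i 1) + r *\<^sub>R axis i (1::real)" for x :: "real^3" and r i
    by (simp add: algebra_simps)
  have self: "(x - (x $ i) *\<^sub>R axis i 1) + (x $ i) *\<^sub>R axis i (1::real) = x" for x :: "real^3" and i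
    by simp
  have ax: "axis 1 Lx = Lx *\<^sub>R axis 1 (1::real)" "axis 2 Ly = Ly *\<^sub>R axis 2 (1::real)"
    by (auto simp: vec_eq_iff axis_def)
  have s1: "g x \<le> integral {0..Lx} (\<lambda>r. k1 (x + (r - x $ 1) *\<^sub>R axis 1 1))" if x: "x \<in> cell Lx Ly" for x
  proof -
    have "x - (x $ 1) *\<^sub>R axis 1 1 \<in> strip" using x by (auto simp: strip_def mem_cell axis_def)
    then have p: "g ((x - (x $ 1) *\<^sub>R axis 1 1) + 0 *\<^sub>R axis 1 1) = g ((x - (x $ 1) *\<^sub>R axis 1 1) + Lx *\<^sub>R axis 1 1)"
      using per unfolding periodic_xy_def ax by simp
    show ?thesis
      using periodic_sup_bound[OF line(1)[OF x, of _ 1, simplified cell_corner] line(2)[OF x, of 0 1, simplified cell_corner] p Lx, of "x $ 1"] x Lx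
      unfolding k1_def shift self by (simp add: mem_cell)
  qed
  have s2: "g x \<le> integral {0..Ly} (\<lambda>r. k2 (x + (r - x $ 2) *\<^sub>R axis 2 1))" if x: "x \<in> cell Lx Ly" for x
  proof -
    have "x - (x $ 2) *\<^sub>R axis 2 1 \<in> strip" using x by (auto simp: strip_def mem_cell axis_def)
    then have p: "g ((x - (x $ 2) *\<^sub>R axis 2 1) + 0 *\<^sub>R axis 2 1) = g ((x - (x $ 2) *\<^sub>R axis 2 1) + Ly *\<^sub>R axis 2 1)"
      using per unfolding periodic_xy_def ax by simp
    show ?thesis
      using periodic_sup_bound[OF line(1)[OF x, of _ 2, simplified cell_corner] line(2)[OF x, of 0 2, simplified cell_corner] p Ly, of "x $ 2"] x Ly
      unfolding k2_def shift self by (simp add: mem_cell)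
  qed
  have s3: "g x \<le> integral {0..1} (\<lambda>r. k3 (x + (r - x $ 3) *\<^sub>R axis 3 1))" if x: "x \<in> cell Lx Ly" for x
  proof -
    have z: "g ((x - (x $ 3) *\<^sub>R axis 3 1) + 0 *\<^sub>R axis 3 1) = 0" "g ((x - (x $ 3) *\<^sub>R axis 3 1) + 1 *\<^sub>R axis 3 1) = 0"
      by (rule gw; simp add: walls_def axis_def)+
    have "2 * (g x - 0) \<le> integral {0..1} (\<lambda>r. \<bar>pd 3 g ((x - (x $ 3) *\<^sub>R axis 3 1) + r *\<^sub>R axis 3 1)\<bar>)"
      using periodic_oscillation[OF line(1)[OF x, of _ 3, simplified cell_corner] line(2)[OF x, of 0 3, simplified cell_corner], of "x $ 3" 0] x
      unfolding z self by (simp add: mem_cell)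
    then show ?thesis
      unfolding k3_def shift by (simp add: integral_divide)
  qed
  have LW: "F\<^sup>2 \<le> J k1 * J k2 * J k3"
    unfolding F_def
  proof (rule cell_Loomis_Whitney[OF _ ck])
    show "continuous_on (cell Lx Ly) (\<lambda>x. m x ^ 3)" by (intro cont_cell smooth_intros sm)
    show "(m x ^ 3)\<^sup>2 \<le> g x ^ 3" for x by (simp add: g_def flip: power_mult)
  qed (use s1 s2 s3 Lx Ly in \<open>auto simp: k1_def k2_def k3_def g_def\<close>)
  define X where "X = sqrt F"
  define a where "a = sqrt M / Lx + 2 * sqrt (D 1)"
  define b where "b = sqrt M / Ly + 2 * sqrt (D 2)"
  define c where "c = 2 * sqrt (D 3)"
  have abc: "0 \<le> a" "0 \<le> b" "0 \<le> c" using M0 D0 Lx Ly by (auto simp: a_def b_def c_def)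
  have X0: "0 \<le> X" using F0 by (simp add: X_def)
  have J1: "J k1 \<le> X * a"
  proof -
    have "J k1 = J (\<lambda>x. (1 / Lx) * g x + \<bar>pd 1 g x\<bar> / 2)" by (simp add: k1_def[abs_def])
    also have "\<dots> = (1 / Lx) * J g + J (\<lambda>x. \<bar>pd 1 g x\<bar> / 2)"
      unfolding J_cmult[symmetric, of "1 / Lx" g]
      by (intro J_add continuous_on_mult continuous_on_const cg continuous_on_divide cc) simp
    also have "\<dots> \<le> (1 / Lx) * (sqrt F * sqrt M) + 2 * (sqrt F * sqrt (D 1))"
      using Lx by (intro add_mono mult_left_mono Jg Jp) auto
    also have "\<dots> = X * a" by (simp add: X_def a_def algebra_simps)
    finally show ?thesis .
  qed
  have J2: "J k2 \<le> X * b"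
  proof -
    have "J k2 = J (\<lambda>x. (1 / Ly) * g x + \<bar>pd 2 g x\<bar> / 2)" by (simp add: k2_def[abs_def])
    also have "\<dots> = (1 / Ly) * J g + J (\<lambda>x. \<bar>pd 2 g x\<bar> / 2)"
      unfolding J_cmult[symmetric, of "1 / Ly" g]
      by (intro J_add continuous_on_mult continuous_on_const cg continuous_on_divide cc) simp
    also have "\<dots> \<le> (1 / Ly) * (sqrt F * sqrt M) + 2 * (sqrt F * sqrt (D 2))"
      using Ly by (intro add_mono mult_left_mono Jg Jp) auto
    also have "\<dots> = X * b" by (simp add: X_def b_def algebra_simps)
    finally show ?thesis .
  qed
  have J3: "J k3 \<le> X * c" using Jp[of 3] by (simp add: k3_def[abs_def] X_def c_def)
  have k0: "0 \<le> J k1" "0 \<le> J k2" "0 \<le> J k3"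
    by (intro J_nonneg ck; use Lx Ly in \<open>simp add: k1_def k2_def k3_def g_def\<close>)+
  \<comment> \<open>With X = sqrt F the Loomis-Whitney bound reads X^4 \<le> X^3 a b c, and X^3
    cancels.\<close>
  have "X ^ 3 * X = F\<^sup>2"
  proof -
    have "X ^ 3 * X = (X\<^sup>2)\<^sup>2" by (simp add: power2_eq_square power3_eq_cube)
    then show ?thesis using F0 by (simp add: X_def)
  qed
  also have "\<dots> \<le> (X * a) * (X * b) * (X * c)"
    by (rule order_trans[OF LW]) (intro mult_mono J1 J2 J3 k0 mult_nonneg_nonneg X0 abc)
  also have "\<dots> = X ^ 3 * (a * b * c)" by (simp add: power3_eq_cube)
  finally have "X ^ 3 * X \<le> X ^ 3 * (a * b * c)" .
  then have Xle: "X \<le> a * b * c"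
    using X0 abc by (cases "X = 0") auto
  define d where "d = sqrt (grad2 t1 + grad2 t2)"
  have dd: "D 1 + D 2 + D 3 = grad2 t1 + grad2 t2"
  proof -
    have "D i = J (\<lambda>x. (pd i t1 x)\<^sup>2) + J (\<lambda>x. (pd i t2 x)\<^sup>2)" for i
      unfolding D_def e_def[abs_def] by (intro J_add cont_cell smooth_intros t1 t2)
    then show ?thesis by (simp add: grad2_def sum_3)
  qed
  have d2: "d\<^sup>2 = D 1 + D 2 + D 3" and d0: "0 \<le> d"
    using D0 by (auto simp: d_def dd[symmetric])
  have "pi\<^sup>2 * M \<le> d\<^sup>2"
  proof -
    have "M = J (\<lambda>x. (t1 x)\<^sup>2) + J (\<lambda>x. (t2 x)\<^sup>2)"
      unfolding M_def m_def[abs_def] by (intro J_add cont_cell smooth_intros t1 t2)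
    then show ?thesis
      using Poincare_grad2[OF t1(1,3)] Poincare_grad2[OF t2(1,3)] dd d2 by (simp add: algebra_simps)
  qed
  then have "sqrt (pi\<^sup>2 * M) \<le> sqrt (d\<^sup>2)" by (rule real_sqrt_le_mono)
  then have sM: "sqrt M \<le> d / pi" using d0 by (simp add: real_sqrt_mult field_simps)
  define \<rho> where "\<rho> = sqrt (1 / Lx\<^sup>2 + 1 / Ly\<^sup>2)"
  have \<rho>: "0 \<le> \<rho>" "\<rho>\<^sup>2 = 1 / Lx\<^sup>2 + 1 / Ly\<^sup>2" by (auto simp: \<rho>_def)
  \<comment> \<open>Cauchy-Schwarz in the plane for the vectors (sqrt (D 1), sqrt (D 2)) and (1/Lx,
    1/Ly).\<close>
  have cross: "sqrt (D 1) / Lx + sqrt (D 2) / Ly \<le> d * \<rho>"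
  proof (rule power2_le_imp_le)
    have "0 \<le> (sqrt (D 1) / Ly - sqrt (D 2) / Lx)\<^sup>2" by simp
    then have "(sqrt (D 1) / Lx + sqrt (D 2) / Ly)\<^sup>2 \<le> ((sqrt (D 1))\<^sup>2 + (sqrt (D 2))\<^sup>2) * (1 / Lx\<^sup>2 + 1 / Ly\<^sup>2)"
      by (simp add: power2_eq_square algebra_simps)
    also have "\<dots> \<le> d\<^sup>2 * \<rho>\<^sup>2"
      unfolding \<rho>(2) d2 using D0 by (intro mult_right_mono) auto
    finally show "(sqrt (D 1) / Lx + sqrt (D 2) / Ly)\<^sup>2 \<le> (d * \<rho>)\<^sup>2" by (simp add: power_mult_distrib)
  qed (use d0 \<rho> in auto)
  \<comment> \<open>Expanding the squares and estimating the mixed terms completes the square (2 d +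
    \<rho> sqrt M)^2. The Poincare bound sqrt M \<le> d/\<pi> then absorbs the mean-value terms into
    the energy d^2.\<close>
  have "a\<^sup>2 + b\<^sup>2 + c\<^sup>2 = 4 * ((sqrt (D 1))\<^sup>2 + (sqrt (D 2))\<^sup>2 + (sqrt (D 3))\<^sup>2) +
      (sqrt M)\<^sup>2 * (1 / Lx\<^sup>2 + 1 / Ly\<^sup>2) + 4 * sqrt M * (sqrt (D 1) / Lx + sqrt (D 2) / Ly)"
    by (simp add: a_def b_def c_def power2_eq_square algebra_simps)
  also have "\<dots> = 4 * d\<^sup>2 + (sqrt M)\<^sup>2 * \<rho>\<^sup>2 + 4 * sqrt M * (sqrt (D 1) / Lx + sqrt (D 2) / Ly)"
    using D0 by (simp add: d2 \<rho>(2))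
  also have "\<dots> \<le> 4 * d\<^sup>2 + (sqrt M)\<^sup>2 * \<rho>\<^sup>2 + 4 * sqrt M * (d * \<rho>)"
    using cross M0 by (intro add_left_mono mult_left_mono) auto
  also have "\<dots> = (2 * d + sqrt M * \<rho>)\<^sup>2" by (simp add: power2_eq_square algebra_simps)
  also have "\<dots> \<le> (2 * d + d / pi * \<rho>)\<^sup>2"
    using sM M0 \<rho> d0 by (intro power_mono add_left_mono mult_right_mono) auto
  also have "\<dots> \<le> (sqrt 3 * CS Lx Ly * d)\<^sup>2"
  proof (rule power_mono)
    have "2 * (1 + \<rho> / pi) \<le> sqrt 3 * CS Lx Ly"
      using CS_lower_bound[OF Lx Ly] by (simp add: \<rho>_def field_simps)
    moreover have "2 + \<rho> / pi \<le> 2 * (1 + \<rho> / pi)" using \<rho> by (simp add: field_simps)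
    ultimately have "(2 + \<rho> / pi) * d \<le> sqrt 3 * CS Lx Ly * d"
      using d0 by (intro mult_right_mono) auto
    then show "2 * d + d / pi * \<rho> \<le> sqrt 3 * CS Lx Ly * d" by (simp add: algebra_simps)
  qed (use d0 \<rho> in auto)
  also have "\<dots> = 3 * ((CS Lx Ly)\<^sup>2 * d\<^sup>2)" by (simp add: power_mult_distrib)
  finally have abc_le: "a\<^sup>2 + b\<^sup>2 + c\<^sup>2 \<le> 3 * ((CS Lx Ly)\<^sup>2 * d\<^sup>2)" .
  have amgm: "27 * (p * q * r) \<le> (p + q + r) ^ 3" if "0 \<le> p" "0 \<le> q" "0 \<le> r" for p q r :: real
  proof -
    have "0 \<le> (p + q + r) * ((p - q)\<^sup>2 + (q - r)\<^sup>2 + (p - r)\<^sup>2) + 6 * (p * (q - r)\<^sup>2 + q * (p - r)\<^sup>2 + r * (p - q)\<^sup>2)"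
      using that by (intro add_nonneg_nonneg mult_nonneg_nonneg) auto
    then show ?thesis by (simp add: power2_eq_square power3_eq_cube algebra_simps)
  qed
  have "F = X\<^sup>2" using F0 by (simp add: X_def)
  also have "\<dots> \<le> (a * b * c)\<^sup>2" using Xle X0 by (intro power_mono)
  also have "\<dots> = a\<^sup>2 * b\<^sup>2 * c\<^sup>2" by (simp add: power_mult_distrib)
  also have "\<dots> \<le> (a\<^sup>2 + b\<^sup>2 + c\<^sup>2) ^ 3 / 27" using amgm[of "a\<^sup>2" "b\<^sup>2" "c\<^sup>2"] by simp
  also have "\<dots> \<le> (3 * ((CS Lx Ly)\<^sup>2 * d\<^sup>2)) ^ 3 / 27"
    using abc_le by (intro divide_right_mono power_mono) auto
  also have "\<dots> = ((CS Lx Ly)\<^sup>2 * d\<^sup>2) ^ 3" by (simp add: power_mult_distrib)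
  finally show ?thesis using D0 by (simp add: F_def m_def d2 dd)
qed

text \<open>On each vertical line the norm of the integrated horizontal gradient is at most the
  integral of its norm \<phi>, which reduces the vector statement to the scalar
  \<open>Hardy3\<close>.\<close>

lemma Hardy_cell:
  assumes f: "smooth_on strip f"
  shows "J (\<lambda>x. norm (grad_xy (zint f) x) ^ 3) \<le> b3 ^ 3 * J (\<lambda>x. sqrt ((pd 1 f x)\<^sup>2 + (pd 2 f x)\<^sup>2) ^ 3)"
    and "continuous_on (cell Lx Ly) (grad_xy (zint f))"
proof -
  let ?m = "\<lambda>x. sqrt ((pd 1 f x)\<^sup>2 + (pd 2 f x)\<^sup>2)"
  let ?N = "\<lambda>x. sqrt ((zint (pd 1 f) x)\<^sup>2 + (zint (pd 2 f) x)\<^sup>2)"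
  have gr: "grad_xy (zint f) x = vector [zint (pd 1 f) x, zint (pd 2 f) x]" if "x \<in> strip" for x
    by (simp add: grad_xy_def pd_zint[OF f that])
  have zc: "continuous_on (cell Lx Ly) (zint (pd i f))" for i
    using continuous_on_zint[OF smooth_on_pd[OF f]] continuous_on_subset cell_subset_strip by blast
  have cN: "continuous_on (cell Lx Ly) ?N" by (intro continuous_intros zc)
  have cm: "continuous_on (cell Lx Ly) ?m" by (intro continuous_intros cont_cell smooth_intros f)
  have "continuous_on (cell Lx Ly) (\<lambda>x. \<chi> i. zint (pd (if i = 1 then 1 else 2) f) x :: real^2)"
    by (intro continuous_on_vec_lambda zc)
  moreover have "(\<chi> i. zint (pd (if i = 1 then 1 else 2) f) x :: real^2) = grad_xy (zint f) x" if "x \<in> cell Lx Ly" for x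
    using gr[OF cell_strip[OF that]] by (simp add: vec_eq_iff forall_2)
  ultimately show "continuous_on (cell Lx Ly) (grad_xy (zint f))"
    by (rule continuous_on_eq) 
  have c: "continuous_on (cell Lx Ly) (\<lambda>x. b3 ^ 3 * ?m x ^ 3 - ?N x ^ 3)"
    by (intro continuous_intros cN cm)
  have "0 \<le> J (\<lambda>x. b3 ^ 3 * ?m x ^ 3 - ?N x ^ 3)"
    unfolding J_def cell_def
  proof (rule integral_nonneg_slices[where i = 3])
    fix x :: "real^3" assume x: "x $ 3 = 0"
    have st: "x + r *\<^sub>R axis 3 1 \<in> strip" if "r \<in> {0..1}" for r
      using x that by (auto simp: strip_def axis_def)
    have c1: "continuous_on {0..1} (\<lambda>r. g (x + r *\<^sub>R axis 3 1))" if "continuous_on strip g" for g :: "real^3 \<Rightarrow> real"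
      by (rule continuous_on_compose2[OF that]) (use st in \<open>auto intro!: continuous_intros\<close>)
    have cp: "continuous_on {0..1} (\<lambda>r. pd i f (x + r *\<^sub>R axis 3 1))" for i
      by (intro c1 smooth_on_continuous smooth_intros f)
    have cz: "continuous_on {0..1} (\<lambda>r. zint (pd i f) (x + r *\<^sub>R axis 3 1))" for i
      by (intro c1 continuous_on_zint smooth_intros f)
    define \<phi> where "\<phi> r = ?m (x + r *\<^sub>R axis 3 1)" for r
    have c\<phi>: "continuous_on {0..1} \<phi>" unfolding \<phi>_def by (intro continuous_intros cp)
    have v: "vector [x $ 1, x $ 2, s] = x + s *\<^sub>R axis 3 (1::real)" for s
      using x by (simp add: vec_eq_iff forall_3 axis_def)
    have z: "zint g (x + r *\<^sub>R axis 3 1) = integral {0..r} (\<lambda>s. g (x + s *\<^sub>R axis 3 1))" for g r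
    proof -
      have "(x + r *\<^sub>R axis 3 1) $ 1 = x $ 1" "(x + r *\<^sub>R axis 3 1) $ 2 = x $ 2" "(x + r *\<^sub>R axis 3 1) $ 3 = r"
        using x by (auto simp: axis_def)
      then show ?thesis unfolding zint_def by (simp only: v)
    qed
    have N_le: "?N (x + r *\<^sub>R axis 3 1) \<le> integral {0..r} \<phi>" if "r \<in> {0..1}" for r
      unfolding z \<phi>_def
      by (rule sqrt_sum_integral_le; rule continuous_on_subset[OF cp]) (use that in auto)
    have cI: "continuous_on {0..1} (\<lambda>r. integral {0..r} \<phi>)"
      using integral_has_vector_derivative[OF c\<phi>] by (rule continuous_on_vector_derivative)
    have "integral {0..1} (\<lambda>r. ?N (x + r *\<^sub>R axis 3 1) ^ 3) \<le> integral {0..1} (\<lambda>r. (integral {0..r} \<phi>) ^ 3)"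
    proof (rule integral_le)
      show "?N (x + r *\<^sub>R axis 3 1) ^ 3 \<le> (integral {0..r} \<phi>) ^ 3" if "r \<in> {0..1}" for r
        by (intro power_mono N_le that) simp
    qed (intro integrable_continuous_real continuous_intros cz cI)+
    also have "\<dots> \<le> b3 ^ 3 * integral {0..1} (\<lambda>r. \<phi> r ^ 3)"
      by (rule Hardy3[OF c\<phi>]) (simp add: \<phi>_def)
    finally have le: "integral {0..1} (\<lambda>r. ?N (x + r *\<^sub>R axis 3 1) ^ 3) \<le> b3 ^ 3 * integral {0..1} (\<lambda>r. \<phi> r ^ 3)" .
    have "((\<lambda>r. b3 ^ 3 * \<phi> r ^ 3 - ?N (x + r *\<^sub>R axis 3 1) ^ 3) has_integral
        b3 ^ 3 * integral {0..1} (\<lambda>r. \<phi> r ^ 3) - integral {0..1} (\<lambda>r. ?N (x + r *\<^sub>R axis 3 1) ^ 3)) {0..1}"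
      by (intro has_integral_diff has_integral_mult_right integrable_integral integrable_continuous_real
          continuous_intros c\<phi> cz)
    then show "0 \<le> integral {(0::real^3) $ 3..(vector [Lx, Ly, 1] :: real^3) $ 3}
        (\<lambda>r. b3 ^ 3 * ?m (x + r *\<^sub>R axis 3 1) ^ 3 - ?N (x + r *\<^sub>R axis 3 1) ^ 3)"
      using le by (simp add: \<phi>_def integral_unique)
  qed (use c in \<open>simp add: cell_def\<close>)
  also have "\<dots> = b3 ^ 3 * J (\<lambda>x. ?m x ^ 3) - J (\<lambda>x. ?N x ^ 3)"
    by (subst J_diff) (auto intro!: continuous_intros cN cm simp: J_cmult)
  finally have "J (\<lambda>x. ?N x ^ 3) \<le> b3 ^ 3 * J (\<lambda>x. ?m x ^ 3)" by simp
  moreover have "J (\<lambda>x. norm (grad_xy (zint f) x) ^ 3) = J (\<lambda>x. ?N x ^ 3)"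
    by (rule J_cong) (simp add: gr[OF cell_strip] norm_vector2)
  ultimately show "J (\<lambda>x. norm (grad_xy (zint f) x) ^ 3) \<le> b3 ^ 3 * J (\<lambda>x. ?m x ^ 3)" by simp
qed

end

section \<open>The gradient of the advection term, and the estimate at a fixed time\<close>

lemma norm_inner_rows_le:
  fixes A :: "real^'n^'m::finite" and b :: "real^'n"
  shows "norm (\<chi> i. A $ i \<bullet> b) \<le> norm A * norm b"
proof -
  have "norm (\<chi> i. A $ i \<bullet> b) = L2_set (\<lambda>i. \<bar>A $ i \<bullet> b\<bar>) UNIV" by (simp add: norm_vec_def)
  also have "\<dots> \<le> L2_set (\<lambda>i. norm (A $ i) * norm b) UNIV"
    by (intro L2_set_mono Cauchy_Schwarz_ineq2) auto
  also have "\<dots> = norm A * norm b" by (simp add: norm_vec_def[of A] L2_set_left_distrib)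
  finally show ?thesis .
qed

lemma enn_powr_half: "0 \<le> a \<Longrightarrow> enn_powr (ennreal a) (1 / 2) = ennreal (sqrt a)"
  by (simp add: enn_powr_def powr_half_sqrt)

lemma continuous_on_grad: "smooth_on strip f \<Longrightarrow> continuous_on strip (grad f)"
  unfolding grad_def by (intro continuous_on_vec_lambda smooth_on_continuous smooth_on_pd)

lemma norm_grad_sq: "(norm (grad f x))\<^sup>2 = (\<Sum>i\<in>UNIV. (norm (pd i f x))\<^sup>2)"
  by (simp add: norm_vec_def L2_set_def grad_def real_sqrt_pow2 sum_nonneg)

context period_cell
begin

lemma J_mono_AE:
  assumes f: "continuous_on (cell Lx Ly) f" and g: "continuous_on (cell Lx Ly) g"
    and le: "AE x in lebesgue_on (cell Lx Ly). f x \<le> g x"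
  shows "J f \<le> J g"
proof -
  have i: "integrable (lebesgue_on (cell Lx Ly)) h" if "continuous_on (cell Lx Ly) h" for h :: "real^3 \<Rightarrow> real"
    using that unfolding cell_def by (rule continuous_imp_integrable)
  have e: "J h = integral\<^sup>L (lebesgue_on (cell Lx Ly)) h" if "continuous_on (cell Lx Ly) h" for h
    unfolding J_def by (rule lebesgue_integral_eq_integral[OF i[OF that], symmetric]) (simp add: cell_def)
  show ?thesis unfolding e[OF f] e[OF g] by (rule integral_mono_AE[OF i[OF f] i[OF g] le])
qed

lemma cont_cell2: "continuous_on strip f \<Longrightarrow> continuous_on (cell Lx Ly) f"
  using continuous_on_subset cell_subset_strip by blast

lemma Lp_norm_J:
  fixes f :: "real^3 \<Rightarrow> 'b::real_normed_vector"
  assumes "continuous_on strip f"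
  shows "Lp_norm 2 (cell Lx Ly) f = ennreal (sqrt (J (\<lambda>x. (norm (f x))\<^sup>2)))"
    "Lp_norm 3 (cell Lx Ly) f = ennreal (root 3 (J (\<lambda>x. norm (f x) ^ 3)))"
    "Lp_norm 6 (cell Lx Ly) f = ennreal (root 6 (J (\<lambda>x. norm (f x) ^ 6)))"
  using Lp_norm_root[OF cont_cell2[OF assms, unfolded cell_def], of 2]
    Lp_norm_root[OF cont_cell2[OF assms, unfolded cell_def], of 3]
    Lp_norm_root[OF cont_cell2[OF assms, unfolded cell_def], of 6]
  by (simp_all add: J_def cell_def sqrt_def)

lemma J_norm_grad: "smooth_on strip f \<Longrightarrow> J (\<lambda>x. (norm (grad f x))\<^sup>2) = grad2 f" for f :: "real^3 \<Rightarrow> real"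
  unfolding norm_grad_sq grad2_def real_norm_def power2_abs
  by (intro J_sum cont_cell smooth_intros) simp_all

definition H1 :: "(real^3 \<Rightarrow> real) \<Rightarrow> real" where
  "H1 f = sqrt (J (\<lambda>x. (f x)\<^sup>2) + grad2 f)"

lemma J_sq_nonneg: "smooth_on strip f \<Longrightarrow> 0 \<le> J (\<lambda>x. (f x)\<^sup>2)" for f :: "real^3 \<Rightarrow> real"
  by (intro J_nonneg cont_cell smooth_intros) auto

lemma H1_norm_eq:
  assumes f: "smooth_on strip f"
    and 1: "Lp_norm 2 (cell Lx Ly) g = Lp_norm 2 (cell Lx Ly) f"
    and 2: "Lp_norm 2 (cell Lx Ly) (wgrad g) = Lp_norm 2 (cell Lx Ly) (grad f)"
  shows "H1_norm (cell Lx Ly) g = ennreal (H1 f)"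
proof -
  note n = J_sq_nonneg[OF f] grad2_nonneg[OF f]
  have "(Lp_norm 2 (cell Lx Ly) g)\<^sup>2 + (Lp_norm 2 (cell Lx Ly) (wgrad g))\<^sup>2 =
      ennreal (J (\<lambda>x. (f x)\<^sup>2) + grad2 f)"
    unfolding 1 2 Lp_norm_J(1)[OF smooth_on_continuous[OF f]] Lp_norm_J(1)[OF continuous_on_grad[OF f]]
      J_norm_grad[OF f] using n by (simp add: ennreal_power flip: ennreal_plus)
  then show ?thesis unfolding H1_norm_def H1_def using n by (simp only: enn_powr_half add_nonneg_nonneg)
qed

lemma J_sum_Cauchy_Schwarz:
  assumes "\<And>i. i \<in> UNIV \<Longrightarrow> continuous_on (cell Lx Ly) (f i)" "\<And>i. i \<in> UNIV \<Longrightarrow> continuous_on (cell Lx Ly) (g i)"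
  shows "(\<Sum>i\<in>(UNIV::'n::finite set). J (\<lambda>x. f i x * g i x)) \<le>
    sqrt (\<Sum>i\<in>UNIV. J (\<lambda>x. (f i x)\<^sup>2)) * sqrt (\<Sum>i\<in>UNIV. J (\<lambda>x. (g i x)\<^sup>2))"
proof -
  have nn: "0 \<le> J (\<lambda>x. (f i x)\<^sup>2)" "0 \<le> J (\<lambda>x. (g i x)\<^sup>2)" for i
    using assms by (auto intro!: J_nonneg continuous_intros)
  have "(\<Sum>i\<in>(UNIV::'n set). J (\<lambda>x. f i x * g i x)) \<le>
      (\<Sum>i\<in>UNIV. \<bar>sqrt (J (\<lambda>x. (f i x)\<^sup>2))\<bar> * \<bar>sqrt (J (\<lambda>x. (g i x)\<^sup>2))\<bar>)"
    using J_Cauchy_Schwarz[OF assms] nn by (intro sum_mono) (auto intro: order_trans[OF abs_ge_self])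
  also have "\<dots> \<le> L2_set (\<lambda>i. sqrt (J (\<lambda>x. (f i x)\<^sup>2))) UNIV * L2_set (\<lambda>i. sqrt (J (\<lambda>x. (g i x)\<^sup>2))) UNIV"
    by (rule L2_set_mult_ineq)
  finally show ?thesis using nn by (simp add: L2_set_def)
qed

text \<open>The H^1 norm is a Euclidean norm built from L^2 norms: Minkowski for each component,
  then the Euclidean triangle inequality, once over the three derivatives and once over the pair
  formed by function and gradient.\<close>

lemma H1_triangle:
  assumes f: "smooth_on strip f" and g: "smooth_on strip g"
  shows "H1 (\<lambda>x. f x - g x) \<le> H1 f + H1 g"
proof -
  have mink: "sqrt (J (\<lambda>x. (h x - k x)\<^sup>2)) \<le> sqrt (J (\<lambda>x. (h x)\<^sup>2)) + sqrt (J (\<lambda>x. (k x)\<^sup>2))"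
    if "smooth_on strip h" "smooth_on strip k" for h k
    using integral_Minkowski[of 0 "vector [Lx, Ly, 1]" h "\<lambda>x. - k x"] cont_cell[OF that(1)] cont_cell[OF that(2)]
    by (simp add: J_def cell_def continuous_on_minus)
  note fg = smooth_on_diff[OF f g]
  let ?n = "\<lambda>h. sqrt (J (\<lambda>x. (h x)\<^sup>2))"
  have G: "sqrt (grad2 h) = L2_set (\<lambda>i. ?n (pd i h)) UNIV" if "smooth_on strip h" for h
    using J_sq_nonneg[OF smooth_on_pd[OF that]] by (simp add: grad2_def L2_set_def)
  have "sqrt (grad2 (\<lambda>x. f x - g x)) \<le> L2_set (\<lambda>i. ?n (pd i f) + ?n (pd i g)) UNIV"
    unfolding G[OF fg]
  proof (rule L2_set_mono)
    fix i
    have "J (\<lambda>x. (pd i (\<lambda>x. f x - g x) x)\<^sup>2) = J (\<lambda>x. (pd i f x - pd i g x)\<^sup>2)"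
      by (rule J_cong) (simp add: pd_diff[OF f g cell_strip])
    then show "?n (pd i (\<lambda>x. f x - g x)) \<le> ?n (pd i f) + ?n (pd i g)"
      using mink[OF smooth_on_pd[OF f] smooth_on_pd[OF g]] by simp
  qed (use J_sq_nonneg[OF smooth_on_pd[OF fg]] in auto)
  also have "\<dots> \<le> sqrt (grad2 f) + sqrt (grad2 g)"
    unfolding G[OF f] G[OF g] by (rule L2_set_triangle_ineq)
  finally have 1: "sqrt (grad2 (\<lambda>x. f x - g x)) \<le> sqrt (grad2 f) + sqrt (grad2 g)" .
  have H: "H1 h = sqrt ((?n h)\<^sup>2 + (sqrt (grad2 h))\<^sup>2)" if "smooth_on strip h" for h
    using J_sq_nonneg[OF that] grad2_nonneg[OF that] by (simp add: H1_def)
  have "H1 (\<lambda>x. f x - g x) \<le> sqrt ((?n f + ?n g)\<^sup>2 + (sqrt (grad2 f) + sqrt (grad2 g))\<^sup>2)"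
    unfolding H[OF fg]
    by (intro real_sqrt_le_mono add_mono power_mono mink f g 1)
      (use J_sq_nonneg[OF fg] grad2_nonneg[OF fg] in auto)
  also have "\<dots> \<le> H1 f + H1 g"
    unfolding H[OF f] H[OF g] by (rule real_sqrt_sum_squares_triangle_ineq)
  finally show ?thesis .
qed

definition advect :: "(real^3 \<Rightarrow> real^3) \<Rightarrow> (real^3 \<Rightarrow> real) \<Rightarrow> real^3 \<Rightarrow> real" where
  "advect v f x = (\<Sum>j\<in>UNIV. v x $ j * pd j f x)"

lemma smooth_on_advect [smooth_intros]: "smooth_on strip v \<Longrightarrow> smooth_on strip f \<Longrightarrow> smooth_on strip (advect v f)"
  unfolding advect_def[abs_def] by (intro smooth_intros)

text \<open>The instantaneous counterpart of \<open>U_infty\<close>, with the norms at one time in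
  place of their upper limits.\<close>

definition speed :: "real \<Rightarrow> real \<Rightarrow> (real^3 \<Rightarrow> real^3) \<Rightarrow> real" where
  "speed Cinf CS0 v = CS0 * root 3 (J (\<lambda>x. norm (v x) ^ 3)) + Cinf * sqrt (J (\<lambda>x. (norm (grad v x))\<^sup>2))"

text \<open>The product rule splits the gradient of v . grad f into (grad v) grad f, estimated by
  L^2 times L^\<infinity>, and the Hessian of f applied to v, estimated by L^6 times L^3. Both norms
  of f are controlled by the H^1 norm of its Laplacian through the elliptic constants.\<close>

lemma grad_advect_le:
  assumes C: "sobolev_elliptic_consts Lx Ly Cinf CS0"
    and f: "smooth_on strip f" "periodic_xy Lx Ly f" "\<forall>x\<in>walls. f x = 0"
    and v: "smooth_on strip v"
  shows "sqrt (grad2 (advect v f)) \<le> speed Cinf CS0 v * H1 (laplacian f)"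
proof -
  define He where "He x = (\<chi> i j. pd i (pd j f) x :: real^3^3)" for x
  have pos: "0 < Cinf" "0 < CS0" using C by (auto simp: sobolev_elliptic_consts_def)
  have lap: "smooth_on strip (laplacian f)" by (intro smooth_intros f)
  note sq = Sobolev_quantities_smooth[OF f(1), where Lx = Lx and Ly = Ly, folded He_def]
  have H1l: "H1_norm (cell Lx Ly) (wlaplacian f) = ennreal (H1 (laplacian f))"
    by (rule H1_norm_eq[OF lap sq(3,4)])
  have H0: "0 \<le> H1 (laplacian f)"
    unfolding H1_def using J_sq_nonneg[OF lap] grad2_nonneg[OF lap] by simp
  have "H3_wall Lx Ly f"
    unfolding H3_wall_def using f H_per_smooth smooth_on_continuous by blast
  then have inf: "Linf_norm (cell Lx Ly) (wgrad f) \<le> ennreal Cinf * ennreal (H1 (laplacian f))"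
    and six: "Lp_norm 6 (cell Lx Ly) (whessian f) \<le> ennreal CS0 * ennreal (H1 (laplacian f))"
    using C H1l by (auto simp: sobolev_elliptic_consts_def)
  have cHe: "continuous_on strip He"
    unfolding He_def[abs_def] by (intro continuous_on_vec_lambda smooth_on_continuous smooth_intros f)
  have cg: "continuous_on strip (grad f)" "continuous_on strip (grad v)"
    using continuous_on_grad f(1) v by auto
  have cv: "continuous_on strip v" by (rule smooth_on_continuous[OF v])
  define c where "c = Cinf * H1 (laplacian f)"
  have c0: "0 \<le> c" using pos H0 by (simp add: c_def)
  \<comment> \<open>The L^\<infinity> norm is an essential supremum, so the gradient bound holds
    only almost everywhere at this point; this suffices for comparing integrals.\<close>
  have "AE x in lebesgue_on (cell Lx Ly). ennreal (norm (wgrad f x)) \<le> Linf_norm (cell Lx Ly) (wgrad f)"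
    unfolding Linf_norm_def by (rule esssup_AE)
  then have bound: "AE x in lebesgue_on (cell Lx Ly). norm (grad f x) \<le> c"
    using sq(1)
  proof eventually_elim
    case (elim x)
    then have "ennreal (norm (grad f x)) \<le> ennreal c"
      using order_trans[OF _ inf] pos H0 by (simp add: c_def ennreal_mult)
    then show ?case using c0 by simp
  qed
  let ?p = "\<lambda>x. norm (grad v x) * norm (grad f x)" and ?q = "\<lambda>x. norm (v x) * norm (He x)"
  have cp: "continuous_on (cell Lx Ly) ?p" "continuous_on (cell Lx Ly) ?q"
    by (intro continuous_intros cont_cell2 cg cv cHe)+
  have "sqrt (J (\<lambda>x. (?p x)\<^sup>2)) \<le> sqrt (J (\<lambda>x. c\<^sup>2 * (norm (grad v x))\<^sup>2))"
  proof (intro real_sqrt_le_mono J_mono_AE continuous_intros cont_cell2 cg)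
    show "AE x in lebesgue_on (cell Lx Ly). (?p x)\<^sup>2 \<le> c\<^sup>2 * (norm (grad v x))\<^sup>2"
      using bound
    proof eventually_elim
      case (elim x)
      then have "(norm (grad f x))\<^sup>2 \<le> c\<^sup>2" by (intro power_mono) auto
      then show ?case by (simp add: power_mult_distrib mult.commute[of "(norm (grad v x))\<^sup>2"] mult_right_mono)
    qed
  qed
  also have "\<dots> = c * sqrt (J (\<lambda>x. (norm (grad v x))\<^sup>2))"
    using c0 by (simp add: J_cmult real_sqrt_mult)
  finally have P: "sqrt (J (\<lambda>x. (?p x)\<^sup>2)) \<le> Cinf * sqrt (J (\<lambda>x. (norm (grad v x))\<^sup>2)) * H1 (laplacian f)"
    by (simp add: c_def mult_ac)
  let ?A = "J (\<lambda>x. norm (v x) ^ 3)" and ?B = "J (\<lambda>x. norm (He x) ^ 6)"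
  have A0: "0 \<le> ?A" and B0: "0 \<le> ?B"
    by (intro J_nonneg continuous_intros cont_cell2 cv cHe; simp)+
  have Q0: "0 \<le> J (\<lambda>x. (?q x)\<^sup>2)" by (intro J_nonneg continuous_intros cp) simp
  have "(J (\<lambda>x. (?q x)\<^sup>2)) ^ 3 \<le> ?A\<^sup>2 * ?B"
    unfolding J_def cell_def
    by (rule integral_Holder_3_6) (use cont_cell2[OF cv] cont_cell2[OF cHe] in \<open>auto simp: cell_def intro!: continuous_intros\<close>)
  moreover have "(sqrt (J (\<lambda>x. (?q x)\<^sup>2))) ^ 6 = (J (\<lambda>x. (?q x)\<^sup>2)) ^ 3"
    using power_mult[of "sqrt (J (\<lambda>x. (?q x)\<^sup>2))" 2 3] Q0 by simp
  moreover have "(root 3 ?A * root 6 ?B) ^ 6 = ?A\<^sup>2 * ?B"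
    using power_mult[of "root 3 ?A" 3 2] A0 B0 by (simp add: power_mult_distrib)
  ultimately have "(sqrt (J (\<lambda>x. (?q x)\<^sup>2))) ^ 6 \<le> (root 3 ?A * root 6 ?B) ^ 6" by simp
  then have "sqrt (J (\<lambda>x. (?q x)\<^sup>2)) \<le> root 3 ?A * root 6 ?B"
    using Q0 A0 B0 by (subst (asm) power_mono_iff) auto
  also have "\<dots> \<le> root 3 ?A * (CS0 * H1 (laplacian f))"
  proof (rule mult_left_mono)
    have "ennreal (root 6 ?B) \<le> ennreal (CS0 * H1 (laplacian f))"
      using six pos H0 unfolding sq(2) Lp_norm_J(3)[OF cHe] by (simp add: ennreal_mult)
    then show "root 6 ?B \<le> CS0 * H1 (laplacian f)" using pos H0 by simp
  qed (use A0 in simp)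
  finally have Q: "sqrt (J (\<lambda>x. (?q x)\<^sup>2)) \<le> CS0 * root 3 ?A * H1 (laplacian f)" by (simp add: mult_ac)
  have pt: "(norm (grad (advect v f) x))\<^sup>2 \<le> (?p x + ?q x)\<^sup>2" if x: "x \<in> cell Lx Ly" for x
  proof -
    note x = cell_strip[OF x]
    have "pd i (advect v f) x = grad v x $ i \<bullet> grad f x + He x $ i \<bullet> v x" for i
      unfolding advect_def[abs_def]
      by (subst pd_sum)
        (auto intro!: smooth_intros f v x simp: pd_mult smooth_intros f v x pd_nth grad_def He_def inner_vec_def
          sum.distrib[symmetric] algebra_simps)
    then have "grad (advect v f) x = (\<chi> i. grad v x $ i \<bullet> grad f x) + (\<chi> i. He x $ i \<bullet> v x)"
      by (simp add: grad_def[of "advect v f"] vec_eq_iff)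
    then have "norm (grad (advect v f) x) \<le> norm (\<chi> i. grad v x $ i \<bullet> grad f x) + norm (\<chi> i. He x $ i \<bullet> v x)"
      by (simp add: norm_triangle_ineq)
    also have "\<dots> \<le> ?p x + ?q x"
      using norm_inner_rows_le[of "grad v x" "grad f x"] norm_inner_rows_le[of "He x" "v x"]
      by (simp add: mult.commute)
    finally show ?thesis by (intro power_mono) auto
  qed
  have a: "smooth_on strip (advect v f)" by (intro smooth_intros f v)
  have "sqrt (grad2 (advect v f)) \<le> sqrt (J (\<lambda>x. (?p x + ?q x)\<^sup>2))"
    unfolding J_norm_grad[OF a, symmetric]
    by (intro real_sqrt_le_mono J_mono pt continuous_intros cp cont_cell2 continuous_on_grad a)
  also have "\<dots> \<le> sqrt (J (\<lambda>x. (?p x)\<^sup>2)) + sqrt (J (\<lambda>x. (?q x)\<^sup>2))"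
    using cp unfolding J_def cell_def by (rule integral_Minkowski)
  also have "\<dots> \<le> speed Cinf CS0 v * H1 (laplacian f)"
    using P Q by (simp add: speed_def distrib_right)
  finally show ?thesis .
qed

lemma J_weighted_Cauchy_Schwarz:
  assumes "continuous_on (cell Lx Ly) h" "continuous_on (cell Lx Ly) p" "continuous_on (cell Lx Ly) q"
    and "\<And>x. 0 \<le> p x" "\<And>x. 0 \<le> q x" "\<And>x. (h x)\<^sup>2 \<le> p x * q x"
  shows "(J h)\<^sup>2 \<le> J p * J q"
  using integral_weighted_Cauchy_Schwarz[of 0 "vector [Lx, Ly, 1]" h p q 1] assms
  by (simp add: J_def cell_def)

text \<open>Interpolation of the horizontal gradient between L^2 and L^6, preceded by the Hardy
  inequality. The norms of f and its Laplacian enter through upper bounds m and d, since later only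
  eventual bounds are known.\<close>

lemma static_estimate:
  assumes f: "smooth_on strip f" "periodic_xy Lx Ly f" "\<forall>x\<in>walls. f x = 0"
    and m: "sqrt (J (\<lambda>x. (f x)\<^sup>2)) \<le> m" and d: "sqrt (J (\<lambda>x. (laplacian f x)\<^sup>2)) \<le> d"
  shows "Lp_norm 3 (cell Lx Ly) (grad_xy (zint f)) \<le>
    ennreal (b3 * CS Lx Ly powr (1 / 2) * m powr (1 / 4) * d powr (3 / 4))"
proof -
  let ?t = "\<lambda>x. (pd 1 f x)\<^sup>2 + (pd 2 f x)\<^sup>2"
  have t: "smooth_on strip ?t" by (intro smooth_intros f)
  have st: "continuous_on (cell Lx Ly) (\<lambda>x. sqrt (?t x))" by (intro continuous_intros cont_cell t)
  have lap: "smooth_on strip (laplacian f)" by (intro smooth_intros f)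
  have m0: "0 \<le> m" using m J_sq_nonneg[OF f(1)] by (meson order_trans real_sqrt_ge_zero)
  have d0: "0 \<le> d" using d J_sq_nonneg[OF lap] by (meson order_trans real_sqrt_ge_zero)
  have CS: "0 < CS Lx Ly"
  proof (rule less_le_trans[OF _ CS_lower_bound[OF Lx Ly]])
    show "0 < 2 / sqrt 3 * (1 + sqrt (1 / Lx\<^sup>2 + 1 / Ly\<^sup>2) / pi)"
      by (intro mult_pos_pos add_pos_nonneg) auto
  qed
  have b3: "0 < b3" by (simp add: b3_def sin_60)
  define X where "X = J (\<lambda>x. sqrt (?t x) ^ 3)"
  have X0: "0 \<le> X" unfolding X_def by (intro J_nonneg continuous_intros st) simp
  have Y0: "0 \<le> J (\<lambda>x. (?t x)\<^sup>2)" by (intro J_sq_nonneg t)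
  have M0: "0 \<le> J ?t" by (intro J_nonneg cont_cell t) simp
  have F0: "0 \<le> J (\<lambda>x. ?t x ^ 3)" by (intro J_nonneg cont_cell smooth_intros t) simp
  have 1: "X\<^sup>2 \<le> J ?t * J (\<lambda>x. (?t x)\<^sup>2)"
    unfolding X_def
  proof (rule J_weighted_Cauchy_Schwarz)
    show "(sqrt (?t x) ^ 3)\<^sup>2 \<le> ?t x * (?t x)\<^sup>2" for x
    proof -
      have "(sqrt (?t x) ^ 3)\<^sup>2 = ((sqrt (?t x))\<^sup>2) ^ 3" by (simp only: power_mult[symmetric] mult.commute)
      also have "\<dots> = ?t x ^ 3" by (subst real_sqrt_pow2) auto
      finally show ?thesis by (simp only: power2_eq_square power3_eq_cube mult.assoc order_refl)
    qed
  qed (use st cont_cell[OF t] in \<open>auto intro: continuous_on_power\<close>)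
  have 2: "(J (\<lambda>x. (?t x)\<^sup>2))\<^sup>2 \<le> J ?t * J (\<lambda>x. ?t x ^ 3)"
  proof (rule J_weighted_Cauchy_Schwarz)
    show "((?t x)\<^sup>2)\<^sup>2 \<le> ?t x * ?t x ^ 3" for x
      by (simp only: power2_eq_square power3_eq_cube mult.assoc order_refl)
  qed (use st cont_cell[OF t] in \<open>auto intro: continuous_on_power\<close>)
  have 3: "J (\<lambda>x. ?t x ^ 3) \<le> ((CS Lx Ly)\<^sup>2 * d\<^sup>2) ^ 3"
  proof -
    have "J (\<lambda>x. ?t x ^ 3) \<le> ((CS Lx Ly)\<^sup>2 * (grad2 (pd 1 f) + grad2 (pd 2 f))) ^ 3"
      by (intro Gagliardo_Nirenberg_6 smooth_intros periodic_pd f) (use pd_zero_walls[OF f(1,3)] in auto)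
    also have "\<dots> \<le> ((CS Lx Ly)\<^sup>2 * d\<^sup>2) ^ 3"
    proof (intro power_mono mult_left_mono)
      have "J (\<lambda>x. (laplacian f x)\<^sup>2) \<le> d\<^sup>2" using d by (rule sqrt_le_D)
      then show "grad2 (pd 1 f) + grad2 (pd 2 f) \<le> d\<^sup>2" using horizontal_Hessian_le[OF f] by linarith
    qed (use grad2_nonneg[OF smooth_on_pd[OF f(1)]] in auto)
    finally show ?thesis .
  qed
  have 4: "J ?t \<le> m * d"
  proof -
    have "J ?t = J (\<lambda>x. (pd 1 f x)\<^sup>2) + J (\<lambda>x. (pd 2 f x)\<^sup>2)" by (intro J_add cont_cell smooth_intros f)
    also have "\<dots> \<le> grad2 f" using J_sq_nonneg[OF smooth_on_pd[OF f(1)]] by (simp add: grad2_def sum_3)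
    also have "\<dots> \<le> sqrt (J (\<lambda>x. (f x)\<^sup>2)) * sqrt (J (\<lambda>x. (laplacian f x)\<^sup>2))" by (rule grad2_le[OF f])
    also have "\<dots> \<le> m * d" using m d m0 J_sq_nonneg[OF lap] by (intro mult_mono) auto
    finally show ?thesis .
  qed
  \<comment> \<open>With \<open>?t\<close> the squared length of the horizontal gradient, 1 and 2
    combine to X^4 \<le> (J t)^3 J(t^3), that is, the twelfth power of the L^3 norm is at most the
    sixth power of the L^2 norm times that of the L^6 norm.\<close>
  have "X ^ 4 = (X\<^sup>2)\<^sup>2" by (simp flip: power_mult)
  also have "\<dots> \<le> (J ?t * J (\<lambda>x. (?t x)\<^sup>2))\<^sup>2" using 1 by (intro power_mono) auto
  also have "\<dots> \<le> (J ?t)\<^sup>2 * (J ?t * J (\<lambda>x. ?t x ^ 3))"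
    unfolding power_mult_distrib using 2 by (intro mult_left_mono) auto
  also have "\<dots> \<le> (m * d)\<^sup>2 * ((m * d) * ((CS Lx Ly)\<^sup>2 * d\<^sup>2) ^ 3)"
    using 3 4 M0 F0 m0 d0 by (intro mult_mono power_mono) auto
  finally have X4: "X ^ 4 \<le> (m * d)\<^sup>2 * ((m * d) * ((CS Lx Ly)\<^sup>2 * d\<^sup>2) ^ 3)" .
  define R where "R = CS Lx Ly powr (1 / 2) * m powr (1 / 4) * d powr (3 / 4)"
  \<comment> \<open>The twelfth power turns all exponents in R into integers; the case y = 0 is
    separate because of \<open>powr\<close>.\<close>
  have p12: "(y powr (1 / 4)) ^ 12 = y ^ 3" "(y powr (3 / 4)) ^ 12 = y ^ 9" "(y powr (1 / 2)) ^ 12 = y ^ 6"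
    if "0 \<le> y" for y :: real
    using that by (cases "y = 0"; auto simp: powr_power powr_numeral)+
  have "(R ^ 3) ^ 4 = R ^ 12" by (simp flip: power_mult)
  also have "\<dots> = (m * d)\<^sup>2 * ((m * d) * ((CS Lx Ly)\<^sup>2 * d\<^sup>2) ^ 3)"
    unfolding R_def power_mult_distrib using m0 d0 CS
    by (simp add: p12) (simp add: power_numeral_reduce algebra_simps)
  finally have "X ^ 4 \<le> (R ^ 3) ^ 4" using X4 by simp
  then have X: "X \<le> R ^ 3"
    using X0 by (subst (asm) power_mono_iff) (auto simp: R_def)
  have R0: "0 \<le> R" by (simp add: R_def)
  have "root 3 (J (\<lambda>x. norm (grad_xy (zint f) x) ^ 3)) \<le> root 3 ((b3 * R) ^ 3)"
  proof (intro real_root_le_mono)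
    have "J (\<lambda>x. norm (grad_xy (zint f) x) ^ 3) \<le> b3 ^ 3 * X"
      using Hardy_cell(1)[OF f(1)] by (simp add: X_def)
    also have "\<dots> \<le> b3 ^ 3 * R ^ 3" using X b3 by (intro mult_left_mono) auto
    finally show "J (\<lambda>x. norm (grad_xy (zint f) x) ^ 3) \<le> (b3 * R) ^ 3" by (simp add: power_mult_distrib)
  qed simp
  also have "\<dots> = b3 * R" using b3 R0 by (intro real_root_power_cancel) auto
  finally have "root 3 (J (\<lambda>x. norm (grad_xy (zint f) x) ^ 3)) \<le> b3 * R" .
  moreover have "Lp_norm 3 (cell Lx Ly) (grad_xy (zint f)) = ennreal (root 3 (J (\<lambda>x. norm (grad_xy (zint f) x) ^ 3)))"
    using Lp_norm_root[OF Hardy_cell(2)[OF f(1), unfolded cell_def], of 3] by (simp add: J_def cell_def)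
  ultimately show ?thesis by (simp add: R_def ennreal_leI mult.assoc)
qed

end

section \<open>From the cell to the strip, and integrals depending on time\<close>

lemma (in period_cell) periodic_integer_shift:
  assumes p: "periodic_xy Lx Ly f" and x: "x \<in> strip"
  shows "f (x + (of_int m * Lx) *\<^sub>R axis 1 1 + (of_int n * Ly) *\<^sub>R axis 2 1) = f x"
proof -
  have ax: "axis 1 Lx = Lx *\<^sub>R axis 1 (1::real)" "axis 2 Ly = Ly *\<^sub>R axis 2 (1::real)"
    by (auto simp: vec_eq_iff axis_def)
  have st: "y + c *\<^sub>R axis 1 1 \<in> strip" "y + c *\<^sub>R axis 2 1 \<in> strip" if "y \<in> strip" for y c
    using axis_strip[OF that] by auto
  have P: "f (y + Lx *\<^sub>R axis 1 1) = f y" "f (y + Ly *\<^sub>R axis 2 1) = f y" if "y \<in> strip" for y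
    using p that unfolding periodic_xy_def ax by auto
  have X: "f (y + (of_int m * Lx) *\<^sub>R axis 1 1) = f y" if y: "y \<in> strip" for y m
  proof (induction m rule: int_induct[where k = 0])
    case (step1 i)
    then show ?case using P(1)[OF st(1)[OF y, of "of_int i * Lx"]] by (simp add: algebra_simps)
  next
    case (step2 i)
    then show ?case using P(1)[OF st(1)[OF y, of "of_int (i - 1) * Lx"]] by (simp add: algebra_simps)
  qed simp
  have Y: "f (y + (of_int n * Ly) *\<^sub>R axis 2 1) = f y" if y: "y \<in> strip" for y n
  proof (induction n rule: int_induct[where k = 0])
    case (step1 i)
    then show ?case using P(2)[OF st(2)[OF y, of "of_int i * Ly"]] by (simp add: algebra_simps)
  next
    case (step2 i)
    then show ?case using P(2)[OF st(2)[OF y, of "of_int (i - 1) * Ly"]] by (simp add: algebra_simps)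
  qed simp
  show ?thesis using Y[OF st(1)[OF x]] X[OF x] by simp
qed

lemma (in period_cell) periodic_eq_on_strip:
  assumes f: "periodic_xy Lx Ly f" and g: "periodic_xy Lx Ly g"
    and eq: "\<And>x. x \<in> cell Lx Ly \<Longrightarrow> f x = g x" and x: "x \<in> strip"
  shows "f x = g x"
proof -
  define m n where "m = - \<lfloor>x $ 1 / Lx\<rfloor>" and "n = - \<lfloor>x $ 2 / Ly\<rfloor>"
  define y where "y = x + (of_int m * Lx) *\<^sub>R axis 1 1 + (of_int n * Ly) *\<^sub>R axis 2 1"
  have red: "0 \<le> c - of_int \<lfloor>c / L\<rfloor> * L \<and> c - of_int \<lfloor>c / L\<rfloor> * L \<le> L" if "0 < L" for c L :: real
  proof -
    have "of_int \<lfloor>c / L\<rfloor> * L \<le> c / L * L" using that by (intro mult_right_mono) auto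
    moreover have "c / L * L \<le> (of_int \<lfloor>c / L\<rfloor> + 1) * L" using that by (intro mult_right_mono) (auto intro: less_imp_le)
    ultimately show ?thesis using that by (simp add: algebra_simps)
  qed
  have "y $ 1 = x $ 1 - of_int \<lfloor>x $ 1 / Lx\<rfloor> * Lx" "y $ 2 = x $ 2 - of_int \<lfloor>x $ 2 / Ly\<rfloor> * Ly" "y $ 3 = x $ 3"
    by (auto simp: y_def m_def n_def axis_def)
  then have "y \<in> cell Lx Ly"
    using red[OF Lx, of "x $ 1"] red[OF Ly, of "x $ 2"] x by (simp add: mem_cell strip_def)
  then have "f y = g y" by (rule eq)
  then show ?thesis
    using periodic_integer_shift[OF f x, of m n] periodic_integer_shift[OF g x, of m n] by (simp add: y_def)
qed

text \<open>The continuous nonnegative function (f - g)^2 has integral 0 over a box with nonempty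
  interior, so it vanishes everywhere in the box.\<close>

lemma (in period_cell) continuous_AE_eq:
  assumes f: "continuous_on (cell Lx Ly) f" and g: "continuous_on (cell Lx Ly) g"
    and eq: "AE x in lebesgue_on (cell Lx Ly). f x = g x" and x: "x \<in> cell Lx Ly"
  shows "f x = (g x :: real)"
proof -
  have c: "continuous_on (cell Lx Ly) (\<lambda>x. (f x - g x)\<^sup>2)" by (intro continuous_intros f g)
  have "J (\<lambda>x. (f x - g x)\<^sup>2) \<le> J (\<lambda>x. 0)"
    by (rule J_mono_AE[OF c]) (use eq in \<open>auto elim!: eventually_mono\<close>)
  then have "integral (cell Lx Ly) (\<lambda>x. (f x - g x)\<^sup>2) = 0"
    using J_nonneg[OF _ c] by (simp add: J_def)
  moreover have "box (0::real^3) (vector [Lx, Ly, 1]) \<noteq> {}"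
  proof -
    have "(\<chi> i. (vector [Lx, Ly, 1] :: real^3) $ i / 2) \<in> box (0::real^3) (vector [Lx, Ly, 1])"
      using Lx Ly by (auto simp: mem_box_cart forall_3)
    then show ?thesis by blast
  qed
  ultimately show ?thesis
    using integral_cbox_eq_0_iff[of 0 "vector [Lx, Ly, 1]" "\<lambda>x. (f x - g x)\<^sup>2"] c x by (simp add: cell_def)
qed

lemma (in period_cell) J_time_derivative:
  assumes F: "smooth_on spacetime F" and t: "0 \<le> t"
  shows "((\<lambda>s. J (\<lambda>x. F (s, x))) has_vector_derivative J (\<lambda>x. dd spacetime (1, 0) F (t, x))) (at t within {0..})"
  unfolding J_def cell_def
proof (rule leibniz_rule_vector_derivative)
  have sub: "{0..} \<times> cbox 0 (vector [Lx, Ly, 1]) \<subseteq> spacetime"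
    using cell_subset_strip by (auto simp: spacetime_def cell_def)
  fix s :: real and x :: "real^3" assume s: "s \<in> {0..}" and x: "x \<in> cbox 0 (vector [Lx, Ly, 1])"
  then show "((\<lambda>s. F (s, x)) has_vector_derivative dd spacetime (1, 0) F (s, x)) (at s within {0..})"
    using slice_time_derivative[OF F, of s x] cell_subset_strip by (auto simp: cell_def)
next
  fix s :: real assume "s \<in> {0..}"
  then show "(\<lambda>x. F (s, x)) integrable_on cbox 0 (vector [Lx, Ly, 1])"
    using cont_cell[OF smooth_on_slice[OF F, of s]] by (simp add: integrable_continuous cell_def)
next
  have "continuous_on spacetime (dd spacetime (1, 0) F)"
    by (intro smooth_on_continuous smooth_on_dd fat_spacetime F)
  then show "continuous_on ({0..} \<times> cbox 0 (vector [Lx, Ly, 1])) (\<lambda>(s, x). dd spacetime (1, 0) F (s, x))"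
    using cell_subset_strip by (auto simp: spacetime_def cell_def intro: continuous_on_subset)
qed (use t in auto)

section \<open>Long-time behaviour of the temperature\<close>

locale convection = period_cell +
  fixes Pe Cinf CS0 :: real
    and u :: "real \<Rightarrow> real^3 \<Rightarrow> real^3" and T :: "real \<Rightarrow> real^3 \<Rightarrow> real" and Q :: "real^3 \<Rightarrow> real"
  assumes Pe: "0 < Pe"
    and sobolev: "sobolev_elliptic_consts Lx Ly Cinf CS0"
    and u: "admissible_velocity Lx Ly u"
    and Q: "H_per 1 Lx Ly Q"
    and T: "temperature_solution Lx Ly Pe Q u T"
begin

definition TT :: "real \<times> (real^3) \<Rightarrow> real" where "TT = (\<lambda>(t, x). T t x)"
definition Tt :: "real \<Rightarrow> real^3 \<Rightarrow> real" where "Tt t x = dd spacetime (1, 0) TT (t, x)"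
text \<open>
  The value of the source forced by the equation at time \<open>t\<close>. It equals \<open>Q\<close> almost everywhere, and
  being continuous it is therefore independent of \<open>t\<close>; \<open>q\<close> is the smooth representative of \<open>Q\<close>.
\<close>

definition src :: "real \<Rightarrow> real^3 \<Rightarrow> real" where
  "src t x = Pe * (Tt t x + advect (u t) (T t) x) - laplacian (T t) x"

abbreviation q :: "real^3 \<Rightarrow> real" where "q \<equiv> src 0"

lemma smooth_TT: "smooth_on spacetime TT"
  using T by (simp add: temperature_solution_def TT_def spacetime_def)

lemma smooth_T [smooth_intros]: "0 \<le> t \<Longrightarrow> smooth_on strip (T t)"
  using smooth_on_slice[OF smooth_TT] by (simp add: TT_def)

lemma smooth_Tt [smooth_intros]: "0 \<le> t \<Longrightarrow> smooth_on strip (Tt t)"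
  using smooth_on_slice[OF smooth_on_dd[OF fat_spacetime smooth_TT]] by (simp add: Tt_def[abs_def])

lemma smooth_u [smooth_intros]: "0 \<le> t \<Longrightarrow> smooth_on strip (u t)"
  using smooth_on_slice[of "\<lambda>(t, x). u t x" t] u by (simp add: admissible_velocity_def spacetime_def)

lemma periodic_T: "0 \<le> t \<Longrightarrow> periodic_xy Lx Ly (T t)"
  using T by (simp add: temperature_solution_def)

lemma wall_T: "0 \<le> t \<Longrightarrow> \<forall>x\<in>walls. T t x = 0"
  using T by (simp add: temperature_solution_def)

lemma periodic_u: "0 \<le> t \<Longrightarrow> periodic_xy Lx Ly (\<lambda>x. u t x $ i)"
  using u by (simp add: admissible_velocity_def periodic_xy_def)

lemma Tt_derivative: "0 \<le> t \<Longrightarrow> x \<in> strip \<Longrightarrow> ((\<lambda>s. T s x) has_vector_derivative Tt t x) (at t within {0..})"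
  using slice_time_derivative[OF smooth_TT] by (simp add: TT_def Tt_def)

lemma at_within_nontrivial:
  assumes "0 \<le> t" shows "at t within {0::real..} \<noteq> bot"
proof -
  have "t islimpt {t..t + 1}" by (simp add: islimpt_Icc)
  then have "t islimpt {0..}" by (rule islimpt_subset) (use assms in auto)
  then show ?thesis by (simp add: trivial_limit_within)
qed

lemma Tt_cong:
  assumes "0 \<le> t" "x \<in> strip" "y \<in> strip" "\<And>s. 0 \<le> s \<Longrightarrow> T s x = T s y"
  shows "Tt t x = Tt t y"
proof -
  have "((\<lambda>s. T s x) has_vector_derivative Tt t y) (at t within {0..})"
    by (rule has_vector_derivative_transform[OF _ _ Tt_derivative]) (use assms in auto)
  then show ?thesis
    using vector_derivative_unique_within[OF at_within_nontrivial] Tt_derivative assms by blast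
qed

lemma periodic_Tt: "0 \<le> t \<Longrightarrow> periodic_xy Lx Ly (Tt t)"
  unfolding periodic_xy_def
proof (intro ballI conjI)
  fix x :: "real^3" assume t: "0 \<le> t" and x: "x \<in> strip"
  have st: "x + axis 1 Lx \<in> strip" "x + axis 2 Ly \<in> strip" using x by (auto simp: strip_def axis_def)
  show "Tt t (x + axis 1 Lx) = Tt t x" "Tt t (x + axis 2 Ly) = Tt t x"
    using periodic_T x by (intro Tt_cong t st x; simp add: periodic_xy_def)+
qed

lemma wall_Tt:
  assumes t: "0 \<le> t" and x: "x \<in> walls"
  shows "Tt t x = 0"
proof -
  have xs: "x \<in> strip" using x by (auto simp: walls_def strip_def)
  have "((\<lambda>s. T s x) has_vector_derivative 0) (at t within {0..})"
    by (rule has_vector_derivative_transform[OF _ _ has_vector_derivative_const[of 0]])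
      (use t x wall_T in auto)
  then show ?thesis
    using vector_derivative_unique_within[OF at_within_nontrivial] Tt_derivative t xs by blast
qed

lemma periodic_advect: "0 \<le> t \<Longrightarrow> periodic_xy Lx Ly (advect (u t) (T t))"
  using periodic_u periodic_pd[OF periodic_T smooth_T] by (simp add: advect_def periodic_xy_def)

text \<open>Horizontal derivatives of T vanish on the walls, and the vertical derivative is
  multiplied by the normal velocity, which is 0 there.\<close>

lemma wall_advect:
  assumes t: "0 \<le> t" and x: "x \<in> walls"
  shows "advect (u t) (T t) x = 0"
proof -
  have "u t x $ j * pd j (T t) x = 0" for j
    using u t x pd_zero_walls[OF smooth_T wall_T, of t j x]
    by (cases "j = 3") (auto simp: admissible_velocity_def)
  then show ?thesis unfolding advect_def by (intro sum.neutral) blast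
qed

lemma smooth_src [smooth_intros]: "0 \<le> t \<Longrightarrow> smooth_on strip (src t)"
  unfolding src_def[abs_def] by (intro smooth_intros)

lemma periodic_src: "0 \<le> t \<Longrightarrow> periodic_xy Lx Ly (src t)"
  using periodic_Tt periodic_advect periodic_laplacian[OF smooth_T periodic_T]
  by (simp add: src_def periodic_xy_def)

lemma divergence_eq_advect:
  assumes t: "0 \<le> t" and x: "x \<in> strip"
  shows "divergence (\<lambda>y. T t y *\<^sub>R u t y) x = advect (u t) (T t) x"
proof -
  have "divergence (\<lambda>y. T t y *\<^sub>R u t y) x = (\<Sum>i\<in>UNIV. pd i (\<lambda>y. T t y * u t y $ i) x)"
    by (simp add: divergence_def)
  also have "\<dots> = (\<Sum>i\<in>UNIV. T t x * pd i (\<lambda>y. u t y $ i) x + pd i (T t) x * u t x $ i)"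
    by (intro sum.cong pd_mult smooth_intros t x refl)
  also have "\<dots> = T t x * divergence (u t) x + advect (u t) (T t) x"
    by (simp add: sum.distrib divergence_def advect_def sum_distrib_left mult.commute)
  finally show ?thesis using u t x by (simp add: admissible_velocity_def)
qed

lemma src_ae:
  assumes t: "0 \<le> t"
  shows "AE x in lebesgue_on (cell Lx Ly). Q x = src t x"
proof -
  have "AE x in lebesgue_on (cell Lx Ly).
        vector_derivative (\<lambda>s. T s x) (at t within {0..}) + divergence (\<lambda>y. T t y *\<^sub>R u t y) x
          = 1 / Pe * laplacian (T t) x + Q x / Pe"
    using T t by (simp add: temperature_solution_def)
  moreover have "AE x in lebesgue_on (cell Lx Ly). x \<in> cell Lx Ly"
    using AE_space[of "lebesgue_on (cell Lx Ly)"] by (simp add: space_restrict_space)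
  ultimately show ?thesis
  proof eventually_elim
    case (elim x)
    note x = cell_strip[OF elim(2)]
    have "vector_derivative (\<lambda>s. T s x) (at t within {0..}) = Tt t x"
      by (rule vector_derivative_within[OF at_within_nontrivial[OF t] Tt_derivative[OF t x]])
    then have "Tt t x + advect (u t) (T t) x = (laplacian (T t) x + Q x) / Pe"
      using elim(1) divergence_eq_advect[OF t x] by (simp add: add_divide_distrib)
    then show ?case using Pe by (simp add: src_def)
  qed
qed

lemma src_time_independent:
  assumes t: "0 \<le> t" and x: "x \<in> strip"
  shows "src t x = q x"
proof (rule periodic_eq_on_strip[OF periodic_src periodic_src _ x])
  fix x assume "x \<in> cell Lx Ly"
  moreover have "AE x in lebesgue_on (cell Lx Ly). src t x = q x"
    using src_ae[OF t] src_ae[OF order_refl] by eventually_elim simp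
  ultimately show "src t x = q x"
    using continuous_AE_eq[OF cont_cell cont_cell] smooth_src t by blast
qed (use t in auto)

definition S :: "real \<Rightarrow> real^3 \<Rightarrow> real" where "S t x = laplacian (T t) x + q x"

lemma evolution: "0 \<le> t \<Longrightarrow> x \<in> strip \<Longrightarrow> S t x = Pe * (Tt t x + advect (u t) (T t) x)"
  using src_time_independent[of t x] by (simp add: S_def src_def)

lemma Tt_eq: "0 \<le> t \<Longrightarrow> x \<in> strip \<Longrightarrow> Tt t x = (1 / Pe) * S t x - advect (u t) (T t) x"
  using evolution[of t x] Pe by simp

lemma smooth_S [smooth_intros]: "0 \<le> t \<Longrightarrow> smooth_on strip (S t)"
  unfolding S_def[abs_def] by (intro smooth_intros) auto

lemma periodic_S: "0 \<le> t \<Longrightarrow> periodic_xy Lx Ly (S t)"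
  using periodic_src[of 0] periodic_laplacian[OF smooth_T periodic_T]
  by (simp add: S_def periodic_xy_def)

lemma wall_S: "0 \<le> t \<Longrightarrow> \<forall>x\<in>walls. S t x = 0"
  using evolution wall_Tt wall_advect by (auto simp: walls_def strip_def)

text \<open>Since 2 T grad T = grad(T^2), integration by parts moves the derivative onto u, which is
  divergence-free; T^2 = 0 on the walls removes the vertical boundary term.\<close>

lemma advection_energy_zero:
  assumes t: "0 \<le> t"
  shows "J (\<lambda>x. T t x * advect (u t) (T t) x) = 0"
proof -
  have "2 * J (\<lambda>x. T t x * advect (u t) (T t) x) = J (\<lambda>x. \<Sum>i\<in>UNIV. u t x $ i * pd i (\<lambda>x. T t x * T t x) x)"
    unfolding J_cmult[symmetric]
    by (rule J_cong) (simp add: advect_def pd_mult smooth_T t cell_strip sum_distrib_left algebra_simps sum.distrib)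
  also have "\<dots> = (\<Sum>i\<in>UNIV. J (\<lambda>x. u t x $ i * pd i (\<lambda>x. T t x * T t x) x))"
    by (intro J_sum cont_cell smooth_intros t) simp
  also have "\<dots> = (\<Sum>i\<in>UNIV. - J (\<lambda>x. pd i (\<lambda>x. u t x $ i) x * (T t x * T t x)))"
    by (intro sum.cong refl IBP smooth_intros t periodic_u periodic_mult periodic_T) (use wall_T[OF t] in auto)
  also have "\<dots> = - J (\<lambda>x. \<Sum>i\<in>UNIV. pd i (\<lambda>x. u t x $ i) x * (T t x * T t x))"
    unfolding sum_negf by (subst J_sum) (auto intro!: cont_cell smooth_intros t)
  \<comment> \<open>Zero is written as a product so that \<open>J_cmult\<close> evaluates the
    integral.\<close>
  also have "J (\<lambda>x. \<Sum>i\<in>UNIV. pd i (\<lambda>x. u t x $ i) x * (T t x * T t x)) = J (\<lambda>x. 0 * 0)"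
  proof (rule J_cong)
    fix x assume "x \<in> cell Lx Ly"
    then have "divergence (u t) x = 0" using u t cell_strip by (simp add: admissible_velocity_def)
    then show "(\<Sum>i\<in>UNIV. pd i (\<lambda>x. u t x $ i) x * (T t x * T t x)) = 0 * 0"
      by (simp add: divergence_def flip: sum_distrib_right)
  qed
  also have "J (\<lambda>x. 0 * 0) = 0" by (subst J_cmult) simp
  finally show ?thesis by simp
qed

abbreviation Q2 :: real where "Q2 \<equiv> sqrt (J (\<lambda>x. (q x)\<^sup>2))"
abbreviation QH :: real where "QH \<equiv> H1 q"

lemma smooth_q [smooth_intros]: "smooth_on strip q"
  by (rule smooth_src) simp

text \<open>The exact balance has derivative 2/Pe times \<integral> T q minus the Dirichlet energy.
  Cauchy-Schwarz and Poincare turn it into an inequality in |T| alone.\<close>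

lemma energy_T:
  assumes t: "0 \<le> t"
  shows "\<exists>y'. ((\<lambda>s. J (\<lambda>x. (T s x)\<^sup>2)) has_vector_derivative y') (at t within {0..}) \<and>
    y' \<le> 2 / Pe * (sqrt (J (\<lambda>x. (T t x)\<^sup>2)) * Q2 - pi\<^sup>2 * J (\<lambda>x. (T t x)\<^sup>2))"
proof -
  have sq: "smooth_on spacetime (\<lambda>p. TT p * TT p)" by (intro smooth_intros smooth_TT)
  have d: "((\<lambda>s. J (\<lambda>x. (T s x)\<^sup>2)) has_vector_derivative J (\<lambda>x. dd spacetime (1, 0) (\<lambda>p. TT p * TT p) (t, x))) (at t within {0..})"
    using J_time_derivative[OF sq t] by (simp add: TT_def power2_eq_square)
  have "J (\<lambda>x. dd spacetime (1, 0) (\<lambda>p. TT p * TT p) (t, x)) =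
      J (\<lambda>x. (2 / Pe) * (T t x * laplacian (T t) x + T t x * q x) - 2 * (T t x * advect (u t) (T t) x))"
  proof (rule J_cong)
    fix x assume "x \<in> cell Lx Ly"
    note x = cell_strip[OF this]
    have "dd spacetime (1, 0) (\<lambda>p. TT p * TT p) (t, x) = 2 * (T t x * Tt t x)"
      by (subst dd_mult[OF fat_spacetime _ smooth_TT smooth_TT])
        (use t x in \<open>auto simp: spacetime_def TT_def Tt_def\<close>)
    then show "dd spacetime (1, 0) (\<lambda>p. TT p * TT p) (t, x) =
       (2 / Pe) * (T t x * laplacian (T t) x + T t x * q x) - 2 * (T t x * advect (u t) (T t) x)"
      using Pe by (simp add: Tt_eq[OF t x] S_def field_simps)
  qed
  also have "\<dots> = (2 / Pe) * (J (\<lambda>x. T t x * laplacian (T t) x) + J (\<lambda>x. T t x * q x)) -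
      2 * J (\<lambda>x. T t x * advect (u t) (T t) x)"
  proof -
    have "J (\<lambda>x. (2 / Pe) * (T t x * laplacian (T t) x + T t x * q x) - 2 * (T t x * advect (u t) (T t) x)) =
        J (\<lambda>x. (2 / Pe) * (T t x * laplacian (T t) x + T t x * q x)) - J (\<lambda>x. 2 * (T t x * advect (u t) (T t) x))"
      by (intro J_diff cont_cell smooth_intros t)
    moreover have "J (\<lambda>x. T t x * laplacian (T t) x + T t x * q x) =
        J (\<lambda>x. T t x * laplacian (T t) x) + J (\<lambda>x. T t x * q x)"
      by (intro J_add cont_cell smooth_intros t)
    ultimately show ?thesis by (simp only: J_cmult)
  qed
  also have "\<dots> = (2 / Pe) * (J (\<lambda>x. T t x * q x) - grad2 (T t))"
    unfolding advection_energy_zero[OF t]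
    using Green_identity[OF smooth_T periodic_T smooth_T periodic_T wall_T] t
    by (simp add: grad2_def power2_eq_square)
  also have "\<dots> \<le> 2 / Pe * (sqrt (J (\<lambda>x. (T t x)\<^sup>2)) * Q2 - pi\<^sup>2 * J (\<lambda>x. (T t x)\<^sup>2))"
  proof (intro mult_left_mono diff_mono)
    show "J (\<lambda>x. T t x * q x) \<le> sqrt (J (\<lambda>x. (T t x)\<^sup>2)) * Q2"
      using J_Cauchy_Schwarz[OF cont_cell[OF smooth_T[OF t]] cont_cell[OF smooth_q]] by (rule order_trans[OF abs_ge_self])
    show "pi\<^sup>2 * J (\<lambda>x. (T t x)\<^sup>2) \<le> grad2 (T t)" by (rule Poincare_grad2[OF smooth_T wall_T]) (rule t)+
  qed (use Pe in simp)
  finally show ?thesis using d by blast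
qed

lemma T_eventually_bounded:
  assumes e: "0 < e"
  shows "\<forall>\<^sub>F t in at_top. sqrt (J (\<lambda>x. (T t x)\<^sup>2)) \<le> Q2 / pi\<^sup>2 + e"
proof -
  obtain y' where y': "\<And>t. 0 \<le> t \<Longrightarrow> ((\<lambda>s. J (\<lambda>x. (T s x)\<^sup>2)) has_vector_derivative y' t) (at t within {0..})"
    "\<And>t. 0 \<le> t \<Longrightarrow> y' t \<le> 2 / Pe * (sqrt (J (\<lambda>x. (T t x)\<^sup>2)) * Q2 - pi\<^sup>2 * J (\<lambda>x. (T t x)\<^sup>2))"
    using energy_T by metis
  have Q0: "0 \<le> Q2" using J_sq_nonneg[OF smooth_q] by simp
  have nn: "0 \<le> J (\<lambda>x. (T t x)\<^sup>2)" if "0 \<le> t" for t using J_sq_nonneg[OF smooth_T[OF that]] .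
  have "\<forall>\<^sub>F t in at_top. J (\<lambda>x. (T t x)\<^sup>2) \<le> (Q2 / pi\<^sup>2 + e)\<^sup>2"
  proof (rule eventually_below_threshold[OF y'(1) order_refl _ _ nn])
    \<comment> \<open>With r the L^2 norm of T, above the threshold both factors of r (\<pi>^2 r -
      Q2) are bounded below, by e and \<pi>^2 e, which yields this uniform rate of decrease.\<close>
    show "0 < 2 / Pe * (e * (pi\<^sup>2 * e))" using Pe e by simp
    fix t :: real assume t: "0 \<le> t" and ge: "(Q2 / pi\<^sup>2 + e)\<^sup>2 \<le> J (\<lambda>x. (T t x)\<^sup>2)"
    let ?r = "sqrt (J (\<lambda>x. (T t x)\<^sup>2))"
    have r: "Q2 / pi\<^sup>2 + e \<le> ?r" using ge by (rule real_le_rsqrt)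
    then have "e \<le> ?r" using Q0 by (auto intro: order_trans[rotated])
    have "pi\<^sup>2 * (Q2 / pi\<^sup>2 + e) \<le> pi\<^sup>2 * ?r" using r by (intro mult_left_mono) auto
    then have "pi\<^sup>2 * e \<le> pi\<^sup>2 * ?r - Q2" by (simp add: distrib_left)
    with \<open>e \<le> ?r\<close> have "e * (pi\<^sup>2 * e) \<le> ?r * (pi\<^sup>2 * ?r - Q2)"
      using e nn[OF t] by (intro mult_mono) auto
    also have "\<dots> = - (?r * Q2 - pi\<^sup>2 * (?r * ?r))" by (simp add: algebra_simps)
    also have "?r * ?r = J (\<lambda>x. (T t x)\<^sup>2)" using nn[OF t] by simp
    finally have "2 / Pe * (e * (pi\<^sup>2 * e)) \<le> 2 / Pe * (- (?r * Q2 - pi\<^sup>2 * J (\<lambda>x. (T t x)\<^sup>2)))"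
      using Pe by (intro mult_left_mono) auto
    then have "2 / Pe * (e * (pi\<^sup>2 * e)) \<le> - (2 / Pe * (?r * Q2 - pi\<^sup>2 * J (\<lambda>x. (T t x)\<^sup>2)))"
      by (simp only: mult_minus_right)
    then show "y' t \<le> - (2 / Pe * (e * (pi\<^sup>2 * e)))" using y'(2)[OF t] by linarith
  qed
  then show ?thesis
    by (rule eventually_mono) (use Q0 e in \<open>auto intro!: real_le_lsqrt\<close>)
qed

text \<open>As q does not depend on time, only the Laplacian of T is differentiated. Moving the time
  derivative inside it uses symmetry of mixed derivatives on \<open>spacetime\<close>, walls and
  initial time included.\<close>

lemma S_time_derivative:
  assumes t: "0 \<le> t" and x: "x \<in> strip"
  shows "smooth_on spacetime (\<lambda>p. S (fst p) (snd p))"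
    and "dd spacetime (1, 0) (\<lambda>p. S (fst p) (snd p)) (t, x) = laplacian (Tt t) x"
proof -
  let ?D = "\<lambda>i. dd spacetime (0, axis i (1::real))"
  let ?L = "\<lambda>p. \<Sum>i\<in>UNIV. ?D i (?D i TT) p"
  have B: "(0, axis i 1) \<in> (Basis :: (real \<times> (real^3)) set)" "(1, 0) \<in> (Basis :: (real \<times> (real^3)) set)" for i
    by (auto simp: Basis_prod_def axis_Basis)
  have sm: "smooth_on spacetime (?D i TT)" "smooth_on spacetime (?D i (?D i TT))"
    "smooth_on spacetime (dd spacetime (1, 0) TT)" "smooth_on spacetime (?D i (dd spacetime (1, 0) TT))" for i
    by (intro smooth_on_dd fat_spacetime smooth_TT)+
  have bl: "bounded_linear (\<lambda>p :: real \<times> (real^3). snd p)" by (rule bounded_linear_snd)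
  have sq: "smooth_on spacetime (\<lambda>p. q (snd p))"
    using smooth_on_affine[OF bl, of spacetime 0 strip q] smooth_q by (auto simp: spacetime_def)
  have two: "pd i (pd i (\<lambda>x. F (s, x))) y = ?D i (?D i F) (s, y)"
    if F: "smooth_on spacetime F" and s: "0 \<le> s" and y: "y \<in> strip" for F :: "real \<times> (real^3) \<Rightarrow> real" and s y i
  proof -
    have "pd i (pd i (\<lambda>x. F (s, x))) y = pd i (\<lambda>x. ?D i F (s, x)) y"
      by (rule pd_cong[OF y]) (rule pd_slice[OF F s])
    also have "\<dots> = ?D i (?D i F) (s, y)"
      by (rule pd_slice[OF smooth_on_dd[OF fat_spacetime F] s y])
    finally show ?thesis .
  qed
  have SL: "S (fst p) (snd p) = ?L p + q (snd p)" if "p \<in> spacetime" for p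
    using that two[OF smooth_TT, of "fst p" "snd p"] by (auto simp: S_def laplacian_def spacetime_def TT_def)
  have sL: "smooth_on spacetime (\<lambda>p. ?L p + q (snd p))" by (intro smooth_intros sm sq)
  then show "smooth_on spacetime (\<lambda>p. S (fst p) (snd p))"
    by (subst smooth_on_cong[OF SL]) auto
  have p: "(t, x) \<in> spacetime" using t x by (simp add: spacetime_def)
  have q0: "dd spacetime (1, 0) (\<lambda>p. q (snd p)) (t, x) = 0"
  proof -
    have "dd spacetime (1, 0) (\<lambda>p. q (0 + snd p)) (t, x) = dd strip (snd (1::real, 0::real^3)) q (0 + snd (t, x))"
      by (rule dd_affine[OF fat_spacetime p fat_strip smooth_q bl]) (auto simp: spacetime_def)
    also have "\<dots> = 0" using dd_strip_expand[OF smooth_q x, of 0] by simp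
    finally show ?thesis by simp
  qed
  have "dd spacetime (1, 0) (\<lambda>p. S (fst p) (snd p)) (t, x) = dd spacetime (1, 0) (\<lambda>p. ?L p + q (snd p)) (t, x)"
    by (rule dd_cong[OF p SL])
  also have "\<dots> = dd spacetime (1, 0) ?L (t, x)"
    by (subst dd_add[OF fat_spacetime p]) (auto intro!: smooth_intros sm sq simp: q0)
  also have "\<dots> = (\<Sum>i\<in>UNIV. dd spacetime (1, 0) (?D i (?D i TT)) (t, x))"
    by (rule dd_sum[OF fat_spacetime p sm(2)])
  also have "\<dots> = (\<Sum>i\<in>UNIV. ?D i (?D i (dd spacetime (1, 0) TT)) (t, x))"
  proof (rule sum.cong[OF refl])
    fix i
    have "dd spacetime (1, 0) (?D i (?D i TT)) (t, x) = ?D i (dd spacetime (1, 0) (?D i TT)) (t, x)"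
      by (rule dd_symmetric[OF fat_spacetime sm(1) p B(2) B(1)])
    also have "\<dots> = ?D i (?D i (dd spacetime (1, 0) TT)) (t, x)"
      by (rule dd_cong[OF p]) (rule dd_symmetric[OF fat_spacetime smooth_TT _ B(2) B(1)])
    finally show "dd spacetime (1, 0) (?D i (?D i TT)) (t, x) = ?D i (?D i (dd spacetime (1, 0) TT)) (t, x)" .
  qed
  also have "\<dots> = laplacian (Tt t) x"
    using two[OF sm(3) t x] by (simp add: laplacian_def Tt_def[abs_def])
  finally show "dd spacetime (1, 0) (\<lambda>p. S (fst p) (snd p)) (t, x) = laplacian (Tt t) x" .
qed

text \<open>Green's identity leaves - \<integral> grad S . grad T_t, and T_t = S/Pe - u . grad T
  there. Thus the advection term is differentiated only once and \<open>grad_advect_le\<close>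
  applies; the result is an inequality in |grad S|.\<close>

lemma energy_S:
  assumes t: "0 \<le> t"
  shows "\<exists>y'. ((\<lambda>s. J (\<lambda>x. (S s x)\<^sup>2)) has_vector_derivative y') (at t within {0..}) \<and>
    y' \<le> 2 * sqrt (grad2 (S t)) * (speed Cinf CS0 (u t) * (sqrt (1 + pi\<^sup>2) / pi * sqrt (grad2 (S t)) + QH)
       - sqrt (grad2 (S t)) / Pe)"
proof -
  let ?S = "\<lambda>p. S (fst p) (snd p)" and ?K = "advect (u t) (T t)" and ?G = "sqrt (grad2 (S t))"
  have G0: "0 \<le> grad2 (S t)" by (rule grad2_nonneg[OF smooth_S[OF t]])
  have smS: "smooth_on spacetime ?S" using S_time_derivative(1)[of 0 0] by (simp add: strip_def)
  have sq: "smooth_on spacetime (\<lambda>p. ?S p * ?S p)" by (intro smooth_intros smS)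
  have K: "smooth_on strip ?K" by (intro smooth_intros t)
  have d: "((\<lambda>s. J (\<lambda>x. (S s x)\<^sup>2)) has_vector_derivative J (\<lambda>x. dd spacetime (1, 0) (\<lambda>p. ?S p * ?S p) (t, x))) (at t within {0..})"
    using J_time_derivative[OF sq t] by (simp add: power2_eq_square)
  have pdTt: "pd i (Tt t) x = (1 / Pe) * pd i (S t) x - pd i ?K x" if x: "x \<in> strip" for i x
  proof -
    have "pd i (Tt t) x = pd i (\<lambda>x. (1 / Pe) * S t x - ?K x) x"
      by (rule pd_cong[OF x]) (rule Tt_eq[OF t])
    also have "\<dots> = pd i (\<lambda>x. (1 / Pe) * S t x) x - pd i ?K x"
      by (intro pd_diff smooth_intros t x)
    also have "pd i (\<lambda>x. (1 / Pe) * S t x) x = (1 / Pe) * pd i (S t) x"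
      by (rule pd_cmult[OF smooth_S[OF t] x])
    finally show ?thesis .
  qed
  have "J (\<lambda>x. dd spacetime (1, 0) (\<lambda>p. ?S p * ?S p) (t, x)) = J (\<lambda>x. 2 * (S t x * laplacian (Tt t) x))"
  proof (rule J_cong)
    fix x assume "x \<in> cell Lx Ly"
    note x = cell_strip[OF this]
    show "dd spacetime (1, 0) (\<lambda>p. ?S p * ?S p) (t, x) = 2 * (S t x * laplacian (Tt t) x)"
      by (subst dd_mult[OF fat_spacetime _ smS smS])
        (use t x S_time_derivative(2)[OF t x] in \<open>auto simp: spacetime_def\<close>)
  qed
  also have "\<dots> = 2 * - (\<Sum>i\<in>UNIV. J (\<lambda>x. pd i (S t) x * pd i (Tt t) x))"
    unfolding J_cmult by (subst Green_identity) (use t in \<open>auto intro: smooth_intros periodic_S periodic_Tt simp: wall_S\<close>)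
  also have "(\<Sum>i\<in>UNIV. J (\<lambda>x. pd i (S t) x * pd i (Tt t) x)) =
      (\<Sum>i\<in>UNIV. (1 / Pe) * J (\<lambda>x. (pd i (S t) x)\<^sup>2) - J (\<lambda>x. pd i (S t) x * pd i ?K x))"
  proof (rule sum.cong[OF refl])
    fix i
    have "J (\<lambda>x. pd i (S t) x * pd i (Tt t) x) =
        J (\<lambda>x. (1 / Pe) * (pd i (S t) x)\<^sup>2 - pd i (S t) x * pd i ?K x)"
      by (rule J_cong) (simp add: pdTt[OF cell_strip] power2_eq_square algebra_simps)
    also have "\<dots> = J (\<lambda>x. (1 / Pe) * (pd i (S t) x)\<^sup>2) - J (\<lambda>x. pd i (S t) x * pd i ?K x)"
      by (intro J_diff cont_cell smooth_intros t)
    finally show "J (\<lambda>x. pd i (S t) x * pd i (Tt t) x) =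
        (1 / Pe) * J (\<lambda>x. (pd i (S t) x)\<^sup>2) - J (\<lambda>x. pd i (S t) x * pd i ?K x)"
      unfolding J_cmult .
  qed
  also have "2 * - \<dots> = 2 * ((\<Sum>i\<in>UNIV. J (\<lambda>x. pd i (S t) x * pd i ?K x)) - (1 / Pe) * grad2 (S t))"
    by (simp add: sum_subtractf grad2_def sum_distrib_left)
  also have "\<dots> \<le> 2 * (?G * sqrt (grad2 ?K) - (1 / Pe) * (?G * ?G))"
  proof (rule mult_left_mono[OF diff_mono])
    show "(\<Sum>i\<in>UNIV. J (\<lambda>x. pd i (S t) x * pd i ?K x)) \<le> ?G * sqrt (grad2 ?K)"
      unfolding grad2_def by (rule J_sum_Cauchy_Schwarz) (intro cont_cell smooth_intros t)+
    show "(1 / Pe) * (?G * ?G) \<le> (1 / Pe) * grad2 (S t)" using G0 by simp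
  qed simp
  also have "\<dots> \<le> 2 * (?G * (speed Cinf CS0 (u t) * (sqrt (1 + pi\<^sup>2) / pi * ?G + QH)) - (1 / Pe) * (?G * ?G))"
  proof (intro mult_left_mono diff_right_mono)
    have "sqrt (grad2 ?K) \<le> speed Cinf CS0 (u t) * H1 (laplacian (T t))"
      by (rule grad_advect_le[OF sobolev smooth_T[OF t] periodic_T[OF t] wall_T[OF t] smooth_u[OF t]])
    also have "\<dots> \<le> speed Cinf CS0 (u t) * (sqrt (1 + pi\<^sup>2) / pi * ?G + QH)"
    proof (rule mult_left_mono)
      \<comment> \<open>The elliptic constants require the H^1 norm of the Laplacian of T, which is
        traded here for that of S plus the H^1 norm of q.\<close>
      have "laplacian (T t) = (\<lambda>x. S t x - q x)" by (simp add: S_def)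
      then have "H1 (laplacian (T t)) \<le> H1 (S t) + QH"
        using H1_triangle[OF smooth_S[OF t] smooth_q] by simp
      \<comment> \<open>Poincare bounds |S|^2 by |grad S|^2/\<pi>^2; this is the source of the
        factor sqrt(1 + \<pi>^2)/\<pi>.\<close>
      also have "H1 (S t) \<le> sqrt (1 + pi\<^sup>2) / pi * ?G"
      proof -
        have "pi\<^sup>2 * J (\<lambda>x. (S t x)\<^sup>2) \<le> grad2 (S t)" by (rule Poincare_grad2[OF smooth_S wall_S]) (rule t)+
        then have "J (\<lambda>x. (S t x)\<^sup>2) + grad2 (S t) \<le> (1 + pi\<^sup>2) / pi\<^sup>2 * grad2 (S t)"
          by (simp add: field_simps)
        then have "H1 (S t) \<le> sqrt ((1 + pi\<^sup>2) / pi\<^sup>2 * grad2 (S t))"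
          unfolding H1_def by (rule real_sqrt_le_mono)
        then show ?thesis by (simp add: real_sqrt_mult real_sqrt_divide)
      qed
      finally show "H1 (laplacian (T t)) \<le> sqrt (1 + pi\<^sup>2) / pi * ?G + QH" by simp
      have "0 \<le> J (\<lambda>x. norm (u t x) ^ 3)" "0 \<le> J (\<lambda>x. (norm (grad (u t) x))\<^sup>2)"
        using smooth_on_continuous[OF smooth_u[OF t]] continuous_on_grad[OF smooth_u[OF t]]
        by (auto intro!: J_nonneg continuous_intros cont_cell2)
      then show "0 \<le> speed Cinf CS0 (u t)"
        using sobolev by (auto simp: speed_def sobolev_elliptic_consts_def)
    qed
    finally show "sqrt (grad2 ?K) \<le> speed Cinf CS0 (u t) * (sqrt (1 + pi\<^sup>2) / pi * ?G + QH)" .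
  qed (use G0 in auto)
  also have "\<dots> = 2 * ?G * (speed Cinf CS0 (u t) * (sqrt (1 + pi\<^sup>2) / pi * ?G + QH) - ?G / Pe)"
    by (simp add: algebra_simps)
  finally show ?thesis using d by blast
qed

lemma S_eventually_bounded:
  assumes e: "0 < e" and U: "\<forall>\<^sub>F t in at_top. speed Cinf CS0 (u t) \<le> U" "0 \<le> U"
    and small: "sqrt (1 + pi\<^sup>2) * U * Pe < pi"
  shows "\<forall>\<^sub>F t in at_top. sqrt (J (\<lambda>x. (S t x)\<^sup>2)) \<le> U * Pe * QH / (pi - sqrt (1 + pi\<^sup>2) * U * Pe) + e"
proof -
  obtain y' where y': "\<And>t. 0 \<le> t \<Longrightarrow> ((\<lambda>s. J (\<lambda>x. (S s x)\<^sup>2)) has_vector_derivative y' t) (at t within {0..})"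
    "\<And>t. 0 \<le> t \<Longrightarrow> y' t \<le> 2 * sqrt (grad2 (S t)) * (speed Cinf CS0 (u t) * (sqrt (1 + pi\<^sup>2) / pi * sqrt (grad2 (S t)) + QH)
       - sqrt (grad2 (S t)) / Pe)"
    using energy_S by metis
  obtain t1 where t1: "\<And>t. t1 \<le> t \<Longrightarrow> speed Cinf CS0 (u t) \<le> U"
    using U(1) by (auto simp: eventually_at_top_linorder)
  define t0 where "t0 = max 0 t1"
  have QH0: "0 \<le> QH" unfolding H1_def using J_sq_nonneg[OF smooth_q] grad2_nonneg[OF smooth_q] by simp
  \<comment> \<open>The dissipation that remains after advection has taken its share; it is positive
    because of \<open>small\<close>.\<close>
  define \<alpha> where "\<alpha> = 1 / Pe - U * sqrt (1 + pi\<^sup>2) / pi"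
  \<comment> \<open>The level of |S| at which the lower bound \<alpha> \<pi> |S| for the remaining
    damping equals the forcing U QH, see \<open>\<alpha>r\<close>.\<close>
  define r where "r = U * Pe * QH / (pi - sqrt (1 + pi\<^sup>2) * U * Pe)"
  have \<alpha>: "0 < \<alpha>" using small Pe by (simp add: \<alpha>_def field_simps)
  have r0: "0 \<le> r" using QH0 U(2) Pe small by (simp add: r_def)
  have \<alpha>r: "\<alpha> * (pi * r) = U * QH"
  proof -
    have "\<alpha> * pi * Pe = pi - sqrt (1 + pi\<^sup>2) * U * Pe" using Pe by (simp add: \<alpha>_def field_simps)
    then have "\<alpha> * pi * Pe * r = U * Pe * QH" using small by (simp add: r_def)
    then show ?thesis using Pe by (simp add: mult_ac)
  qed
  have nn: "0 \<le> J (\<lambda>x. (S t x)\<^sup>2)" if "0 \<le> t" for t using J_sq_nonneg[OF smooth_S[OF that]] .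
  have "\<forall>\<^sub>F t in at_top. J (\<lambda>x. (S t x)\<^sup>2) \<le> (r + e)\<^sup>2"
  proof (rule eventually_below_threshold[of t0])
    show "0 < 2 * (pi * e) * (\<alpha> * (pi * e))" using \<alpha> e by simp
    show "0 \<le> t0" by (simp add: t0_def)
    fix t :: real assume "t0 \<le> t"
    then have t: "0 \<le> t" and Ut: "speed Cinf CS0 (u t) \<le> U" using t1 by (auto simp: t0_def)
    show "((\<lambda>s. J (\<lambda>x. (S s x)\<^sup>2)) has_vector_derivative y' t) (at t within {0..})" by (rule y'(1)[OF t])
    show "0 \<le> J (\<lambda>x. (S t x)\<^sup>2)" by (rule nn[OF t])
    assume ge: "(r + e)\<^sup>2 \<le> J (\<lambda>x. (S t x)\<^sup>2)"
    let ?G = "sqrt (grad2 (S t))"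
    have G0: "0 \<le> ?G" using grad2_nonneg[OF smooth_S[OF t]] by simp
    have "pi\<^sup>2 * (r + e)\<^sup>2 \<le> grad2 (S t)"
      \<comment> \<open>Poincare turns the assumed lower bound on |S| into one on |grad S|, the
        quantity in which \<open>energy_S\<close> is expressed.\<close>
      by (rule order_trans[OF mult_left_mono[OF ge] Poincare_grad2[OF smooth_S[OF t] wall_S[OF t]]]) simp
    then have G: "pi * (r + e) \<le> ?G" by (intro real_le_rsqrt) (simp add: power_mult_distrib)
    have Gpe: "pi * e \<le> ?G" using G r0 by (rule_tac order_trans[OF _ G]) simp
    have "\<alpha> * (pi * (r + e)) \<le> \<alpha> * ?G" using G \<alpha> by (intro mult_left_mono) auto
    then have "\<alpha> * (pi * e) \<le> \<alpha> * ?G - U * QH" using \<alpha>r by (simp add: algebra_simps)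
    then have "2 * (pi * e) * (\<alpha> * (pi * e)) \<le> 2 * ?G * (\<alpha> * ?G - U * QH)"
      using Gpe e \<alpha> G0 by (intro mult_mono) auto
    also have "\<dots> = - (2 * ?G * (U * (sqrt (1 + pi\<^sup>2) / pi * ?G + QH) - ?G / Pe))"
      by (simp add: \<alpha>_def algebra_simps)
    finally have 1: "2 * ?G * (U * (sqrt (1 + pi\<^sup>2) / pi * ?G + QH) - ?G / Pe) \<le> - (2 * (pi * e) * (\<alpha> * (pi * e)))"
      by simp
    have "2 * ?G * (speed Cinf CS0 (u t) * (sqrt (1 + pi\<^sup>2) / pi * ?G + QH) - ?G / Pe) \<le>
        2 * ?G * (U * (sqrt (1 + pi\<^sup>2) / pi * ?G + QH) - ?G / Pe)"
      using G0 QH0 Ut by (intro mult_left_mono diff_right_mono mult_right_mono) auto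
    then show "y' t \<le> - (2 * (pi * e) * (\<alpha> * (pi * e)))" using y'(2)[OF t] 1 by linarith
  qed
  then show ?thesis
    unfolding r_def[symmetric] by (rule eventually_mono) (use r0 e in \<open>auto intro!: real_le_lsqrt\<close>)
qed

text \<open>The Laplacian of T is S - q, so the eventual bounds on T and S provide both inputs of
  \<open>static_estimate\<close> at all late times.\<close>

lemma norm_bounded_by_energies:
  assumes e: "0 < e" and U: "\<forall>\<^sub>F t in at_top. speed Cinf CS0 (u t) \<le> U" "0 \<le> U"
    and small: "sqrt (1 + pi\<^sup>2) * U * Pe < pi"
  shows "\<forall>\<^sub>F t in at_top. Lp_norm 3 (cell Lx Ly) (grad_xy (zint (T t))) \<le>
    ennreal (b3 * CS Lx Ly powr (1 / 2) * (Q2 / pi\<^sup>2 + e) powr (1 / 4) *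
      (U * Pe * QH / (pi - sqrt (1 + pi\<^sup>2) * U * Pe) + e + Q2) powr (3 / 4))"
  using T_eventually_bounded[OF e] S_eventually_bounded[OF e U small] eventually_ge_at_top[of 0]
proof eventually_elim
  case (elim t)
  have "sqrt (J (\<lambda>x. (laplacian (T t) x)\<^sup>2)) = sqrt (J (\<lambda>x. (S t x + - q x)\<^sup>2))"
    by (simp add: S_def)
  also have "\<dots> \<le> sqrt (J (\<lambda>x. (S t x)\<^sup>2)) + sqrt (J (\<lambda>x. (- q x)\<^sup>2))"
    unfolding J_def cell_def
    by (rule integral_Minkowski)
      (use cont_cell[OF smooth_S[OF elim(3)]] cont_cell[OF smooth_q] in \<open>auto simp: cell_def intro: continuous_on_minus\<close>)
  finally have "sqrt (J (\<lambda>x. (laplacian (T t) x)\<^sup>2)) \<le> U * Pe * QH / (pi - sqrt (1 + pi\<^sup>2) * U * Pe) + e + Q2"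
    using elim(2) by simp
  then show ?case
    by (rule static_estimate[OF smooth_T[OF elim(3)] periodic_T[OF elim(3)] wall_T[OF elim(3)] elim(1)])
qed

text \<open>Each upper limit in \<open>U_infty\<close> is eventually exceeded by less than a margin
  h, and h is chosen so that the two weighted margins add up to d.\<close>

lemma speed_eventually_le:
  assumes fin: "U_infty Lx Ly Cinf CS0 u < \<infinity>" and d: "0 < d"
  shows "\<forall>\<^sub>F t in at_top. speed Cinf CS0 (u t) \<le> enn2real (U_infty Lx Ly Cinf CS0 u) + d"
proof -
  have pos: "0 < Cinf" "0 < CS0" using sobolev by (auto simp: sobolev_elliptic_consts_def)
  define L3 where "L3 = Limsup at_top (\<lambda>t. Lp_norm 3 (cell Lx Ly) (u t))"
  define L2 where "L2 = Limsup at_top (\<lambda>t. Lp_norm 2 (cell Lx Ly) (grad (u t)))"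
  have U: "U_infty Lx Ly Cinf CS0 u = ennreal CS0 * L3 + ennreal Cinf * L2"
    by (simp add: U_infty_def L3_def L2_def)
  have "L3 < \<infinity>" "L2 < \<infinity>"
    using fin pos unfolding U by (auto simp: ennreal_mult_less_top less_top)
  then obtain l3 l2 where l: "0 \<le> l3" "L3 = ennreal l3" "0 \<le> l2" "L2 = ennreal l2"
    by (cases L3; cases L2) auto
  have U_real: "enn2real (U_infty Lx Ly Cinf CS0 u) = CS0 * l3 + Cinf * l2"
    unfolding U l using pos l by (simp add: ennreal_mult[symmetric] ennreal_plus[symmetric] del: ennreal_plus)
  define h where "h = d / (CS0 + Cinf)"
  have h: "0 < h" using d pos by (simp add: h_def)
  have "(CS0 + Cinf) * h = d" using pos by (simp add: h_def)
  then have hd: "CS0 * h + Cinf * h = d" by (simp only: distrib_right)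
  have "Limsup at_top (\<lambda>t. Lp_norm 3 (cell Lx Ly) (u t)) < ennreal (l3 + h)"
    "Limsup at_top (\<lambda>t. Lp_norm 2 (cell Lx Ly) (grad (u t))) < ennreal (l2 + h)"
    using l h unfolding L3_def[symmetric] L2_def[symmetric] by (auto intro!: ennreal_lessI)
  then have "\<forall>\<^sub>F t in at_top. Lp_norm 3 (cell Lx Ly) (u t) < ennreal (l3 + h)"
    "\<forall>\<^sub>F t in at_top. Lp_norm 2 (cell Lx Ly) (grad (u t)) < ennreal (l2 + h)"
    by (auto dest: Limsup_lessD)
  then show ?thesis
    using eventually_ge_at_top[of 0]
  proof eventually_elim
    case (elim t)
    have "root 3 (J (\<lambda>x. norm (u t x) ^ 3)) \<le> l3 + h"
      using less_imp_le[OF elim(1)] l h unfolding Lp_norm_J(2)[OF smooth_on_continuous[OF smooth_u[OF elim(3)]]]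
      by (simp del: ennreal_plus)
    moreover have "sqrt (J (\<lambda>x. (norm (grad (u t) x))\<^sup>2)) \<le> l2 + h"
      using less_imp_le[OF elim(2)] l h unfolding Lp_norm_J(1)[OF continuous_on_grad[OF smooth_u[OF elim(3)]]]
      by (simp del: ennreal_plus)
    ultimately have "speed Cinf CS0 (u t) \<le> CS0 * (l3 + h) + Cinf * (l2 + h)"
      unfolding speed_def using pos by (intro add_mono mult_left_mono) auto
    also have "\<dots> = enn2real (U_infty Lx Ly Cinf CS0 u) + d"
      unfolding U_real hd[symmetric] by (simp add: algebra_simps)
    finally show ?case .
  qed
qed

lemma limsup_bound:
  assumes small: "U_infty Lx Ly Cinf CS0 u * ennreal Pe < ennreal (pi / sqrt (1 + pi\<^sup>2))"
  shows "Limsup at_top (\<lambda>t. Lp_norm 3 (cell Lx Ly) (grad_xy (zint (T t))))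
    \<le> ennreal (R3 Lx Ly Pe (enn2real (U_infty Lx Ly Cinf CS0 u)) Q)"
proof -
  let ?U = "U_infty Lx Ly Cinf CS0 u" and ?u = "enn2real (U_infty Lx Ly Cinf CS0 u)"
  \<comment> \<open>Finiteness is part of the smallness condition, because an infinite value times a
    positive Pe is infinite. It allows the remaining computation to take place in the reals.\<close>
  have fin: "?U < \<infinity>"
  proof (rule ccontr)
    assume "\<not> ?U < \<infinity>"
    then have "?U * ennreal Pe = \<infinity>" using Pe by (simp add: less_top[symmetric] ennreal_top_mult)
    then show False using small by simp
  qed
  have "ennreal (?u * Pe) < ennreal (pi / sqrt (1 + pi\<^sup>2))"
    using small fin Pe by (simp add: ennreal_mult)
  then have "?u * Pe < pi / sqrt (1 + pi\<^sup>2)" by (simp add: ennreal_less_iff Pe less_imp_le)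
  then have "?u * Pe * sqrt (1 + pi\<^sup>2) < pi" by (simp add: pos_less_divide_eq add_pos_nonneg)
  then have lt: "sqrt (1 + pi\<^sup>2) * ?u * Pe < pi" by (simp add: mult_ac)
  have Q2: "enn2real (Lp_norm 2 (cell Lx Ly) Q) = Q2"
    unfolding wgrad_of_ae_smooth_on_cell(2)[OF Q smooth_q src_ae[OF order_refl]]
      Lp_norm_J(1)[OF smooth_on_continuous[OF smooth_q]]
    using J_sq_nonneg[OF smooth_q] by simp
  have QH: "enn2real (H1_norm (cell Lx Ly) Q) = QH"
    using H1_norm_eq[OF smooth_q wgrad_of_ae_smooth_on_cell(2,1)[OF Q smooth_q src_ae[OF order_refl]]]
      J_sq_nonneg[OF smooth_q] grad2_nonneg[OF smooth_q] by (simp add: H1_def)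
  have nn: "0 \<le> Q2" "0 \<le> QH"
    using J_sq_nonneg[OF smooth_q] grad2_nonneg[OF smooth_q] by (auto simp: H1_def)
  \<comment> \<open>A single e serves as margin for the velocity, for T and for S. The strict
    inequality \<open>lt\<close> keeps the denominator positive for small e, and the claim follows
    as e decreases to 0.\<close>
  define h where "h e = b3 * CS Lx Ly powr (1 / 2) * (Q2 / pi\<^sup>2 + e) powr (1 / 4) *
      ((?u + e) * Pe * QH / (pi - sqrt (1 + pi\<^sup>2) * (?u + e) * Pe) + e + Q2) powr (3 / 4)" for e
  have sm: "\<forall>\<^sub>F e in at_right 0. sqrt (1 + pi\<^sup>2) * (?u + e) * Pe < pi"
  proof (rule order_tendstoD(2))
    show "((\<lambda>e. sqrt (1 + pi\<^sup>2) * (?u + e) * Pe) \<longlongrightarrow> sqrt (1 + pi\<^sup>2) * (?u + 0) * Pe) (at_right 0)"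
      by (intro tendsto_intros)
  qed (use lt in simp)
  have pos: "\<forall>\<^sub>F e in at_right (0::real). 0 < e" by (rule eventually_at_right_less)
  have "(h \<longlongrightarrow> h 0) (at_right 0)"
    unfolding h_def
  proof (intro tendsto_mult tendsto_const tendsto_powr2 tendsto_add tendsto_divide tendsto_diff tendsto_ident_at)
    \<comment> \<open>\<open>tendsto_powr2\<close> requires only eventually nonnegative bases, so it
      covers the limiting base 0 that occurs when Q2 = 0.\<close>
    show "\<forall>\<^sub>F e in at_right 0. 0 \<le> Q2 / pi\<^sup>2 + e" using pos by eventually_elim (use nn in simp)
    show "\<forall>\<^sub>F e in at_right 0. 0 \<le> (?u + e) * Pe * QH / (pi - sqrt (1 + pi\<^sup>2) * (?u + e) * Pe) + e + Q2"
      using pos sm by eventually_elim (use nn Pe in simp)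
  qed (use lt in auto)
  then have "((\<lambda>e. ennreal (h e)) \<longlongrightarrow> ennreal (h 0)) (at_right 0)" by (rule tendsto_ennrealI)
  moreover have "\<forall>\<^sub>F e in at_right 0. Limsup at_top (\<lambda>t. Lp_norm 3 (cell Lx Ly) (grad_xy (zint (T t)))) \<le> ennreal (h e)"
    using pos sm
  proof eventually_elim
    case (elim e)
    show ?case
      unfolding h_def
      by (rule Limsup_bounded[OF norm_bounded_by_energies[OF elim(1) speed_eventually_le[OF fin elim(1)]]])
        (use elim in auto)
  qed
  ultimately have "Limsup at_top (\<lambda>t. Lp_norm 3 (cell Lx Ly) (grad_xy (zint (T t)))) \<le> ennreal (h 0)"
    by (rule tendsto_lowerbound) simp
  also have "h 0 = R3 Lx Ly Pe ?u Q"
  proof -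
    \<comment> \<open>The fourth root of the factor 1/\<pi>^2 in the bound on T is the 1/sqrt \<pi>
      of \<open>R3\<close>.\<close>
    have "(pi\<^sup>2) powr (1 / 4) = sqrt pi"
      by (simp add: powr_powr flip: powr_numeral powr_half_sqrt)
    then have "(Q2 / pi\<^sup>2) powr (1 / 4) = Q2 powr (1 / 4) / sqrt pi" using nn by (simp add: powr_divide)
    then show ?thesis unfolding h_def R3_def Let_def Q2 QH by simp
  qed
  finally show ?thesis .
qed

end

theorem theorem4p1:
  fixes Lx Ly Pe Cinf CS0 :: real
    and u :: "real \<Rightarrow> real^3 \<Rightarrow> real^3"
    and T :: "real \<Rightarrow> real^3 \<Rightarrow> real"
    and Q :: "real^3 \<Rightarrow> real"
  assumes "0 < Lx" and "0 < Ly" and "0 < Pe"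
    and "sobolev_elliptic_consts Lx Ly Cinf CS0"
    and "admissible_velocity Lx Ly u"
    and "H_per 1 Lx Ly Q"
    and "temperature_solution Lx Ly Pe Q u T"
    and "U_infty Lx Ly Cinf CS0 u * ennreal Pe < ennreal (pi / sqrt (1 + pi\<^sup>2))"
  shows "Limsup at_top (\<lambda>t. Lp_norm 3 (cell Lx Ly) (grad_xy (zint (T t))))
    \<le> ennreal (R3 Lx Ly Pe (enn2real (U_infty Lx Ly Cinf CS0 u)) Q)"
proof -
  interpret convection Lx Ly Pe Cinf CS0 u T Q
    by unfold_locales (fact assms)+
  show ?thesis by (rule limsup_bound[OF assms(8)])
qed

end
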